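(* Let $q$ be a prime power and $n\ge1$, $r>2$ integers. Suppose that for every divisor $k$ of $n$ with $k<n$, the pair $(q^k,n/k)$ is not a Dickson number pair and is not one of the pairs $(5,2),(7,2),(11,2),(23,2),(29,2),(59,2)$. If an $(n-1)$-spread $\mathcal{S}$ of $\mathrm{PG}(rn-1,q)$ contains $r$ normal elements in general position, then $\mathcal{S}$ is a Desarguesian spread.
   Context: An $(n-1)$-spread of $\mathrm{PG}(N-1,q)$ is a set of $(n-1)$-dimensional subspaces partitioning the point set. An element $E$ of an $(n-1)$-spread $\mathcal{S}$ of $\mathrm{PG}(rn-1,q)$ is normal if for every $F\in\mathcal{S}\setminus\{E\}$ the $(2n-1)$-space $\langle E,F\rangle$ is partitioned by elements of $\mathcal{S}$. A set of $(n-1)$-spaces of $\mathrm{PG}(rn-1,q)$ is in general position if any $r$ of them span the whole space. A Desarguesian spread of $\mathrm{PG}(rn-1,q)$ is (any spread projectively equivalent to) the spread obtained by field reduction: regard $V(r,q^n)=\mathbb{F}_{q^n}^r$ as an $rn$-dimensional $\mathbb{F}_q$-vector space; each $1$-dimensional $\mathbb{F}_{q^n}$-subspace becomes an $n$-dimensional $\mathbb{F}_q$-subspace, i.e. an $(n-1)$-space of $\mathrm{PG}(rn-1,q)$, and these form the spread. A pair of positive integers $(Q,m)$ is a Dickson number pair if (i) $Q=p^h$ for a prime $p$; (ii) each prime divisor of $m$ divides $Q-1$; (iii) if $Q\equiv 3\pmod 4$ then $m\not\equiv 0\pmod 4$. *)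

theory Defs
  imports
    "HOL-Analysis.Cartesian_Space"
    "HOL-Algebra.Algebraic_Closure_Type"
    "HOL-Library.Disjoint_Sets"
    "HOL-Library.FuncSet"
    "HOL-Number_Theory.Prime_Powers"
begin

text \<open>
  \<open>PG(N-1,q)\<close> is the projective space of the vector space \<open>'a ^ 'd\<close>, where \<open>CARD('a) = q\<close> and
  \<open>CARD('d) = N\<close>. A projective \<open>(k-1)\<close>-space is represented by the underlying \<open>k\<close>-dimensional
  vector subspace, so that \<open>vec.dim\<close> below is always one more than the projective dimension;
  \<open>\<langle>E, F\<rangle>\<close> is \<open>vec.span (E \<union> F)\<close>.
\<close>

definition vsubspaces :: "nat \<Rightarrow> ('a::field ^ 'd) set set" where
  "vsubspaces k = {U. vec.subspace U \<and> vec.dim U = k}"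

definition pg_points :: "('a::field ^ 'd) set \<Rightarrow> ('a ^ 'd) set set" where
  "pg_points U = {P \<in> vsubspaces 1. P \<subseteq> U}"

text \<open>Distinct subspaces have distinct point sets, so the image below does not identify elements
  of \<open>T\<close>.\<close>

definition partitions_points :: "('a::field ^ 'd) set \<Rightarrow> ('a ^ 'd) set set \<Rightarrow> bool" where
  "partitions_points U T \<longleftrightarrow> partition_on (pg_points U) (pg_points ` T)"

definition spread :: "nat \<Rightarrow> ('a::field ^ 'd) set set \<Rightarrow> bool" where
  "spread n S \<longleftrightarrow> S \<subseteq> vsubspaces n \<and> partitions_points UNIV S"

definition normal_element :: "('a::field ^ 'd) set set \<Rightarrow> ('a ^ 'd) set \<Rightarrow> bool" where
  "normal_element S E \<longleftrightarrow>
     E \<in> S \<and> (\<forall>F\<in>S - {E}. \<exists>T\<subseteq>S. partitions_points (vec.span (E \<union> F)) T)"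

definition general_position :: "nat \<Rightarrow> ('a::field ^ 'd) set set \<Rightarrow> bool" where
  "general_position r A \<longleftrightarrow> (\<forall>B\<subseteq>A. card B = r \<longrightarrow> vec.span (\<Union>B) = UNIV)"

definition projectively_equivalent ::
    "('a::field ^ 'd) set set \<Rightarrow> ('a ^ 'd) set set \<Rightarrow> bool" where
  "projectively_equivalent S T \<longleftrightarrow>
     (\<exists>g. Vector_Spaces.linear (*s) (*s) g \<and> bij g \<and> S = (\<lambda>U. g ` U) ` T)"

text \<open>The coordinate space \<open>V(r, L)\<close> over a field \<open>L\<close>.\<close>

definition coord_space :: "('l, 'm) ring_scheme \<Rightarrow> nat \<Rightarrow> (nat \<Rightarrow> 'l) set" where
  "coord_space L r = {..<r} \<rightarrow>\<^sub>E carrier L"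

definition coord_add ::
    "('l, 'm) ring_scheme \<Rightarrow> nat \<Rightarrow> (nat \<Rightarrow> 'l) \<Rightarrow> (nat \<Rightarrow> 'l) \<Rightarrow> (nat \<Rightarrow> 'l)" where
  "coord_add L r v w = (\<lambda>i\<in>{..<r}. v i \<oplus>\<^bsub>L\<^esub> w i)"

definition coord_scale ::
    "('l, 'm) ring_scheme \<Rightarrow> nat \<Rightarrow> 'l \<Rightarrow> (nat \<Rightarrow> 'l) \<Rightarrow> (nat \<Rightarrow> 'l)" where
  "coord_scale L r c v = (\<lambda>i\<in>{..<r}. c \<otimes>\<^bsub>L\<^esub> v i)"

definition coord_zero :: "('l, 'm) ring_scheme \<Rightarrow> nat \<Rightarrow> (nat \<Rightarrow> 'l)" where
  "coord_zero L r = (\<lambda>i\<in>{..<r}. \<zero>\<^bsub>L\<^esub>)"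

definition one_dim_subspaces :: "('l, 'm) ring_scheme \<Rightarrow> nat \<Rightarrow> (nat \<Rightarrow> 'l) set set" where
  "one_dim_subspaces L r =
     {{coord_scale L r c v | c. c \<in> carrier L} | v. v \<in> coord_space L r - {coord_zero L r}}"

text \<open>An identification \<open>\<phi>\<close> of \<open>V(r, L)\<close>, regarded as a vector space over \<open>'a\<close> by means of the
  field embedding \<open>\<iota>\<close> of \<open>'a\<close> into \<open>L\<close>, with \<open>'a ^ 'd\<close>.\<close>

definition field_reduction_map ::
    "('l, 'm) ring_scheme \<Rightarrow> ('a::field \<Rightarrow> 'l) \<Rightarrow> nat \<Rightarrow> ((nat \<Rightarrow> 'l) \<Rightarrow> 'a ^ 'd) \<Rightarrow> bool" where
  "field_reduction_map L \<iota> r \<phi> \<longleftrightarrow>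
     bij_betw \<phi> (coord_space L r) UNIV \<and>
     (\<forall>v\<in>coord_space L r. \<forall>w\<in>coord_space L r. \<phi> (coord_add L r v w) = \<phi> v + \<phi> w) \<and>
     (\<forall>c. \<forall>v\<in>coord_space L r. \<phi> (coord_scale L r (\<iota> c) v) = c *s \<phi> v)"

definition field_reduction_spread ::
    "('l, 'm) ring_scheme \<Rightarrow> nat \<Rightarrow> ((nat \<Rightarrow> 'l) \<Rightarrow> 'a::field ^ 'd) \<Rightarrow> ('a ^ 'd) set set" where
  "field_reduction_spread L r \<phi> = (\<lambda>U. \<phi> ` U) ` one_dim_subspaces L r"

text \<open>\<open>L\<close> plays the role of the field with \<open>q^n\<close> elements. Taking its elements to be natural numbers
  is no restriction, since every finite field is isomorphic to one of that form.\<close>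

definition desarguesian_spread ::
    "nat \<Rightarrow> nat \<Rightarrow> ('a::{field,finite} ^ 'd) set set \<Rightarrow> bool" where
  "desarguesian_spread n r S \<longleftrightarrow>
     (\<exists>(L :: nat ring) \<iota> (\<phi> :: (nat \<Rightarrow> nat) \<Rightarrow> 'a ^ 'd).
        field L \<and> card (carrier L) = CARD('a) ^ n \<and>
        \<iota> \<in> ring_hom (ring_of_type_algebra :: 'a ring) L \<and>
        field_reduction_map L \<iota> r \<phi> \<and>
        projectively_equivalent S (field_reduction_spread L r \<phi>))"

definition dickson_number_pair :: "nat \<Rightarrow> nat \<Rightarrow> bool" where
  "dickson_number_pair Q m \<longleftrightarrow>
     Q > 0 \<and> m > 0 \<and>
     primepow Q \<and>
     (\<forall>p. prime p \<and> p dvd m \<longrightarrow> p dvd Q - 1) \<and>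
     (Q mod 4 = 3 \<longrightarrow> m mod 4 \<noteq> 0)"

end

theory Submission
  imports Defs "HOL-Number_Theory.Residues"
begin

text \<open>
  For a prime divisor \<open>s\<close> of \<open>n\<close>, the pair \<open>(q ^ (n / s), s)\<close> is a Dickson number pair as soon as
  \<open>s\<close> divides \<open>q ^ (n / s) - 1\<close>, which by Fermat is equivalent to \<open>s\<close> dividing \<open>q ^ n - 1\<close>. So the
  hypothesis forces \<open>n\<close> and \<open>q ^ n - 1\<close> to be coprime, and the classification of finite nearfields
  is not needed.

  Coordinates along \<open>r > 2\<close> normal elements in general position show that the linear maps between
  two coordinate \<open>n\<close>-spaces whose graphs lie in the spread form, after identification of all these
  spaces with a single one \<open>D\<close>, a group \<open>G\<close> (with zero added) that acts sharply transitively on the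
  nonzero vectors of \<open>D\<close>. If \<open>G\<close> is abelian, it is the multiplicative group of a field on \<open>D\<close> and
  the spread is Desarguesian.

  If \<open>G\<close> is not abelian, some abelian subgroup \<open>A\<close> is normalized but not centralized by an element
  \<open>x\<close> of \<open>G\<close>, and one may assume that \<open>x\<close> acts on \<open>A\<close> with prime order \<open>s\<close>, a divisor of
  \<open>q ^ n - 1\<close>. The algebra \<open>R\<close> spanned by \<open>A\<close> over the ground field \<open>F\<close> is commutative and reduced, and \<open>x\<close> permutes its
  primitive idempotents \<open>e\<close>. Orbits of length \<open>s\<close> contribute a multiple of \<open>s\<close> to \<open>dim D = n\<close>. If
  \<open>e\<close> is fixed, then \<open>e R\<close> is a field with a nontrivial \<open>F\<close>-automorphism of order \<open>s\<close>, so \<open>s\<close>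
  divides its degree and hence \<open>dim (e D)\<close>. Altogether \<open>s\<close> divides \<open>n\<close>, a contradiction.
\<close>

section \<open>Abelian subgroups with nontrivial normalizer action\<close>

text \<open>The obstacle is that the algebra spanned by an abelian group of fixed-point-free maps is
  in general no field: sums may have kernels. What survives is the law
  \<open>f ^^ (q ^ n) = f\<close>. On the group it is Lagrange's theorem; it passes to sums because
  the \<open>q\<close>-th power is additive on commuting operators over a field of order
  \<open>q\<close>. It excludes nilpotents and yields the idempotents
  \<open>f ^^ (q ^ n - 1)\<close>. Freeness returns at one point: if conjugation by \<open>x\<close>
  moves \<open>a\<close>, it moves the value of \<open>a\<close> at every nonzero vector, so the
  automorphism stays nontrivial on every fixed corner. The abelian subgroup comes from a count in a
  smallest non-abelian subgroup \<open>H\<close> with center \<open>Z\<close>. Its noncentral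
  elements have abelian centralizers. If normalizers acted trivially on all of these, the conjugates
  of one centralizer, without \<open>Z\<close>, would form at least half of \<open>H\<close> but not
  all of \<open>H - Z\<close>, and two disjoint such families would not fit. Prime order is reached
  by passing to a power of \<open>x\<close>. The condition \<open>r > 2\<close> provides a third
  coordinate, through which slopes between two coordinates can be composed.\<close>

lemma (in group) inv_mult_cancel:
  assumes "x \<in> carrier G" "y \<in> carrier G"
  shows "inv x \<otimes> (x \<otimes> y) = y" "x \<otimes> (inv x \<otimes> y) = y"
  using assms by (simp_all add: m_assoc[symmetric])

text \<open>Turns coinciding conjugates into an intertwining relation, the form in which the fibres
  of the conjugation map are computed below.\<close>

lemma (in group) conj_eq_conj_iff:
  assumes "g \<in> carrier G" "h \<in> carrier G" "w \<in> carrier G" "v \<in> carrier G"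
  shows "g \<otimes> w \<otimes> inv g = h \<otimes> v \<otimes> inv h \<longleftrightarrow> (inv h \<otimes> g) \<otimes> w = v \<otimes> (inv h \<otimes> g)"
proof -
  have "g \<otimes> w \<otimes> inv g = h \<otimes> v \<otimes> inv h \<longleftrightarrow> g \<otimes> w = h \<otimes> v \<otimes> inv h \<otimes> g"
    using assms by (metis inv_closed inv_solve_right m_closed)
  also have "\<dots> \<longleftrightarrow> inv h \<otimes> (g \<otimes> w) = v \<otimes> inv h \<otimes> g"
    using assms inv_solve_left'[of "v \<otimes> inv h \<otimes> g" h "g \<otimes> w"] by (simp add: m_assoc)
  finally show ?thesis using assms by (simp add: m_assoc)
qed

definition centralizer_in :: "('g, 'm) monoid_scheme \<Rightarrow> 'g set \<Rightarrow> 'g \<Rightarrow> 'g set" where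
  "centralizer_in G H z = {g \<in> H. g \<otimes>\<^bsub>G\<^esub> z = z \<otimes>\<^bsub>G\<^esub> g}"

lemma (in group) subgroup_centralizer_in:
  assumes "subgroup H G" "z \<in> carrier G"
  shows "subgroup (centralizer_in G H z) G"
proof
  interpret H: subgroup H G by fact
  show "centralizer_in G H z \<subseteq> carrier G" by (auto simp: centralizer_in_def)
  show "\<one> \<in> centralizer_in G H z" using assms by (auto simp: centralizer_in_def)
  fix x assume x: "x \<in> centralizer_in G H z"
  then have xc: "x \<in> carrier G" "x \<in> H" "x \<otimes> z = z \<otimes> x" by (auto simp: centralizer_in_def)
  then have "inv x \<otimes> z = z \<otimes> inv x"
    using assms by (metis inv_closed inv_solve_left inv_solve_right m_assoc m_closed)
  then show "inv x \<in> centralizer_in G H z" using xc by (auto simp: centralizer_in_def)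
  fix y assume "y \<in> centralizer_in G H z"
  then show "x \<otimes> y \<in> centralizer_in G H z"
    using xc assms by (auto simp: centralizer_in_def) (metis H.mem_carrier m_assoc)
qed

text \<open>By contradiction, counting conjugates in a non-abelian subgroup of least order: each
  family \<open>U z\<close> of conjugates has at least half the order of \<open>H\<close>, and two
  of them are disjoint inside \<open>H - Z\<close>.\<close>

lemma (in group) exists_noncentral_normalizer:
  assumes fin: "finite (carrier G)"
    and ncomm: "x0 \<in> carrier G" "y0 \<in> carrier G" "x0 \<otimes> y0 \<noteq> y0 \<otimes> x0"
  obtains (normalizer) A x where "subgroup A G" "\<And>a b. a \<in> A \<Longrightarrow> b \<in> A \<Longrightarrow> a \<otimes> b = b \<otimes> a"
    "x \<in> carrier G" "\<And>a. a \<in> A \<Longrightarrow> x \<otimes> a \<otimes> inv x \<in> A" "\<exists>a\<in>A. x \<otimes> a \<noteq> a \<otimes> x"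
proof (rule ccontr)
  assume "\<not> thesis"
  \<comment> \<open>The negated claim: whatever normalizes an abelian subgroup centralizes
    it.\<close>
  then have contr: "x \<otimes> a = a \<otimes> x" if "subgroup A G" "\<And>a b. a \<in> A \<Longrightarrow> b \<in> A \<Longrightarrow> a \<otimes> b = b \<otimes> a"
    "x \<in> carrier G" "\<And>a. a \<in> A \<Longrightarrow> x \<otimes> a \<otimes> inv x \<in> A" "a \<in> A" for A x a
    using that \<open>\<not> thesis\<close> normalizer by blast
  define nc where "nc H \<longleftrightarrow> subgroup H G \<and> (\<exists>x\<in>H. \<exists>y\<in>H. x \<otimes> y \<noteq> y \<otimes> x)" for H
  have "nc (carrier G)" using ncomm subgroup_self by (auto simp: nc_def)
  then obtain H where H: "nc H" and Hmin: "\<And>H'. nc H' \<Longrightarrow> card H \<le> card H'"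
    using ex_has_least_nat[of nc "carrier G" card] by auto
  interpret H: subgroup H G using H by (auto simp: nc_def)
  have sH: "subgroup H G" by (rule H.subgroup_axioms)
  have Hc: "g \<in> carrier G" if "g \<in> H" for g using that by (rule H.mem_carrier)
  have finH: "finite H" using fin H.subset finite_subset by blast
  define C where "C = centralizer_in G H"
  define Z where "Z = {z \<in> H. \<forall>g\<in>H. g \<otimes> z = z \<otimes> g}"
  have C_iff: "g \<in> C z \<longleftrightarrow> g \<in> H \<and> g \<otimes> z = z \<otimes> g" for g z by (auto simp: C_def centralizer_in_def)
  have CH: "C z \<subseteq> H" for z by (auto simp: C_iff)
  have finC: "finite (C z)" for z using finH CH finite_subset by blast
  have sC: "subgroup (C z) G" if "z \<in> H" for z
    unfolding C_def using that by (intro subgroup_centralizer_in sH) auto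
  have Cpsub: "C z \<subset> H" if "z \<in> H - Z" for z
  proof -
    obtain g where "g \<in> H" "g \<otimes> z \<noteq> z \<otimes> g" using \<open>z \<in> H - Z\<close> unfolding Z_def by blast
    then show ?thesis using CH[of z] C_iff by blast
  qed
  \<comment> \<open>Proper subgroups of the least non-abelian subgroup are abelian, and
    \<open>C z\<close> is proper for noncentral \<open>z\<close>.\<close>
  have Ccomm: "a \<otimes> b = b \<otimes> a" if "z \<in> H - Z" "a \<in> C z" "b \<in> C z" for a b z
  proof (rule ccontr)
    assume "a \<otimes> b \<noteq> b \<otimes> a"
    then have "nc (C z)" using that sC by (auto simp: nc_def)
    then have "card H \<le> card (C z)" by (rule Hmin)
    then show False using psubset_card_mono[OF finH Cpsub[OF that(1)]] by simp
  qed
  have Ceq: "C w = C z" if "z \<in> H - Z" "w \<in> C z - Z" for w z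
  proof
    have w: "w \<in> H - Z" using that CH by auto
    show "C z \<subseteq> C w"
    proof
      fix x assume x: "x \<in> C z"
      then have "x \<otimes> w = w \<otimes> x" using that by (intro Ccomm[of z]) auto
      then show "x \<in> C w" using x C_iff by simp
    qed
    have "z \<in> C w" using that CH by (simp add: C_iff)
    show "C w \<subseteq> C z"
    proof
      fix x assume x: "x \<in> C w"
      then have "x \<otimes> z = z \<otimes> x" using \<open>z \<in> C w\<close> by (rule Ccomm[OF w])
      then show "x \<in> C z" using x C_iff by simp
    qed
  qed
  have Zsub: "Z \<subseteq> C z" if "z \<in> H" for z using that by (auto simp: Z_def C_iff)
  have oneZ: "\<one> \<in> Z" using Hc by (auto simp: Z_def)
  have finZ: "finite Z" using finH by (auto simp: Z_def)
  have cardZ: "card Z > 0" using oneZ finZ by (auto simp: card_gt_0_iff)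
  have conjC: "h \<otimes> c \<otimes> inv h \<in> C w'" if "h \<in> H" "w \<in> H" "w' \<in> H" "h \<otimes> w = w' \<otimes> h" "c \<in> C w" for h w w' c
  proof -
    have c: "c \<in> H" "c \<otimes> w = w \<otimes> c" using that(5) by (auto simp: C_iff)
    have w': "w' = h \<otimes> w \<otimes> inv h"
      using that Hc by (simp add: inv_solve_right)
    have "(h \<otimes> c \<otimes> inv h) \<otimes> w' = h \<otimes> (c \<otimes> w) \<otimes> inv h"
      unfolding w' using Hc[OF that(1)] Hc[OF that(2)] Hc[OF c(1)]
      by (simp add: m_assoc inv_mult_cancel)
    also have "\<dots> = h \<otimes> (w \<otimes> c) \<otimes> inv h" using c by simp
    also have "\<dots> = w' \<otimes> (h \<otimes> c \<otimes> inv h)"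
      unfolding w' using Hc[OF that(1)] Hc[OF that(2)] Hc[OF c(1)]
      by (simp add: m_assoc inv_mult_cancel)
    finally show ?thesis using that c by (auto simp: C_iff)
  qed
  text \<open>Non-central elements of \<open>C z\<close> that are conjugate in \<open>H\<close> are equal, since the
    normalizer of the abelian group \<open>C z\<close> centralizes it.\<close>
  have fuse: "h \<in> C z \<and> w' = w" if z: "z \<in> H - Z" and w: "w \<in> C z - Z" "w' \<in> C z - Z"
    and h: "h \<in> H" "h \<otimes> w = w' \<otimes> h" for z w w' h
  proof -
    have CC: "C w = C z" "C w' = C z" using Ceq[OF z] w by auto
    have wH: "w \<in> H" "w' \<in> H" "z \<in> H" using w z CH by auto
    have cen: "h \<otimes> c = c \<otimes> h" if "c \<in> C z" for c
    proof (rule contr[OF sC[OF wH(3)]])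
      show "h \<otimes> a \<otimes> inv h \<in> C z" if "a \<in> C z" for a
        using conjC[OF h(1) wH(1,2) h(2)] that CC by simp
    qed (use Ccomm[OF z] Hc h that in auto)
    have "h \<otimes> w = w \<otimes> h" using cen w by auto
    then have "w' = w" using h wH Hc by (metis right_cancel)
    moreover have "h \<in> C z" using cen[of z] h wH by (auto simp: C_iff)
    ultimately show ?thesis by simp
  qed
  define U where "U z = (\<lambda>(g, w). g \<otimes> w \<otimes> inv g) ` (H \<times> (C z - Z))" for z
  have UH: "U z \<subseteq> H - Z" if "z \<in> H" for z
  proof (clarsimp simp: U_def)
    fix g w assume gw: "g \<in> H" "w \<in> C z" "w \<notin> Z"
    then have wH: "w \<in> H" using CH by auto
    have "False" if "g \<otimes> w \<otimes> inv g \<in> Z"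
    proof -
      define u where "u = g \<otimes> w \<otimes> inv g"
      have "g \<otimes> w = u \<otimes> g" using gw wH Hc by (simp add: u_def m_assoc)
      also have "\<dots> = g \<otimes> u" using that gw by (auto simp: Z_def u_def)
      finally have "w = u" using gw wH Hc by (simp add: u_def)
      then show False using gw that u_def by simp
    qed
    then show "g \<otimes> w \<otimes> inv g \<in> H \<and> g \<otimes> w \<otimes> inv g \<notin> Z" using gw wH by auto
  qed
  have cardU: "card (U z) * card (C z) = card H * (card (C z) - card Z)" if z: "z \<in> H - Z" for z
  proof -
    let ?f = "\<lambda>(g, w). g \<otimes> w \<otimes> inv g"
    let ?D = "H \<times> (C z - Z)"
    have "card {p \<in> ?D. ?f p = u} = card (C z)" if u: "u \<in> U z" for u
    proof -
      obtain g0 w0 where gw: "g0 \<in> H" "w0 \<in> C z - Z" "u = g0 \<otimes> w0 \<otimes> inv g0"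
      proof -
        from u obtain p where "p \<in> H \<times> (C z - Z)" "u = ?f p" unfolding U_def by (rule imageE)
        then show ?thesis by (intro that[of "fst p" "snd p"]) (simp_all add: mem_Times_iff case_prod_beta)
      qed
      \<comment> \<open>By \<open>fuse\<close>, two pairs with the same conjugate share
        \<open>w\<close>, and their conjugating elements differ by a right factor in
        \<open>C z\<close>. So each fibre is a coset of \<open>C z\<close>.\<close>
      have "{p \<in> ?D. ?f p = u} = (\<lambda>c. (g0 \<otimes> c, w0)) ` C z"
      proof (intro equalityI subsetI)
        fix p assume "p \<in> {p \<in> ?D. ?f p = u}"
        then obtain g w where p: "p = (g, w)" "g \<in> H" "w \<in> C z - Z" "g \<otimes> w \<otimes> inv g = u" by auto
        have cc: "g \<in> carrier G" "g0 \<in> carrier G" "w \<in> carrier G" "w0 \<in> carrier G"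
          using p gw Hc subsetD[OF CH] by auto
        have "(inv g0 \<otimes> g) \<otimes> w = w0 \<otimes> (inv g0 \<otimes> g)"
          using conj_eq_conj_iff[OF cc] p gw by simp
        then have *: "inv g0 \<otimes> g \<in> C z \<and> w0 = w"
          using fuse[OF z p(3) gw(2)] p gw by auto
        then have "p = (g0 \<otimes> (inv g0 \<otimes> g), w0)" using cc p by (simp add: m_assoc[symmetric])
        then show "p \<in> (\<lambda>c. (g0 \<otimes> c, w0)) ` C z" using * by blast
      next
        fix p assume "p \<in> (\<lambda>c. (g0 \<otimes> c, w0)) ` C z"
        then obtain c where c: "c \<in> C z" "p = (g0 \<otimes> c, w0)" by auto
        have cc: "c \<in> carrier G" "g0 \<in> carrier G" "w0 \<in> carrier G"
          using c gw Hc subsetD[OF CH] by auto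
        have "c \<otimes> w0 = w0 \<otimes> c" using Ccomm[OF z] c gw by auto
        then have "g0 \<otimes> c \<otimes> w0 \<otimes> inv (g0 \<otimes> c) = u"
          using cc gw conj_eq_conj_iff[of "g0 \<otimes> c" g0 w0 w0]
          by (simp add: m_assoc[symmetric])
        then show "p \<in> {p \<in> ?D. ?f p = u}" using c gw CH by auto
      qed
      moreover have "inj_on (\<lambda>c. (g0 \<otimes> c, w0)) (C z)"
        using gw Hc subsetD[OF CH] by (auto intro!: inj_onI)
      ultimately show ?thesis by (simp add: card_image)
    qed
    then have "(\<Sum>u\<in>U z. card {p \<in> ?D. ?f p = u}) = card (U z) * card (C z)" by simp
    then have "card ?D = card (U z) * card (C z)"
      using sum.image_gen[of ?D "\<lambda>_. 1::nat" ?f] finH finC by (simp only: U_def card_eq_sum) simp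
    then show ?thesis
      using z Zsub finZ by (simp add: card_cartesian_product card_Diff_subset)
  qed
  \<comment> \<open>\<open>Z\<close> and its translate by \<open>z\<close> are disjoint, and both
    lie in \<open>C z\<close>.\<close>
  have C2: "2 * card Z \<le> card (C z)" if z: "z \<in> H - Z" for z
  proof -
    have "(\<lambda>y. z \<otimes> y) ` Z \<inter> Z = {}"
    proof (rule ccontr)
      assume "\<not> ?thesis"
      then obtain y where y: "y \<in> Z" "z \<otimes> y \<in> Z" by auto
      have "z \<in> Z"
      proof -
        have "g \<otimes> z = z \<otimes> g" if g: "g \<in> H" for g
        proof -
          have cc: "g \<in> carrier G" "z \<in> carrier G" "y \<in> carrier G" using g z y Hc by (auto simp: Z_def)
          have "(g \<otimes> z) \<otimes> y = g \<otimes> (z \<otimes> y)" using cc by (simp add: m_assoc)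
          also have "\<dots> = z \<otimes> (y \<otimes> g)" using y g cc by (auto simp: Z_def m_assoc)
          also have "y \<otimes> g = g \<otimes> y" using y g by (auto simp: Z_def)
          finally have "(g \<otimes> z) \<otimes> y = (z \<otimes> g) \<otimes> y" using cc by (simp add: m_assoc)
          then show ?thesis using cc by simp
        qed
        then show ?thesis using z by (auto simp: Z_def)
      qed
      then show False using z by simp
    qed
    moreover have "(\<lambda>y. z \<otimes> y) ` Z \<union> Z \<subseteq> C z"
    proof -
      have "z \<in> C z" using z by (auto simp: C_iff)
      then show ?thesis using Zsub z sC[of z] by (auto intro: subgroup.m_closed)
    qed
    moreover have "card ((\<lambda>y. z \<otimes> y) ` Z) = card Z"
    proof (intro card_image inj_onI)
      fix x y assume "x \<in> Z" "y \<in> Z" "z \<otimes> x = z \<otimes> y"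
      then show "x = y" using z Hc by (auto simp: Z_def)
    qed
    ultimately have "card Z + card Z \<le> card (C z)"
      using card_mono[OF finC] finZ by (metis card_Un_disjoint finite_imageI)
    then show ?thesis by simp
  qed
  have U2: "card H \<le> 2 * card (U z)" if z: "z \<in> H - Z" for z
  proof -
    have "card H * card (C z) \<le> card H * (2 * (card (C z) - card Z))"
      using C2[OF z] by (intro mult_left_mono) auto
    also have "\<dots> = 2 * card (U z) * card (C z)" using cardU[OF z] by simp
    finally show ?thesis using C2[OF z] cardZ by simp
  qed
  obtain z1 where z1: "z1 \<in> H - Z" using H by (auto simp: nc_def Z_def)
  \<comment> \<open>Equality in the count \<open>cardU\<close> would give
    \<open>card (C z1) = card H\<close>.\<close>
  have "U z1 \<noteq> H - Z"
  proof
    assume *: "U z1 = H - Z"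
    have "card (H - Z) = card H - card Z" using finZ Zsub CH by (intro card_Diff_subset) (auto simp: Z_def)
    then have "(card H - card Z) * card (C z1) = card H * (card (C z1) - card Z)"
      using cardU[OF z1] * by simp
    moreover have "card Z \<le> card H" using finH by (intro card_mono) (auto simp: Z_def)
    then obtain h where "card H = card Z + h" using le_Suc_ex by blast
    moreover have "card Z \<le> card (C z1)" using z1 Zsub finC by (intro card_mono) auto
    then obtain c where "card (C z1) = card Z + c" using le_Suc_ex by blast
    moreover have "card (C z1) < card H" by (rule psubset_card_mono[OF finH Cpsub[OF z1]])
    ultimately show False using cardZ by (simp add: algebra_simps)
  qed
  then obtain z2 where z2: "z2 \<in> H - Z" "z2 \<notin> U z1" using UH[of z1] z1 by auto
  \<comment> \<open>A common conjugate moves \<open>z2\<close> into \<open>C z1\<close> by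
    conjugation, and back again this puts \<open>z2\<close> into \<open>U z1\<close>, against its
    choice.\<close>
  have disj: "U z1 \<inter> U z2 = {}"
  proof (rule ccontr)
    assume "\<not> ?thesis"
    then obtain g w g' w' where gw: "g \<in> H" "g' \<in> H" "w \<in> C z1 - Z" "w' \<in> C z2 - Z"
      and eq: "g \<otimes> w \<otimes> inv g = g' \<otimes> w' \<otimes> inv g'" by (auto simp: U_def)
    have wH: "w \<in> H" "w' \<in> H" using gw CH by auto
    have "g' \<otimes> w' \<otimes> inv g' = g \<otimes> w \<otimes> inv g" using eq by simp
    then have h: "(inv g \<otimes> g') \<otimes> w' = w \<otimes> (inv g \<otimes> g')"
      using conj_eq_conj_iff gw wH Hc by simp
    define h where "h = inv g \<otimes> g'"
    have hH: "h \<in> H" using gw by (simp add: h_def)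
    have "z2 \<in> C w'" using Ceq[OF z2(1) gw(4)] z2 by (auto simp: C_iff)
    then have "h \<otimes> z2 \<otimes> inv h \<in> C w"
      using conjC[OF hH wH(2,1)] h h_def by auto
    then have y: "h \<otimes> z2 \<otimes> inv h \<in> C z1" (is "?y \<in> _") using Ceq[OF z1 gw(3)] by simp
    have cc: "h \<in> carrier G" "z2 \<in> carrier G" using hH z2 Hc by auto
    have z2_conj: "inv h \<otimes> ?y \<otimes> inv (inv h) = z2"
      using cc by (simp add: m_assoc inv_mult_cancel)
    have "?y \<notin> Z"
    proof
      assume "?y \<in> Z"
      then have "inv h \<otimes> ?y = ?y \<otimes> inv h" using hH by (auto simp: Z_def)
      then have "z2 = ?y" using z2_conj cc by (simp add: m_assoc)
      then show False using \<open>?y \<in> Z\<close> z2 by simp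
    qed
    then have "z2 \<in> U z1" using y hH z2_conj unfolding U_def
      by (intro image_eqI[of _ _ "(inv h, ?y)"]) auto
    then show False using z2 by simp
  qed
  have "card H \<le> card (U z1) + card (U z2)" using U2[OF z1] U2[OF z2(1)] by simp
  also have "\<dots> = card (U z1 \<union> U z2)"
    by (rule card_Un_disjoint[symmetric, OF _ _ disj]) (simp_all add: U_def finH finC)
  also have "\<dots> \<le> card (H - Z)" using finH UH[of z1] UH[of z2] z1 z2 by (intro card_mono) blast+
  also have "\<dots> < card H"
    using finH oneZ H.one_closed by (intro psubset_card_mono) blast+
  finally show False by simp
qed

section \<open>Automorphisms of finite fields\<close>

text \<open>The sequence \<open>c\<close> is cut off beyond \<open>d\<close> to become a polynomial
  of \<open>UP R\<close>. Its degree may be smaller than \<open>d\<close>, so some nonzero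
  coefficient up to \<open>d\<close> is enough.\<close>

lemma (in domain) card_roots_le:
  fixes c :: "nat \<Rightarrow> 'a"
  assumes fin: "finite (carrier R)" and c: "\<And>k. c k \<in> carrier R"
    and k: "k \<le> d" "c k \<noteq> \<zero>"
  shows "card {x \<in> carrier R. (\<Oplus>i\<in>{..d}. c i \<otimes> x [^] i) = \<zero>} \<le> d"
proof -
  define f where "f = (\<lambda>i. if i \<le> d then c i else \<zero>)"
  have fu: "f \<in> up R"
  proof (rule mem_upI)
    show "f i \<in> carrier R" for i using c by (simp add: f_def)
    show "\<exists>n. bound \<zero> n f" by (rule exI[of _ d], rule bound.intro, simp add: f_def)
  qed
  then have fc: "f \<in> carrier (UP R)" by (simp add: UP_def)
  have coeff: "up_ring.coeff (UP R) f i = f i" for i using fu by (simp add: UP_def)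
  interpret UP: UP_domain R "UP R" by unfold_locales simp
  have deg: "deg R f \<le> d"
    using fc by (intro UP.deg_aboveI) (simp_all only: coeff, simp add: f_def)
  have "f \<noteq> \<zero>\<^bsub>UP R\<^esub>" using k by (auto simp: UP_def f_def fun_eq_iff)
  then have *: "card {a \<in> carrier R. UnivPoly.eval R R id a f = \<zero>} \<le> deg R f"
    using UP.roots_bound[OF fc _ fin] by simp
  have "UnivPoly.eval R R id x f = (\<Oplus>i\<in>{..d}. c i \<otimes> x [^] i)" if x: "x \<in> carrier R" for x
  proof -
    have "UnivPoly.eval R R id x f = (\<Oplus>i\<in>{..deg R f}. f i \<otimes> x [^] i)"
      using fc by (simp add: eval_def coeff)
    also have "\<dots> = (\<Oplus>i\<in>{..d}. f i \<otimes> x [^] i)"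
    proof (rule add.finprod_mono_neutral_cong_left)
      show "f i \<otimes> x [^] i = \<zero>" if "i \<in> {..d} - {..deg R f}" for i
        using UP.deg_aboveD[OF _ fc, of i] coeff x that by auto
    qed (use deg x c in \<open>auto simp: f_def\<close>)
    also have "\<dots> = (\<Oplus>i\<in>{..d}. c i \<otimes> x [^] i)"
      using x c by (intro add.finprod_cong') (auto simp: f_def)
    finally show ?thesis .
  qed
  then have "{x \<in> carrier R. (\<Oplus>i\<in>{..d}. c i \<otimes> x [^] i) = \<zero>} =
      {a \<in> carrier R. UnivPoly.eval R R id a f = \<zero>}" by auto
  then show ?thesis using * deg by simp
qed

text \<open>Every automorphism over \<open>F\<close> is a power of the Frobenius map, whose order
  divides \<open>d\<close>. A generator \<open>g\<close> of the multiplicative group is a root of a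
  nonzero polynomial over \<open>F\<close> of degree at most \<open>d\<close>; its \<open>d\<close>
  distinct Frobenius images exhaust the roots, so \<open>\<tau> g\<close> is one of them, and this
  determines \<open>\<tau>\<close>.\<close>

lemma (in field) finite_field_automorphism_period:
  fixes q d :: nat
  assumes fin: "finite (carrier R)" and cardR: "card (carrier R) = q ^ d" and q: "q \<ge> 2"
    and F: "F \<subseteq> carrier R" "card F = q" "\<And>c c'. c \<in> F \<Longrightarrow> c' \<in> F \<Longrightarrow> c \<ominus> c' \<in> F"
    and frob: "(\<lambda>x. x [^] q) \<in> ring_hom R R" "\<And>c. c \<in> F \<Longrightarrow> c [^] q = c"
    and \<tau>: "\<tau> \<in> ring_hom R R" "\<And>c. c \<in> F \<Longrightarrow> \<tau> c = c"
    and x: "x \<in> carrier R"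
  shows "(\<tau> ^^ d) x = x"
proof -
  have finF: "finite F" using F fin finite_subset by blast
  obtain g where g: "g \<in> carrier R" "g \<noteq> \<zero>"
    and gen: "\<And>y. y \<in> carrier R \<Longrightarrow> y \<noteq> \<zero> \<Longrightarrow> \<exists>i::nat. y = g [^] i"
  proof -
    obtain a where a: "a \<in> carrier (Multiplicative_Group.mult_of R)" "carrier (Multiplicative_Group.mult_of R) = {a [^] i | i::nat. i \<in> UNIV}"
      using finite_field_mult_group_has_gen[OF fin] by auto
    show ?thesis
    proof (rule that[of a])
      fix y assume "y \<in> carrier R" "y \<noteq> \<zero>"
      then have "y \<in> carrier (Multiplicative_Group.mult_of R)" by simp
      then show "\<exists>i::nat. y = a [^] i" using a by auto
    qed (use a in auto)
  qed
  have cN: "card (carrier R - {\<zero>}) = q ^ d - 1" using fin cardR by simp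
  \<comment> \<open>If \<open>g [^] m\<close> is one, the first \<open>m\<close> powers of
    \<open>g\<close> already exhaust the nonzero elements.\<close>
  have ord_ge: "q ^ d - 1 \<le> m" if "g [^] m = \<one>" "m > 0" for m :: nat
  proof -
    have "carrier R - {\<zero>} \<subseteq> (\<lambda>i. g [^] i) ` {..<m}"
    proof
      fix y assume "y \<in> carrier R - {\<zero>}"
      then obtain i :: nat where i: "y = g [^] i" using gen by auto
      have "g [^] i = g [^] (m * (i div m) + i mod m)" by simp
      also have "\<dots> = (g [^] m) [^] (i div m) \<otimes> g [^] (i mod m)"
        using g by (simp add: nat_pow_mult nat_pow_pow)
      also have "\<dots> = g [^] (i mod m)" using that g by simp
      finally show "y \<in> (\<lambda>i. g [^] i) ` {..<m}" using i that by auto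
    qed
    then have "card (carrier R - {\<zero>}) \<le> card ((\<lambda>i. g [^] i) ` {..<m})"
      by (intro card_mono) auto
    also have "\<dots> \<le> m" using card_image_le[of "{..<m}"] by force
    finally show ?thesis using cN by simp
  qed
  have d0: "d > 0" 
  proof (rule ccontr)
    assume "\<not> d > 0"
    then obtain y where "carrier R = {y}" using cardR by (auto simp: card_1_singleton_iff)
    then show False using one_closed zero_closed one_not_zero by auto
  qed
  have pow_nz: "g [^] (i::nat) \<noteq> \<zero>" for i
  proof (induction i)
    case (Suc i)
    then show ?case using g integral[of "g [^] i" g] by auto
  qed (use one_not_zero in simp)
  \<comment> \<open>A coincidence would give \<open>g\<close> a period at most
    \<open>q ^ j - q ^ i\<close>, which is below \<open>q ^ d - 1\<close>.\<close>
  have inj: "inj_on (\<lambda>j. g [^] (q ^ j)) {..<d}"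
  proof (rule linorder_inj_onI')
    fix i j assume ij: "i \<in> {..<d}" "j \<in> {..<d}" "i < j"
    show "g [^] (q ^ i) \<noteq> g [^] (q ^ j)"
    proof
      assume eq: "g [^] (q ^ i) = g [^] (q ^ j)"
      have lt: "q ^ i < q ^ j" using ij q by (intro power_strict_increasing) auto
      have "g [^] (q ^ i) \<otimes> g [^] (q ^ j - q ^ i) = g [^] (q ^ j)"
        using nat_pow_mult[of g "q ^ i" "q ^ j - q ^ i"] lt g by simp
      then have "g [^] (q ^ i) \<otimes> g [^] (q ^ j - q ^ i) = g [^] (q ^ i) \<otimes> \<one>"
        using eq g by simp
      then have "g [^] (q ^ j - q ^ i) = \<one>"
        using m_lcancel[of "g [^] (q ^ i)"] pow_nz g by (meson nat_pow_closed one_closed)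
      then have "q ^ d - 1 \<le> q ^ j - q ^ i" using lt by (intro ord_ge) auto
      also have "\<dots> \<le> q ^ j - 1" using q by (simp add: diff_le_mono2)
      also have "\<dots> < q ^ d - 1"
        using power_strict_increasing[of j d q] ij q by (simp add: diff_less_mono)
      finally show False by simp
    qed
  qed
  have pow_qd: "y [^] (q ^ d) = y" if y: "y \<in> carrier R" for y
  proof (cases "y = \<zero>")
    case True
    then show ?thesis using q by (simp add: nat_pow_zero)
  next
    case False
    interpret M: group "Multiplicative_Group.mult_of R" by (rule field_mult_group)
    have "y [^]\<^bsub>Multiplicative_Group.mult_of R\<^esub> Coset.order (Multiplicative_Group.mult_of R) = \<one>\<^bsub>Multiplicative_Group.mult_of R\<^esub>"
      using y False by (intro M.pow_order_eq_1) auto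
    moreover have "y [^]\<^bsub>Multiplicative_Group.mult_of R\<^esub> (k::nat) = y [^] k" for k
      by (simp add: nat_pow_def Multiplicative_Group.mult_of_def)
    ultimately have 1: "y [^] (q ^ d - 1) = \<one>"
      using order_mult_of[OF fin] cardR by (simp add: Coset.order_def)
    have "y [^] (q ^ d) = y [^] Suc (q ^ d - 1)" using q by simp
    also have "\<dots> = y" using 1 y by simp
    finally show ?thesis .
  qed
  \<comment> \<open>Pigeonhole: \<open>q ^ Suc d\<close> coefficient vectors over \<open>F\<close>
    have at most \<open>q ^ d\<close> values at \<open>g\<close>, and \<open>c\<close> is the
    difference of two vectors with the same value.\<close>
  obtain c where c: "\<And>k. c k \<in> F" "\<exists>k\<le>d. c k \<noteq> \<zero>" "(\<Oplus>i\<in>{..d}. c i \<otimes> g [^] i) = \<zero>"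
  proof -
    let ?S = "\<lambda>c. \<Oplus>i\<in>{..d}. c i \<otimes> g [^] i"
    let ?P = "{..d} \<rightarrow>\<^sub>E F"
    have cP: "card ?P = q ^ Suc d" using F by (simp add: card_PiE)
    have "?S ` ?P \<subseteq> carrier R"
    proof
      fix y assume "y \<in> ?S ` ?P"
      then obtain a where a: "a \<in> ?P" "y = ?S a" by blast
      have "a i \<in> carrier R" if "i \<le> d" for i using a(1) F(1) that by (auto simp: PiE_iff)
      then show "y \<in> carrier R" unfolding a(2) using g by (intro finsum_closed) auto
    qed
    then have "card (?S ` ?P) \<le> q ^ d" using card_mono[OF fin] cardR by simp
    also have "\<dots> < card ?P" using cP q by simp
    finally obtain a b where ab: "a \<in> ?P" "b \<in> ?P" "a \<noteq> b" "?S a = ?S b"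
      using pigeonhole[of ?S ?P] unfolding inj_on_def by blast
    have abc: "a i \<in> carrier R" "b i \<in> carrier R" "a i \<in> F" "b i \<in> F" if "i \<le> d" for i
      using ab that F by (auto simp: PiE_iff)
    \<comment> \<open>Capping the index at \<open>d\<close> keeps every \<open>c k\<close> in
      \<open>F\<close>; only indices up to \<open>d\<close> enter the sum.\<close>
    define c where "c i = a (min i d) \<ominus> b (min i d)" for i
    show ?thesis
    proof (rule that[of c])
      show "c k \<in> F" for k
        unfolding c_def by (intro F(3) abc(3,4)) simp_all
      obtain k where "k \<le> d" "a k \<noteq> b k" using PiE_ext[OF ab(1,2)] ab(3) by auto
      then have "a k \<ominus> b k \<noteq> \<zero>" using r_right_minus_eq[of "a k" "b k"] abc by blast
      moreover have "c k = a k \<ominus> b k" using \<open>k \<le> d\<close> by (simp only: c_def min_absorb1)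
      ultimately have "c k \<noteq> \<zero>" by simp
      then show "\<exists>k\<le>d. c k \<noteq> \<zero>" using \<open>k \<le> d\<close> by blast
      have "(\<Oplus>i\<in>{..d}. c i \<otimes> g [^] i) = (\<Oplus>i\<in>{..d}. a i \<otimes> g [^] i \<ominus> b i \<otimes> g [^] i)"
        using abc g by (intro add.finprod_cong') (auto simp: c_def minus_eq l_distr l_minus)
      also have "\<dots> = ?S a \<ominus> ?S b"
      proof -
        have "?S a = (\<Oplus>i\<in>{..d}. (a i \<otimes> g [^] i \<ominus> b i \<otimes> g [^] i) \<oplus> b i \<otimes> g [^] i)"
          using abc g by (intro add.finprod_cong') (auto simp: minus_eq a_assoc l_neg)
        also have "\<dots> = (\<Oplus>i\<in>{..d}. a i \<otimes> g [^] i \<ominus> b i \<otimes> g [^] i) \<oplus> ?S b"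
          using abc g by (intro finsum_addf) auto
        finally have eq: "?S a = (\<Oplus>i\<in>{..d}. a i \<otimes> g [^] i \<ominus> b i \<otimes> g [^] i) \<oplus> ?S b" .
        have "u = (u \<oplus> v) \<ominus> v" if "u \<in> carrier R" "v \<in> carrier R" for u v
          using that by (simp add: minus_eq a_assoc r_neg)
        then show ?thesis unfolding eq using abc g by (auto intro!: finsum_closed)
      qed
      also have "\<dots> = \<zero>" using ab abc g by (simp add: finsum_closed Pi_def)
      finally show "(\<Oplus>i\<in>{..d}. c i \<otimes> g [^] i) = \<zero>" .
    qed
  qed
  have cc: "c k \<in> carrier R" for k using c F by auto
  have hom_root: "(\<Oplus>i\<in>{..d}. c i \<otimes> h y [^] i) = \<zero>"
    if h: "h \<in> ring_hom R R" "\<And>c. c \<in> F \<Longrightarrow> h c = c" and y: "y \<in> carrier R"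
      "(\<Oplus>i\<in>{..d}. c i \<otimes> y [^] i) = \<zero>" for h y
  proof -
    interpret h: ring_hom_cring R R h
      using h is_cring by (intro ring_hom_cring.intro ring_hom_cring_axioms.intro)
    have "\<zero> = h (\<Oplus>i\<in>{..d}. c i \<otimes> y [^] i)" using y by simp
    also have "\<dots> = (\<Oplus>i\<in>{..d}. (h \<circ> (\<lambda>i. c i \<otimes> y [^] i)) i)"
      using cc y by (intro h.hom_finsum) auto
    also have "\<dots> = (\<Oplus>i\<in>{..d}. c i \<otimes> h y [^] i)"
      using cc y h c by (intro add.finprod_cong') auto
    finally show ?thesis by simp
  qed
  let ?roots = "{x \<in> carrier R. (\<Oplus>i\<in>{..d}. c i \<otimes> x [^] i) = \<zero>}"
  have conj: "g [^] (q ^ j) \<in> ?roots" for j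
  proof (induction j)
    case 0
    then show ?case using c g by simp
  next
    case (Suc j)
    have "(g [^] (q ^ j)) [^] q \<in> ?roots"
      using hom_root[OF frob, of "g [^] (q ^ j)"] Suc g by simp
    then show ?case using g by (simp add: nat_pow_pow mult.commute)
  qed
  have \<tau>c: "\<tau> y \<in> carrier R" if "y \<in> carrier R" for y
    using ring_hom_closed[OF \<tau>(1) that] .
  \<comment> \<open>Otherwise \<open>\<tau> g\<close> would be a further root beside the
    \<open>d\<close> Frobenius images of \<open>g\<close>.\<close>
  have \<tau>g: "\<tau> g \<in> (\<lambda>j. g [^] (q ^ j)) ` {..<d}"
  proof (rule ccontr)
    assume not: "\<not> ?thesis"
    have "insert (\<tau> g) ((\<lambda>j. g [^] (q ^ j)) ` {..<d}) \<subseteq> ?roots"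
      using hom_root[OF \<tau> g(1) c(3)] \<tau>c g conj by auto
    moreover have "finite ?roots" using fin by auto
    ultimately have "card (insert (\<tau> g) ((\<lambda>j. g [^] (q ^ j)) ` {..<d})) \<le> card ?roots"
      by (intro card_mono)
    also have "\<dots> \<le> d" using c(2) card_roots_le[OF fin, of c] cc by auto
    also have "d < card (insert (\<tau> g) ((\<lambda>j. g [^] (q ^ j)) ` {..<d}))"
      using not card_image[OF inj] by simp
    finally show False by simp
  qed
  then obtain j where j: "\<tau> g = g [^] (q ^ j)" by auto
  interpret \<tau>: ring_hom_cring R R \<tau>
    using \<tau> is_cring by (intro ring_hom_cring.intro ring_hom_cring_axioms.intro)
  have \<tau>pow: "\<tau> y = y [^] (q ^ j)" if y: "y \<in> carrier R" for y
  proof (cases "y = \<zero>")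
    case True
    then show ?thesis using q by (simp add: nat_pow_zero)
  next
    case False
    then obtain i :: nat where "y = g [^] i" using gen y by blast
    then show ?thesis using g j by (simp add: nat_pow_pow mult.commute)
  qed
  have "(\<tau> ^^ m) x = x [^] (q ^ (j * m)) " for m
  proof (induction m)
    case 0
    then show ?case using x by simp
  next
    case (Suc m)
    then show ?case using x
      by (simp add: \<tau>pow nat_pow_pow power_add[symmetric] add.commute)
  qed
  moreover have "x [^] (q ^ (m * d)) = x" for m
    using x by (induction m) (simp_all add: power_add nat_pow_pow[symmetric] pow_qd)
  ultimately show ?thesis by metis
qed

section \<open>Linear operators on a finite coordinate space\<close>

definition linear_op :: "('a::field ^ 'd \<Rightarrow> 'a ^ 'd) \<Rightarrow> bool" where
  "linear_op f \<longleftrightarrow> (\<forall>v w. f (v + w) = f v + f w) \<and> (\<forall>c v. f (c *s v) = c *s f v)"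

lemma linear_op_add: "linear_op f \<Longrightarrow> f (v + w) = f v + f w"
  and linear_op_scale: "linear_op f \<Longrightarrow> f (c *s v) = c *s f v"
  by (auto simp: linear_op_def)

lemma linear_op_zero: "linear_op f \<Longrightarrow> f 0 = 0"
  using linear_op_scale[of f 0 0] by (simp add: vec_eq_iff)

lemma linear_op_minus: "linear_op f \<Longrightarrow> f (- v) = - f v"
  using linear_op_add[of f v "- v"] linear_op_zero[of f] by (simp add: eq_neg_iff_add_eq_0 add.commute)

lemma linear_op_diff: "linear_op f \<Longrightarrow> f (v - w) = f v - f w"
  using linear_op_add[of f v "- w"] linear_op_minus[of f w] by simp

lemma linear_op_sum: "linear_op f \<Longrightarrow> f (\<Sum>i\<in>I. v i) = (\<Sum>i\<in>I. f (v i))"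
  by (induction I rule: infinite_finite_induct) (auto simp: linear_op_zero linear_op_add)

lemma linear_op_funpow: "linear_op f \<Longrightarrow> linear_op (f ^^ k)"
  by (induction k) (auto simp: linear_op_def)

lemma subspace_range_linear_op: "linear_op f \<Longrightarrow> vec.subspace (range f)"
proof (rule vec.subspaceI)
  assume f: "linear_op f"
  show "0 \<in> range f" by (rule range_eqI[of _ _ 0]) (simp add: linear_op_zero f)
  show "v + w \<in> range f" if vw: "v \<in> range f" "w \<in> range f" for v w
  proof -
    obtain a b where "v = f a" "w = f b" using vw by auto
    then show ?thesis by (intro range_eqI[of _ _ "a + b"]) (simp add: linear_op_add f)
  qed
  show "c *s v \<in> range f" if v: "v \<in> range f" for c v
  proof -
    obtain a where "v = f a" using v by auto
    then show ?thesis by (intro range_eqI[of _ _ "c *s a"]) (simp add: linear_op_scale f)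
  qed
qed

section \<open>Cardinalities of finite vector spaces\<close>

lemma card_span_independent:
  fixes B :: "('a::{field,finite} ^ 'd) set"
  assumes "finite B" "vec.independent B"
  shows "card (vec.span B) = CARD('a) ^ card B"
  using assms
proof (induction B)
  case empty
  then show ?case by simp
next
  case (insert b B)
  have ind: "vec.independent B" "b \<notin> vec.span B"
    using insert.prems insert.hyps by (auto simp: vec.independent_insert)
  let ?f = "\<lambda>(k, x). k *s b + x"
  have "?f ` (UNIV \<times> vec.span B) = vec.span (insert b B)"
  proof (intro equalityI subsetI)
    fix y assume "y \<in> ?f ` (UNIV \<times> vec.span B)"
    then obtain k x where "y = k *s b + x" "x \<in> vec.span B" by auto
    then show "y \<in> vec.span (insert b B)"
      by (metis add_diff_cancel_left' vec.span_breakdown_eq)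
  next
    fix y assume "y \<in> vec.span (insert b B)"
    then obtain k where "y - k *s b \<in> vec.span B" by (auto simp: vec.span_breakdown_eq)
    then show "y \<in> ?f ` (UNIV \<times> vec.span B)"
      by (intro image_eqI[of _ _ "(k, y - k *s b)"]) auto
  qed
  moreover have "inj_on ?f (UNIV \<times> vec.span B)"
  proof (rule inj_onI, clarsimp)
    fix k l :: 'a and x y
    assume xy: "x \<in> vec.span B" "y \<in> vec.span B" and eq: "k *s b + x = l *s b + y"
    have *: "(k - l) *s b = y - x"
      using eq by (simp add: vector_sub_rdistrib algebra_simps)
    have "k = l"
    proof (rule ccontr)
      assume "k \<noteq> l"
      have "b = inverse (k - l) *s (y - x)"
        using \<open>k \<noteq> l\<close> by (simp add: *[symmetric])
      then show False using ind xy by (metis vec.span_diff vec.span_scale)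
    qed
    then show "k = l \<and> x = y" using eq by simp
  qed
  ultimately have "card (vec.span (insert b B)) = CARD('a) * card (vec.span B)"
    using card_image[of ?f "UNIV \<times> vec.span B"] by (simp add: card_cartesian_product)
  then show ?case using insert ind by simp
qed

lemma card_subspace:
  fixes U :: "('a::{field,finite} ^ 'd) set"
  assumes "vec.subspace U"
  shows "card U = CARD('a) ^ vec.dim U"
proof -
  obtain B where "B \<subseteq> U" "vec.independent B" "U \<subseteq> vec.span B" "card B = vec.dim U"
    using vec.basis_exists[of U] by blast
  then have "vec.span B = U" using assms by (simp add: vec.span_subspace)
  then show ?thesis
    using card_span_independent[OF _ \<open>vec.independent B\<close>] \<open>card B = vec.dim U\<close> by simp
qed

text \<open>\<open>K\<close> behaves on \<open>V\<close> like a finite field of scalars, so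
  \<open>V\<close> is a vector space over it. The dimension count is done directly: a
  \<open>K\<close>-stable subgroup of largest possible size \<open>card K ^ i\<close> could be
  enlarged by the factor \<open>card K\<close> with any vector outside it.\<close>

lemma card_power_of_free_action:
  fixes V :: "'v::ab_group_add set" and K :: "('v \<Rightarrow> 'v) set"
  assumes finV: "finite V" and V: "0 \<in> V" "\<And>v w. v \<in> V \<Longrightarrow> w \<in> V \<Longrightarrow> v - w \<in> V"
    and K2: "card K \<ge> 2"
    and act: "\<And>k v. k \<in> K \<Longrightarrow> v \<in> V \<Longrightarrow> k v \<in> V"
    and add: "\<And>k v w. k \<in> K \<Longrightarrow> v \<in> V \<Longrightarrow> w \<in> V \<Longrightarrow> k (v - w) = k v - k w"
    and comp: "\<And>k l. k \<in> K \<Longrightarrow> l \<in> K \<Longrightarrow> \<exists>m\<in>K. \<forall>v\<in>V. m v = k (l v)"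
    and diff: "\<And>k l. k \<in> K \<Longrightarrow> l \<in> K \<Longrightarrow> \<exists>m\<in>K. \<forall>v\<in>V. m v = k v - l v"
    and inv: "\<And>k l. k \<in> K \<Longrightarrow> l \<in> K \<Longrightarrow> k \<noteq> l \<Longrightarrow> \<exists>m\<in>K. \<forall>v\<in>V. m (k v - l v) = v"
  shows "\<exists>i. card V = card K ^ i"
proof -
  have finK: "finite K" using K2 by (cases "finite K") auto
  define sub where "sub U \<longleftrightarrow> U \<subseteq> V \<and> 0 \<in> U \<and> (\<forall>u\<in>U. \<forall>v\<in>U. u - v \<in> U) \<and>
    (\<forall>k\<in>K. \<forall>u\<in>U. k u \<in> U) \<and> (\<exists>i. card U = card K ^ i)" for U
  have kz: "k 0 = 0" if "k \<in> K" for k using add[OF that V(1) V(1)] by simp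
  have "sub {0}" using V by (auto simp: sub_def kz intro: exI[of _ 0])
  moreover have "\<forall>U. sub U \<longrightarrow> card U < Suc (card V)" using finV by (auto simp: sub_def card_mono less_Suc_eq_le)
  ultimately obtain U where U: "sub U" and Umax: "\<And>U'. sub U' \<Longrightarrow> card U' \<le> card U"
    using ex_has_greatest_nat[of sub "{0}" card "Suc (card V)"] by auto
  have UV: "U \<subseteq> V" "0 \<in> U" and Ud: "\<And>u v. u \<in> U \<Longrightarrow> v \<in> U \<Longrightarrow> u - v \<in> U"
    and Uk: "\<And>k u. k \<in> K \<Longrightarrow> u \<in> U \<Longrightarrow> k u \<in> U" using U by (auto simp: sub_def)
  have Up: "u + v \<in> U" if "u \<in> U" "v \<in> U" for u v
    using Ud[OF that(1) Ud[OF UV(2) that(2)]] by simp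
  have Vp: "u + v \<in> V" if "u \<in> V" "v \<in> V" for u v
    using V(2)[OF that(1) V(2)[OF V(1) that(2)]] by simp
  have kp: "k (u + v) = k u + k v" if "k \<in> K" "u \<in> V" "v \<in> V" for k u v
    using add[OF that(1) Vp[OF that(2,3)] that(3)] by (simp add: algebra_simps)
  have "U = V"
  proof (rule ccontr)
    assume "U \<noteq> V"
    then obtain v where v: "v \<in> V" "v \<notin> U" using UV by auto
    let ?f = "\<lambda>(k, u). k v + u"
    let ?W = "?f ` (K \<times> U)"
    \<comment> \<open>If \<open>k\<close> and \<open>l\<close> differ, then \<open>k v - l v\<close>
      lies in \<open>U\<close> and some \<open>m\<close> recovers \<open>v\<close> from it, against
      \<open>v \<notin> U\<close>.\<close>
    have inj: "inj_on ?f (K \<times> U)"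
    proof (rule inj_onI, clarsimp)
      fix k l u w assume kl: "k \<in> K" "l \<in> K" "u \<in> U" "w \<in> U" "k v + u = l v + w"
      have "k v - l v = w - u" using kl(5) by (simp add: algebra_simps)
      then have *: "k v - l v \<in> U" using Ud kl by simp
      have "k = l"
      proof (rule ccontr)
        assume "k \<noteq> l"
        then obtain m where "m \<in> K" "m (k v - l v) = v" using inv kl v by blast
        then show False using Uk[OF _ *] v by metis
      qed
      then show "k = l \<and> u = w" using kl by simp
    qed
    have cW: "card ?W = card K * card U"
      using card_image[OF inj] by (simp add: card_cartesian_product)
    have "sub ?W"
      unfolding sub_def
    proof (intro conjI ballI)
      show "?W \<subseteq> V" using act v UV Vp by auto
      obtain k where "k \<in> K" using K2 by fastforce
      then obtain z where "z \<in> K" "\<forall>v\<in>V. z v = k v - k v" using diff by blast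
      then show "0 \<in> ?W" using UV v by (intro image_eqI[of _ _ "(z, 0)"]) auto
      show "x - y \<in> ?W" if "x \<in> ?W" "y \<in> ?W" for x y
      proof -
        obtain k l u w where kl: "k \<in> K" "l \<in> K" "u \<in> U" "w \<in> U" "x = k v + u" "y = l v + w"
          using \<open>x \<in> ?W\<close> \<open>y \<in> ?W\<close> by auto
        obtain m where "m \<in> K" "m v = k v - l v" using diff[OF kl(1,2)] v by blast
        then show ?thesis using kl Ud by (intro image_eqI[of _ _ "(m, u - w)"]) auto
      qed
      show "k x \<in> ?W" if kx: "k \<in> K" "x \<in> ?W" for k x
      proof -
        obtain l u where lu: "l \<in> K" "u \<in> U" "x = l v + u" using \<open>x \<in> ?W\<close> by auto
        obtain m where "m \<in> K" "m v = k (l v)" using comp[OF kx(1) lu(1)] v by blast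
        then show ?thesis using lu kx Uk UV act v
          by (intro image_eqI[of _ _ "(m, k u)"]) (auto simp: kp subset_iff)
      qed
      show "\<exists>i. card ?W = card K ^ i"
        using U cW unfolding sub_def by (metis power_Suc)
    qed
    then have "card K * card U \<le> card U" using Umax cW by metis
    moreover have "card U > 0" using UV finV finite_subset by (auto simp: card_gt_0_iff)
    ultimately show False using K2 by simp
  qed
  then show ?thesis using U by (simp add: sub_def)
qed

section \<open>The operator algebra spanned by an abelian group\<close>

text \<open>The linear span as an inductive closure: commutation with a fixed operator, the power
  law and stability under conjugation then pass from \<open>A\<close> to the algebra by rule
  induction. The zero operator arises by scaling with \<open>0\<close>, once \<open>A\<close> is
  nonempty.\<close>

inductive_set op_span :: "('a::field ^ 'd \<Rightarrow> 'a ^ 'd) set \<Rightarrow> ('a ^ 'd \<Rightarrow> 'a ^ 'd) set"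
  for A where
  base: "a \<in> A \<Longrightarrow> a \<in> op_span A"
| add: "f \<in> op_span A \<Longrightarrow> g \<in> op_span A \<Longrightarrow> (\<lambda>v. f v + g v) \<in> op_span A"
| scale: "f \<in> op_span A \<Longrightarrow> (\<lambda>v. c *s f v) \<in> op_span A"

lemma linear_op_span:
  assumes "\<And>a. a \<in> A \<Longrightarrow> linear_op a" "f \<in> op_span A"
  shows "linear_op f"
  using assms(2)
proof induction
  case (base a)
  then show ?case by (rule assms(1))
qed (simp_all add: linear_op_def algebra_simps vector_add_ldistrib vector_smult_assoc)

lemma op_span_comp:
  assumes lin: "\<And>a. a \<in> A \<Longrightarrow> linear_op a"
    and comp: "\<And>a b. a \<in> A \<Longrightarrow> b \<in> A \<Longrightarrow> a \<circ> b \<in> A"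
    and f: "f \<in> op_span A" and g: "g \<in> op_span A"
  shows "f \<circ> g \<in> op_span A"
  using f
proof induction
  case (base a)
  show ?case using g
  proof induction
    case (base b)
    show ?case by (rule op_span.base[OF comp[OF \<open>a \<in> A\<close> base]])
  next
    case (add f g)
    have "a \<circ> (\<lambda>v. f v + g v) = (\<lambda>v. (a \<circ> f) v + (a \<circ> g) v)"
      using linear_op_add[OF lin[OF \<open>a \<in> A\<close>]] by (auto simp: fun_eq_iff)
    then show ?case using op_span.add[OF add.IH] by simp
  next
    case (scale f c)
    have "a \<circ> (\<lambda>v. c *s f v) = (\<lambda>v. c *s (a \<circ> f) v)"
      using linear_op_scale[OF lin[OF \<open>a \<in> A\<close>]] by (auto simp: fun_eq_iff)
    then show ?case using op_span.scale[OF scale.IH] by simp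
  qed
next
  case (add f h)
  then show ?case using op_span.add[OF add.IH] by (simp add: comp_def)
next
  case (scale f c)
  then show ?case using op_span.scale[OF scale.IH] by (simp add: comp_def)
qed

lemma op_span_commute_one:
  assumes lin: "linear_op b" and comm: "\<And>a. a \<in> A \<Longrightarrow> a \<circ> b = b \<circ> a" and f: "f \<in> op_span A"
  shows "f \<circ> b = b \<circ> f"
  using f
proof induction
  case (add f g)
  then show ?case using linear_op_add[OF lin] by (simp add: fun_eq_iff)
next
  case (scale f c)
  then show ?case using linear_op_scale[OF lin] by (simp add: fun_eq_iff)
qed (use comm in auto)

lemma op_span_commute:
  assumes lin: "\<And>a. a \<in> A \<Longrightarrow> linear_op a"
    and comm: "\<And>a b. a \<in> A \<Longrightarrow> b \<in> A \<Longrightarrow> a \<circ> b = b \<circ> a"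
    and f: "f \<in> op_span A" and g: "g \<in> op_span A"
  shows "f \<circ> g = g \<circ> f"
proof -
  have "g \<circ> a = a \<circ> g" if "a \<in> A" for a
    using op_span_commute_one[OF lin[OF that] _ g] comm that by metis
  then show ?thesis
    using op_span_commute_one[OF linear_op_span[OF lin g] _ f] by metis
qed

section \<open>Frobenius powers of commuting operators\<close>

lemma binomial_coeff_card_zero:
  assumes q: "CARD('a::{field,finite}) = q" "primepow q" and k: "0 < k" "k < q"
  shows "of_nat (q choose k) = (0 :: 'a)"
proof -
  obtain p h where p: "prime p" "q = p ^ h" "h > 0" using q by (auto simp: primepow_def)
  \<comment> \<open>Translation by \<open>1\<close> permutes the field, so \<open>q\<close> times
    \<open>1\<close> vanishes. This identifies the characteristic as the prime below
    \<open>q\<close>, and the polynomial identity \<open>(1 + X) ^ q = 1 + X ^ q\<close> then gives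
    the coefficients.\<close>
  have "(\<Sum>x\<in>UNIV. x :: 'a) = (\<Sum>x\<in>UNIV. x + 1)"
    by (rule sum.reindex_bij_witness[of _ "\<lambda>x. x + 1" "\<lambda>x. x - 1"]) auto
  then have "of_nat q = (0 :: 'a)" using q by (simp add: sum.distrib)
  then have "CHAR('a) dvd q" by (simp add: of_nat_eq_0_iff_char_dvd)
  moreover have "prime CHAR('a)"
    by (intro prime_CHAR_semidom finite_imp_CHAR_pos) auto
  ultimately have ch: "CHAR('a) = p" using p
    by (metis prime_dvd_power primes_dvd_imp_eq)
  have "([:1, 1:] :: 'a poly) ^ q = ([:0, 1:] + 1) ^ q" by (simp add: one_pCons)
  also have "\<dots> = [:0, 1:] ^ q + 1 ^ q"
    using p ch by (intro freshmans_dream'[of _ h]) auto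
  finally have eq: "([:1, 1:] :: 'a poly) ^ q = monom 1 q + 1" by (simp add: monom_altdef)
  have "of_nat (q choose k) = coeff (([:1, 1:] :: 'a poly) ^ q) k"
    using k coeff_linear_poly_power[of k q 1 "1::'a"] by simp
  also have "\<dots> = 0" using k by (simp add: eq)
  finally show ?thesis .
qed

text \<open>Multiplication by a nonzero \<open>x\<close> permutes the nonzero elements and hence
  preserves their product.\<close>

lemma field_power_card:
  fixes x :: "'a::{field,finite}"
  shows "x ^ CARD('a) = x"
proof (cases "x = 0")
  case False
  have "x ^ (CARD('a) - 1) * \<Prod>(UNIV - {0}) = (\<Prod>y\<in>UNIV - {0}. x * y)"
    by (simp add: prod.distrib)
  also have "\<dots> = \<Prod>(UNIV - {0})"
    by (rule prod.reindex_bij_witness[of _ "\<lambda>y. y / x" "\<lambda>y. x * y"]) (use False in auto)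
  finally have "x ^ (CARD('a) - 1) = 1" by (simp add: prod_zero_iff)
  then show ?thesis
    by (metis finite_UNIV_card_ge_0 finite_class.finite_UNIV mult.left_neutral power_minus_mult)
qed simp

text \<open>The binomial theorem for iterates under composition, by Pascal's rule.\<close>

lemma funpow_add_linear_op:
  assumes f: "linear_op f" and g: "linear_op g" and comm: "f \<circ> g = g \<circ> f"
  shows "((\<lambda>v. f v + g v) ^^ m) v = (\<Sum>k\<le>m. of_nat (m choose k) *s (f ^^ k) ((g ^^ (m - k)) v))"
proof (induction m)
  case 0
  then show ?case by simp
next
  case (Suc m)
  let ?t = "\<lambda>k l. (f ^^ k) ((g ^^ l) v)"
  have fg: "g ((f ^^ k) w) = (f ^^ k) (g w)" for k w
  proof (induction k)
    case (Suc k)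
    then show ?case using fun_cong[OF comm, of "(f ^^ k) w"] by simp
  qed simp
  have "((\<lambda>v. f v + g v) ^^ Suc m) v =
      (\<Sum>k\<le>m. of_nat (m choose k) *s ?t (Suc k) (m - k)) +
      (\<Sum>k\<le>m. of_nat (m choose k) *s ?t k (Suc m - k))"
    using f g by (simp add: Suc.IH linear_op_sum linear_op_scale fg Suc_diff_le)
  \<comment> \<open>Both sums are brought to the range up to \<open>Suc m\<close>; the explicit
    \<open>0\<close> at \<open>k = 0\<close> replaces \<open>m choose (k - 1)\<close>, which natural
    subtraction would turn into \<open>1\<close>.\<close>
  also have "(\<Sum>k\<le>m. of_nat (m choose k) *s ?t (Suc k) (m - k)) =
      (\<Sum>k=1..Suc m. of_nat (m choose (k - 1)) *s ?t k (Suc m - k))"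
    by (rule sum.reindex_bij_witness[of _ "\<lambda>k. k - 1" Suc]) auto
  also have "\<dots> = (\<Sum>k\<le>Suc m. (if k = 0 then 0 else of_nat (m choose (k - 1))) *s ?t k (Suc m - k))"
    by (rule sum.mono_neutral_cong_left) auto
  also have "(\<Sum>k\<le>m. of_nat (m choose k) *s ?t k (Suc m - k)) =
      (\<Sum>k\<le>Suc m. of_nat (m choose k) *s ?t k (Suc m - k))"
    by (simp add: binomial_eq_0)
  also have "(\<Sum>k\<le>Suc m. (if k = 0 then 0 else of_nat (m choose (k - 1))) *s ?t k (Suc m - k)) +
      (\<Sum>k\<le>Suc m. of_nat (m choose k) *s ?t k (Suc m - k)) =
      (\<Sum>k\<le>Suc m. of_nat (Suc m choose k) *s ?t k (Suc m - k))"
    unfolding sum.distrib[symmetric] vector_sadd_rdistrib[symmetric]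
    by (intro sum.cong refl arg_cong2[where f = "(*s)"]) (auto simp: choose_reduce_nat)
  finally show ?case .
qed

lemma funpow_card_add:
  fixes f g :: "'a::{field,finite} ^ 'd \<Rightarrow> 'a ^ 'd"
  assumes f: "linear_op f" and g: "linear_op g" and comm: "f \<circ> g = g \<circ> f"
    and q: "CARD('a) = q" "primepow q"
  shows "(\<lambda>v. f v + g v) ^^ q = (\<lambda>v. (f ^^ q) v + (g ^^ q) v)"
proof
  fix v
  have q0: "q > 0" using q(2) primepow_gt_0_nat by blast
  let ?t = "\<lambda>k. of_nat (q choose k) *s (f ^^ k) ((g ^^ (q - k)) v)"
  have "((\<lambda>v. f v + g v) ^^ q) v = (\<Sum>k\<le>q. ?t k)"
    by (rule funpow_add_linear_op[OF f g comm])
  also have "\<dots> = (\<Sum>k\<in>{0, q}. ?t k)"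
    using binomial_coeff_card_zero[OF q]
    by (intro sum.mono_neutral_right) (auto simp: vec_eq_iff)
  also have "\<dots> = (f ^^ q) v + (g ^^ q) v" using q0 by (simp add: add.commute)
  finally show "((\<lambda>v. f v + g v) ^^ q) v = (f ^^ q) v + (g ^^ q) v" .
qed

text \<open>Carries the law \<open>f ^^ (q ^ n) = f\<close> from a commuting set of operators to
  sums of elements of its span.\<close>

lemma funpow_card_power_add:
  fixes f g :: "'a::{field,finite} ^ 'd \<Rightarrow> 'a ^ 'd"
  assumes f: "linear_op f" and g: "linear_op g" and comm: "f \<circ> g = g \<circ> f"
    and q: "CARD('a) = q" "primepow q"
  shows "(\<lambda>v. f v + g v) ^^ (q ^ m) = (\<lambda>v. (f ^^ (q ^ m)) v + (g ^^ (q ^ m)) v)"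
proof (induction m)
  case (Suc m)
  have pow_comm: "h ^^ k \<circ> l = l \<circ> h ^^ k" if "h \<circ> l = l \<circ> h" for h l :: "'a ^ 'd \<Rightarrow> 'a ^ 'd" and k
    using that by (induction k) (simp_all add: fun_eq_iff)
  have "f ^^ (q ^ m) \<circ> g ^^ (q ^ m) = g ^^ (q ^ m) \<circ> f ^^ (q ^ m)"
    using pow_comm[OF pow_comm[OF comm, symmetric]] by metis
  then have "((\<lambda>v. f v + g v) ^^ (q ^ m)) ^^ q =
      (\<lambda>v. ((f ^^ (q ^ m)) ^^ q) v + ((g ^^ (q ^ m)) ^^ q) v)"
    unfolding Suc using f g q by (intro funpow_card_add linear_op_funpow)
  then show ?case by (simp add: funpow_mult mult.commute)
qed simp

lemma funpow_scale_linear_op: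
  assumes "linear_op f"
  shows "(\<lambda>v. c *s f v) ^^ m = (\<lambda>v. (c ^ m) *s (f ^^ m) v)"
proof (induction m)
  case (Suc m)
  then show ?case
    using assms by (simp add: fun_eq_iff linear_op_scale vector_smult_assoc)
qed simp

section \<open>Invariant idempotents of a commutative operator algebra\<close>

text \<open>Bezout: the periods of a point under \<open>f\<close> are closed under multiples, and
  multiples of coprime numbers can differ by one.\<close>

lemma fixed_funpow_coprime:
  assumes "(f ^^ a) x = x" "(f ^^ b) x = x" "coprime a b" "a > 0"
  shows "f x = x"
proof -
  have mult: "(f ^^ (c * k)) x = x" if "(f ^^ c) x = x" for c k
    using that by (induction k) (simp_all add: funpow_add)
  obtain u w where "a * u = b * w + 1"
    using assms bezout_nat[of a b] by auto
  then have "(f ^^ (b * w + 1)) x = x" using mult[OF assms(1), of u] by simp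
  then show ?thesis using mult[OF assms(2), of w] by simp
qed

text \<open>All operators are maps of the whole space but effectively live on the image of the
  projection \<open>\<pi>\<close>, which therefore replaces the identity as unit of \<open>R\<close>
  and in the relations between \<open>x\<close> and \<open>x'\<close>. The element \<open>x\<close>
  need not lie in \<open>R\<close>; it acts by conjugation. The witness must be moved at every
  nonzero vector of the image, since only then does it remain moved after restriction to an
  arbitrary invariant idempotent.\<close>

locale op_algebra =
  fixes R :: "('a::{field,finite} ^ 'd \<Rightarrow> 'a ^ 'd) set" and \<pi> x x' :: "'a ^ 'd \<Rightarrow> 'a ^ 'd"
    and q n s :: nat
  assumes q: "CARD('a) = q" "primepow q" and n: "n > 0"
    and lin: "f \<in> R \<Longrightarrow> linear_op f"
    and add: "f \<in> R \<Longrightarrow> g \<in> R \<Longrightarrow> (\<lambda>v. f v + g v) \<in> R"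
    and scale: "f \<in> R \<Longrightarrow> (\<lambda>v. c *s f v) \<in> R"
    and comp: "f \<in> R \<Longrightarrow> g \<in> R \<Longrightarrow> f \<circ> g \<in> R"
    and comm: "f \<in> R \<Longrightarrow> g \<in> R \<Longrightarrow> f \<circ> g = g \<circ> f"
    and one: "\<pi> \<in> R" "f \<in> R \<Longrightarrow> \<pi> \<circ> f = f"
    and frob: "f \<in> R \<Longrightarrow> f ^^ (q ^ n) = f"
    and x: "linear_op x" "linear_op x'" "x \<circ> x' = \<pi>" "x' \<circ> x = \<pi>"
    and conjR: "f \<in> R \<Longrightarrow> x \<circ> f \<circ> x' \<in> R"
    and s: "prime s" "f \<in> R \<Longrightarrow> ((\<lambda>f. x \<circ> f \<circ> x') ^^ s) f = f"
    and witness: "\<exists>a\<in>R. \<forall>v. v \<noteq> 0 \<longrightarrow> \<pi> v = v \<longrightarrow> x (a (x' v)) \<noteq> a v"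
begin

text \<open>On \<open>R\<close> this is an algebra automorphism whose order divides
  \<open>s\<close>.\<close>

definition \<phi> :: "('a ^ 'd \<Rightarrow> 'a ^ 'd) \<Rightarrow> ('a ^ 'd \<Rightarrow> 'a ^ 'd)" where
  "\<phi> f = x \<circ> f \<circ> x'"

definition Z :: "'a ^ 'd \<Rightarrow> 'a ^ 'd" where "Z = (\<lambda>v. 0)"

lemma q_ge_2: "q \<ge> 2"
  using q(2) primepow_gt_Suc_0[of q] by simp

lemma \<phi>_s: "f \<in> R \<Longrightarrow> (\<phi> ^^ s) f = f"
  using s(2) unfolding \<phi>_def[abs_def] .

lemma \<phi>_R: "f \<in> R \<Longrightarrow> \<phi> f \<in> R"
  using conjR by (simp add: \<phi>_def)

lemma \<phi>_pow_R: "f \<in> R \<Longrightarrow> (\<phi> ^^ k) f \<in> R"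
  by (induction k) (auto simp: \<phi>_R)

lemma one_right: "f \<in> R \<Longrightarrow> f \<circ> \<pi> = f"
  using one comm by metis

lemma \<phi>_comp:
  assumes "f \<in> R" "g \<in> R"
  shows "\<phi> (f \<circ> g) = \<phi> f \<circ> \<phi> g"
proof -
  have "\<phi> f \<circ> \<phi> g = x \<circ> (f \<circ> (x' \<circ> x) \<circ> g) \<circ> x'" by (simp add: \<phi>_def comp_assoc)
  also have "\<dots> = \<phi> (f \<circ> g)" using assms one_right x(4) by (simp add: \<phi>_def comp_assoc)
  finally show ?thesis by simp
qed

lemma \<phi>_add: "\<phi> (\<lambda>v. f v + g v) = (\<lambda>v. \<phi> f v + \<phi> g v)"
  using x(1) by (auto simp: \<phi>_def linear_op_add)

lemma \<phi>_diff: "\<phi> (\<lambda>v. f v - g v) = (\<lambda>v. \<phi> f v - \<phi> g v)"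
  using x(1) by (auto simp: \<phi>_def linear_op_diff)

lemma \<phi>_scale: "\<phi> (\<lambda>v. c *s f v) = (\<lambda>v. c *s \<phi> f v)"
  using x(1) by (auto simp: \<phi>_def linear_op_scale)

lemma \<phi>_zero: "\<phi> Z = Z"
  using x(1) by (auto simp: \<phi>_def Z_def linear_op_zero)

lemma \<phi>_inj: assumes "f \<in> R" "g \<in> R" "\<phi> f = \<phi> g" shows "f = g"
proof -
  have "(\<phi> ^^ s) f = (\<phi> ^^ s) g"
    using assms(3) s(1) prime_gt_0_nat[of s] by (cases s) (auto simp: funpow_swap1)
  then show ?thesis using \<phi>_s assms by simp
qed

lemma diff: "f \<in> R \<Longrightarrow> g \<in> R \<Longrightarrow> (\<lambda>v. f v - g v) \<in> R"
  using add[OF _ scale[of g "- 1"]] by (simp add: vector_smult_lneg)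

lemma zero: "Z \<in> R"
  using diff[OF one(1) one(1)] by (simp add: Z_def)

lemma funpow_R: "f \<in> R \<Longrightarrow> k > 0 \<Longrightarrow> f ^^ k \<in> R"
proof (induction k)
  case (Suc k)
  then show ?case using comp[of f "f ^^ k"] by (cases "k = 0") (simp_all add: comp_def)
qed simp

lemma sum_R: "finite I \<Longrightarrow> (\<And>i. i \<in> I \<Longrightarrow> f i \<in> R) \<Longrightarrow> (\<lambda>v. \<Sum>i\<in>I. f i v) \<in> R"
proof (induction I rule: finite_induct)
  case empty
  then show ?case using zero by (simp add: Z_def)
next
  case (insert i I)
  then show ?case using add[of "f i"] by simp
qed

abbreviation idem :: "('a ^ 'd \<Rightarrow> 'a ^ 'd) \<Rightarrow> bool" where
  "idem e \<equiv> e \<in> R \<and> e \<circ> e = e"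

text \<open>The primitive idempotents of \<open>R\<close>; the relation
  \<open>f \<circ> e = f\<close> says that \<open>f\<close> lies below \<open>e\<close>.\<close>

definition minimal :: "('a ^ 'd \<Rightarrow> 'a ^ 'd) \<Rightarrow> bool" where
  "minimal e \<longleftrightarrow> idem e \<and> e \<noteq> Z \<and> (\<forall>f. idem f \<longrightarrow> f \<circ> e = f \<longrightarrow> f \<noteq> Z \<longrightarrow> f = e)"

text \<open>An idempotent with smallest image is chosen. An idempotent \<open>f\<close> below
  \<open>e\<close> with the same image is equal to \<open>e\<close>, because \<open>f\<close> fixes
  its image pointwise.\<close>

lemma exists_minimal:
  assumes "idem \<epsilon>" "\<epsilon> \<noteq> Z"
  obtains e where "minimal e" "e \<circ> \<epsilon> = e"
proof -
  let ?P = "\<lambda>f. idem f \<and> f \<noteq> Z \<and> f \<circ> \<epsilon> = f"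
  have "?P \<epsilon>" using assms by auto
  then obtain e where e: "?P e" and min: "\<And>f. ?P f \<Longrightarrow> card (range e) \<le> card (range f)"
    using ex_has_least_nat[of ?P \<epsilon> "\<lambda>f. card (range f)"] by auto
  have "f = e" if f: "idem f" "f \<circ> e = f" "f \<noteq> Z" for f
  proof -
    have ef: "e \<circ> f = f" using f e comm by metis
    have "f \<circ> \<epsilon> = f \<circ> (e \<circ> \<epsilon>)" using f by (metis comp_assoc)
    then have "?P f" using f e by auto
    then have "card (range e) \<le> card (range f)" by (rule min)
    moreover have "range f \<subseteq> range e" by (subst ef[symmetric]) auto
    ultimately have "range f = range e" by (intro card_seteq) auto
    have "f (e v) = e v" for v
    proof -
      obtain w where "e v = f w" using \<open>range f = range e\<close> by (metis rangeE rangeI)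
      then show ?thesis using f(1) by (metis comp_apply)
    qed
    then show ?thesis using f(2) by (metis comp_apply ext)
  qed
  then show ?thesis using that[of e] e by (auto simp: minimal_def)
qed

text \<open>From \<open>f ^^ (q ^ n) = f\<close>, the power \<open>q ^ n - 1\<close> acts as a unit
  for \<open>f\<close> and hence for all its positive powers.\<close>

lemma idem_power:
  assumes f: "f \<in> R" "f \<noteq> Z"
  shows "idem (f ^^ (q ^ n - 1))" "f ^^ (q ^ n - 1) \<noteq> Z" "f ^^ (q ^ n - 1) \<circ> f = f"
proof -
  let ?N = "q ^ n - 1"
  have "2 \<le> q ^ n" using q_ge_2 n by (metis power_one_right power_increasing one_le_numeral order_trans Suc_leI One_nat_def)
  then have N: "?N > 0" "Suc ?N = q ^ n" by auto
  have *: "f ^^ ?N \<circ> f = f" using frob[OF f(1)] N by (metis funpow_Suc_right)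
  have "f ^^ ?N \<circ> f ^^ ?N = (f ^^ ?N \<circ> f) \<circ> f ^^ (?N - 1)"
    using N by (metis Suc_diff_1 comp_assoc funpow.simps(2))
  also have "\<dots> = f ^^ ?N" unfolding * using N by (metis Suc_diff_1 funpow.simps(2))
  finally show "idem (f ^^ ?N)" using funpow_R f N by auto
  show "f ^^ ?N \<circ> f = f" by (rule *)
  show "f ^^ ?N \<noteq> Z"
  proof
    assume "f ^^ ?N = Z"
    then have "Z \<circ> f = f" using * by simp
    then show False using f(2) by (auto simp: Z_def comp_def)
  qed
qed

text \<open>The corner of \<open>R\<close> cut out by the idempotent \<open>e\<close>, with
  \<open>e\<close> as its unit, as a record to which the results on finite fields apply.\<close>

definition opring :: "('a ^ 'd \<Rightarrow> 'a ^ 'd) \<Rightarrow> ('a ^ 'd \<Rightarrow> 'a ^ 'd) ring" where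
  "opring e = \<lparr>carrier = {f \<in> R. f \<circ> e = f}, monoid.mult = (\<circ>), one = e,
     ring.zero = Z, add = (\<lambda>f g v. f v + g v)\<rparr>"

lemma opring_simps:
  "carrier (opring e) = {f \<in> R. f \<circ> e = f}" "f \<otimes>\<^bsub>opring e\<^esub> g = f \<circ> g"
  "\<one>\<^bsub>opring e\<^esub> = e" "\<zero>\<^bsub>opring e\<^esub> = Z" "f \<oplus>\<^bsub>opring e\<^esub> g = (\<lambda>v. f v + g v)"
  by (simp_all add: opring_def)

text \<open>For nonzero \<open>f\<close> below \<open>e\<close>, the idempotent
  \<open>f ^^ (q ^ n - 1)\<close> is nonzero and below \<open>e\<close>, so primitivity makes it
  equal to \<open>e\<close>. The preceding power of \<open>f\<close> is then the inverse.\<close>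

lemma field_opring:
  assumes e: "minimal e"
  shows "field (opring e)"
proof -
  have eR: "e \<in> R" "e \<circ> e = e" "e \<noteq> Z" using e by (auto simp: minimal_def)
  have ef: "e \<circ> f = f" if "f \<in> R" "f \<circ> e = f" for f using comm[of e f] eR that by simp
  have cring: "cring (opring e)"
  proof (intro cringI abelian_groupI comm_monoidI, unfold opring_simps)
    fix f assume f: "f \<in> {f \<in> R. f \<circ> e = f}"
    have "(\<lambda>v. - 1 *s f v) \<in> R" using f scale by blast
    then show "\<exists>g\<in>{f \<in> R. f \<circ> e = f}. (\<lambda>v. g v + f v) = Z"
      using f by (intro bexI[of _ "\<lambda>v. - 1 *s f v"]) (auto simp: Z_def fun_eq_iff vec_eq_iff)
    fix g assume g: "g \<in> {f \<in> R. f \<circ> e = f}"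
    show "(\<lambda>v. f v + g v) \<in> {f \<in> R. f \<circ> e = f}" using f g add by (auto simp: fun_eq_iff)
    show "f \<circ> g \<in> {f \<in> R. f \<circ> e = f}" using f g comp by (auto simp: comp_assoc)
    show "f \<circ> g = g \<circ> f" using f g comm by auto
    fix h
    show "(\<lambda>v. f v + g v) \<circ> h = (\<lambda>v. (f \<circ> h) v + (g \<circ> h) v)" by auto
  next
    show "Z \<in> {f \<in> R. f \<circ> e = f}" using zero by (auto simp: Z_def)
  qed (use eR ef in \<open>auto simp: Z_def add_ac comp_assoc\<close>)
  have "\<exists>g\<in>carrier (opring e). g \<circ> f = e" if f: "f \<in> R" "f \<circ> e = f" "f \<noteq> Z" for f
  proof -
    let ?N = "q ^ n - 1"
    note ip = idem_power[OF f(1,3)]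
    have N: "?N > 0"
    proof (rule ccontr)
      assume "\<not> ?N > 0"
      then have "q ^ n \<le> 1" by simp
      then show False using one_less_power[of q n] q_ge_2 n by simp
    qed
    have Ne: "f ^^ ?N = e"
    proof -
      have "f ^^ ?N \<circ> e = f ^^ (?N - 1) \<circ> (f \<circ> e)"
        using N by (metis Suc_diff_1 comp_assoc funpow_Suc_right)
      also have "\<dots> = f ^^ ?N" using N f(2) by (metis Suc_diff_1 funpow_Suc_right)
      finally show ?thesis using e ip by (auto simp: minimal_def)
    qed
    \<comment> \<open>The factor \<open>e\<close> matters when \<open>?N = 1\<close>: the zeroth
      iterate is the identity map, which need not lie in \<open>R\<close>.\<close>
    let ?g = "f ^^ (?N - 1) \<circ> e"
    have gf: "?g \<circ> f = e"
      using Ne N ef[OF f(1,2)] by (metis Suc_diff_1 comp_assoc funpow_Suc_right)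
    have "?g \<in> R" using eR comp funpow_R[OF f(1)] by (cases "?N - 1 = 0") auto
    then show ?thesis using gf eR by (intro bexI[of _ ?g]) (auto simp: opring_simps comp_assoc)
  qed
  then have inv: "\<exists>g\<in>carrier (opring e). g \<otimes>\<^bsub>opring e\<^esub> f = \<one>\<^bsub>opring e\<^esub>"
    if "f \<in> carrier (opring e)" "f \<noteq> \<zero>\<^bsub>opring e\<^esub>" for f
    using that by (simp add: opring_simps)
  interpret E: cring "opring e" by (rule cring)
  show ?thesis
  proof (rule E.cring_fieldI)
    show "Units (opring e) = carrier (opring e) - {\<zero>\<^bsub>opring e\<^esub>}"
    proof (intro equalityI subsetI)
      fix f assume f: "f \<in> Units (opring e)"
      then have "f \<in> carrier (opring e)" by auto
      moreover have "f \<noteq> Z"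
      proof
        assume "f = Z"
        moreover obtain g where "g \<otimes>\<^bsub>opring e\<^esub> f = e"
          using f by (auto simp: Units_def opring_simps)
        moreover obtain g' where "f \<otimes>\<^bsub>opring e\<^esub> g' = e"
          using f by (auto simp: Units_def opring_simps)
        ultimately show False using eR(3) by (auto simp: opring_simps Z_def comp_def)
      qed
      ultimately show "f \<in> carrier (opring e) - {\<zero>\<^bsub>opring e\<^esub>}" by (simp add: opring_simps)
    next
      fix f assume f: "f \<in> carrier (opring e) - {\<zero>\<^bsub>opring e\<^esub>}"
      then obtain g where "g \<in> carrier (opring e)" "g \<otimes>\<^bsub>opring e\<^esub> f = \<one>\<^bsub>opring e\<^esub>"
        using inv by blast
      then show "f \<in> Units (opring e)" using f E.m_comm[of f g] unfolding Units_def by force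
    qed
  qed
qed

lemma minimal_faithful:
  assumes e: "minimal e" and f: "f \<in> R" "f \<circ> e = f" "f \<noteq> Z" and v: "e v = v" "f v = 0"
  shows "v = 0"
proof -
  interpret E: field "opring e" by (rule field_opring[OF e])
  have "f \<in> Units (opring e)" using f E.field_Units by (simp add: opring_simps)
  then obtain g where g: "g \<in> R" "g \<circ> f = e" by (auto simp: Units_def opring_simps)
  have "g (f v) = (g \<circ> f) v" by simp
  also have "\<dots> = v" unfolding g by (rule v(1))
  finally have "g (f v) = v" .
  then show ?thesis using v(2) linear_op_zero[OF lin[OF g(1)]] by simp
qed

text \<open>The corner \<open>K\<close> is a field of order \<open>q ^ d\<close>, and the image of
  \<open>e\<close> is a vector space over it, so it remains to see that \<open>s\<close> divides
  \<open>d\<close>. Otherwise \<open>\<phi>\<close>, whose iterates \<open>s\<close> and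
  \<open>d\<close> are both trivial on \<open>K\<close>, would itself be trivial there, which the
  witness excludes.\<close>

lemma card_minimal_fixed:
  assumes e: "minimal e" and fixed: "\<phi> e = e"
  shows "\<exists>k. card (range e) = q ^ (s * k)"
proof -
  have eR: "e \<in> R" "e \<circ> e = e" "e \<noteq> Z" using e by (auto simp: minimal_def)
  define K where "K = {f \<in> R. f \<circ> e = f}"
  have KR: "f \<in> R" "f \<circ> e = f" "e \<circ> f = f" if "f \<in> K" for f
    using that comm[of e f] eR by (auto simp: K_def)
  have eK: "e \<in> K" using eR by (simp add: K_def)
  have ZK: "Z \<in> K" using zero by (auto simp: K_def Z_def)
  have diffK: "(\<lambda>v. f v - g v) \<in> K" if "f \<in> K" "g \<in> K" for f g
    using diff[of f g] that by (auto simp: K_def fun_eq_iff)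
  have compK: "f \<circ> g \<in> K" if "f \<in> K" "g \<in> K" for f g
    using comp[of f g] that by (auto simp: K_def comp_assoc)
  interpret E: field "opring e" by (rule field_opring[OF e])
  have carK: "carrier (opring e) = K" by (simp add: K_def opring_simps)
  have inj_at: "f = g" if "f \<in> K" "g \<in> K" "f v = g v" "e v = v" "v \<noteq> 0" for f g v
  proof (rule ccontr)
    assume "f \<noteq> g"
    then have "(\<lambda>v. f v - g v) \<noteq> Z" by (auto simp: Z_def fun_eq_iff)
    then show False
      using minimal_faithful[OF e, of "\<lambda>v. f v - g v" v] diffK[OF that(1,2)] that KR by auto
  qed
  obtain v where v: "e v = v" "v \<noteq> 0"
  proof -
    obtain w where "e w \<noteq> 0" using eR(3) by (auto simp: Z_def)
    then show ?thesis using that[of "e w"] eR(2) by (metis comp_apply)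
  qed
  have K2: "card K \<ge> 2"
    using card_mono[of K "{Z, e}"] eK ZK eR(3) by simp
  \<comment> \<open>Evaluation at \<open>v\<close> embeds \<open>K\<close> as a subspace over the
    ground field.\<close>
  obtain d where d: "card K = q ^ d"
  proof -
    let ?U = "(\<lambda>f. f v) ` K"
    have "vec.subspace ?U"
      unfolding vec.subspace_def
    proof (intro conjI ballI allI)
      show "0 \<in> ?U" using ZK by (auto simp: Z_def image_iff)
      show "a + b \<in> ?U" if ab: "a \<in> ?U" "b \<in> ?U" for a b
      proof -
        obtain f g where fg: "f \<in> K" "g \<in> K" "a = f v" "b = g v" using ab by blast
        have "(\<lambda>v. f v + g v) \<in> K" using fg add[of f g] by (auto simp: K_def fun_eq_iff)
        then show ?thesis using fg by (auto simp: image_iff intro: bexI[of _ "\<lambda>v. f v + g v"])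
      qed
      show "c *s a \<in> ?U" if a: "a \<in> ?U" for a c
      proof -
        obtain f where f: "f \<in> K" "a = f v" using a by blast
        have "(\<lambda>v. c *s f v) \<in> K" using f scale[of f c] by (auto simp: K_def fun_eq_iff)
        then show ?thesis using f by (auto simp: image_iff intro: bexI[of _ "\<lambda>v. c *s f v"])
      qed
    qed
    then have "card ?U = q ^ vec.dim ?U" using card_subspace q by blast
    moreover have "card ?U = card K" using v by (intro card_image inj_onI) (auto intro: inj_at)
    ultimately show ?thesis using that by simp
  qed
  have "s dvd d"
  proof (rule ccontr)
    assume "\<not> s dvd d"
    then have cop: "coprime s d" using prime_imp_coprime[OF s(1)] by blast
    have pow: "f [^]\<^bsub>opring e\<^esub> (k::nat) = f ^^ k \<circ> e" if "f \<in> K" for f k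
    proof (induction k)
      case 0
      then show ?case by (simp add: opring_simps)
    next
      case (Suc k)
      have "f [^]\<^bsub>opring e\<^esub> Suc k = f ^^ k \<circ> (e \<circ> f)"
        by (simp add: Suc opring_simps fun_eq_iff)
      then show ?case using KR[OF that] by (metis comp_assoc funpow_Suc_right)
    qed
    have q0: "q > 0" using q_ge_2 by simp
    have powq: "f [^]\<^bsub>opring e\<^esub> q = f ^^ q" if "f \<in> K" for f
    proof -
      have "f ^^ q \<circ> e = f ^^ (q - 1) \<circ> (f \<circ> e)"
        using q0 by (metis Suc_diff_1 comp_assoc funpow_Suc_right)
      also have "\<dots> = f ^^ q" using q0 KR(2)[OF that] by (metis Suc_diff_1 funpow_Suc_right)
      finally show ?thesis using pow[OF that] by simp
    qed
    \<comment> \<open>The copy of the ground field inside the corner; \<open>\<phi>\<close> fixes it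
      because it fixes \<open>e\<close>.\<close>
    let ?F = "range (\<lambda>c. \<lambda>v. c *s e v)"
    have FK: "?F \<subseteq> K" using eR scale[OF eR(1)] by (auto simp: K_def fun_eq_iff)
    have cF: "card ?F = q"
    proof -
      have "inj (\<lambda>c. \<lambda>v. c *s e v)"
      proof (rule injI)
        fix c c' assume "(\<lambda>v. c *s e v) = (\<lambda>v. c' *s e v)"
        then have "c *s v = c' *s v" using v by metis
        then show "c = c'" using v by simp
      qed
      then show ?thesis using q by (simp add: card_image)
    qed
    have dK: "f \<ominus>\<^bsub>opring e\<^esub> g = (\<lambda>v. f v - g v)" if "f \<in> K" "g \<in> K" for f g
    proof -
      have "(\<lambda>v. f v - g v) \<oplus>\<^bsub>opring e\<^esub> g = f" by (simp add: opring_simps)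
      then have "(\<lambda>v. f v - g v) = f \<oplus>\<^bsub>opring e\<^esub> (\<ominus>\<^bsub>opring e\<^esub> g)"
        using E.add.inv_solve_right[of "\<lambda>v. f v - g v" f g] that diffK[OF that] carK by simp
      then show ?thesis by (simp add: E.minus_eq)
    qed
    have fixK: "(\<phi> ^^ d) f = f" if f: "f \<in> K" for f
    proof (rule E.finite_field_automorphism_period[where q = q and d = d and F = ?F])
      show "finite (carrier (opring e))" by simp
      show "card (carrier (opring e)) = q ^ d" using d carK by simp
      show "2 \<le> q" by (rule q_ge_2)
      show "?F \<subseteq> carrier (opring e)" using FK carK by simp
      show "card ?F = q" by (rule cF)
      show "c \<ominus>\<^bsub>opring e\<^esub> c' \<in> ?F" if cc: "c \<in> ?F" "c' \<in> ?F" for c c'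
      proof -
        obtain a b where ab: "c = (\<lambda>v. a *s e v)" "c' = (\<lambda>v. b *s e v)" using cc by auto
        have "c \<ominus>\<^bsub>opring e\<^esub> c' = (\<lambda>v. (a - b) *s e v)"
          using dK[of c c'] cc FK ab by (auto simp: vector_sub_rdistrib)
        then show ?thesis by auto
      qed
      show "(\<lambda>f. f [^]\<^bsub>opring e\<^esub> q) \<in> ring_hom (opring e) (opring e)"
      proof (rule ring_hom_memI)
        fix f g assume "f \<in> carrier (opring e)" "g \<in> carrier (opring e)"
        then have fg: "f \<in> K" "g \<in> K" using carK by auto
        show "(f \<otimes>\<^bsub>opring e\<^esub> g) [^]\<^bsub>opring e\<^esub> q = f [^]\<^bsub>opring e\<^esub> q \<otimes>\<^bsub>opring e\<^esub> g [^]\<^bsub>opring e\<^esub> q"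
          using fg carK by (simp add: E.nat_pow_distrib)
        have "f \<oplus>\<^bsub>opring e\<^esub> g \<in> K" using fg carK by (metis E.add.m_closed)
        then have "(f \<oplus>\<^bsub>opring e\<^esub> g) [^]\<^bsub>opring e\<^esub> q = (\<lambda>v. f v + g v) ^^ q"
          using powq by (simp add: opring_simps)
        also have "\<dots> = (\<lambda>v. (f ^^ q) v + (g ^^ q) v)"
          using fg KR lin comm q by (intro funpow_card_add) auto
        finally show "(f \<oplus>\<^bsub>opring e\<^esub> g) [^]\<^bsub>opring e\<^esub> q =
            f [^]\<^bsub>opring e\<^esub> q \<oplus>\<^bsub>opring e\<^esub> g [^]\<^bsub>opring e\<^esub> q"
          using fg powq by (simp add: opring_simps)
      qed (use carK in auto)
      show "c [^]\<^bsub>opring e\<^esub> q = c" if c: "c \<in> ?F" for c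
      proof -
        obtain a where a: "c = (\<lambda>v. a *s e v)" using c by auto
        have "c ^^ q = (\<lambda>v. (a ^ q) *s (e ^^ q) v)"
          unfolding a using lin[OF eR(1)] by (rule funpow_scale_linear_op)
        moreover have "e ^^ k = e" if "k > 0" for k
          using that eR(2) by (induction k rule: nat_induct_non_zero) auto
        moreover have "a ^ q = a" using field_power_card[of a] q(1) by simp
        ultimately have "c ^^ q = c" using q0 a by simp
        moreover have "c \<in> K" using c FK by blast
        ultimately show ?thesis using powq by simp
      qed
      show "\<phi> \<in> ring_hom (opring e) (opring e)"
      proof (rule ring_hom_memI)
        fix f assume "f \<in> carrier (opring e)"
        then have f: "f \<in> R" "f \<circ> e = f" by (auto simp: opring_simps)
        then have "\<phi> f \<circ> e = \<phi> f" using \<phi>_comp[OF f(1) eR(1)] fixed by simp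
        then show "\<phi> f \<in> carrier (opring e)" using \<phi>_R f by (auto simp: opring_simps)
      qed (auto simp: opring_simps \<phi>_comp \<phi>_add fixed)
      show "\<phi> c = c" if "c \<in> ?F" for c
        using that fixed by (auto simp: \<phi>_scale)
      show "f \<in> carrier (opring e)" using f carK by simp
    qed
    \<comment> \<open>Cut down to the corner, the witness would be fixed by \<open>\<phi>\<close>;
      evaluated at \<open>v\<close>, this contradicts its choice.\<close>
    obtain a where a: "a \<in> R" "\<And>v. v \<noteq> 0 \<Longrightarrow> \<pi> v = v \<Longrightarrow> \<phi> a v \<noteq> a v"
      using witness by (auto simp: \<phi>_def)
    have ae: "a \<circ> e \<in> K" using a eR comp by (auto simp: K_def comp_assoc)
    have "\<phi> (a \<circ> e) = a \<circ> e"
    proof (rule fixed_funpow_coprime)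
      show "(\<phi> ^^ s) (a \<circ> e) = a \<circ> e" using \<phi>_s KR(1)[OF ae] .
      show "(\<phi> ^^ d) (a \<circ> e) = a \<circ> e" using fixK ae .
    qed (use cop s(1) prime_gt_0_nat in auto)
    then have "(\<phi> a \<circ> e) v = (a \<circ> e) v"
      using \<phi>_comp[OF a(1) eR(1)] fixed by simp
    then have "\<phi> a (e v) = a (e v)" by simp
    moreover have "\<pi> v = v" using fun_cong[OF one(2)[OF eR(1)], of v] v by simp
    ultimately show False using a(2)[of v] v by simp
  qed
  have "\<exists>i. card (range e) = card K ^ i"
  proof (rule card_power_of_free_action)
    show "0 \<in> range e" using linear_op_zero[OF lin[OF eR(1)]] by (intro range_eqI[of _ _ 0]) simp
    show "v - w \<in> range e" if vw: "v \<in> range e" "w \<in> range e" for v w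
    proof -
      obtain a b where "v = e a" "w = e b" using vw by auto
      then have "v - w = e (a - b)" using linear_op_diff[OF lin[OF eR(1)], of a b] by simp
      then show ?thesis by simp
    qed
    show "k v \<in> range e" if "k \<in> K" for k v using KR(3)[OF that] by (metis comp_apply rangeI)
    show "k (v - w) = k v - k w" if "k \<in> K" for k v w
      using linear_op_diff[OF lin[OF KR(1)[OF that]]] .
    show "\<exists>m\<in>K. \<forall>v\<in>range e. m v = k (l v)" if "k \<in> K" "l \<in> K" for k l
      using compK[OF that] by (intro bexI[of _ "k \<circ> l"]) auto
    show "\<exists>m\<in>K. \<forall>v\<in>range e. m v = k v - l v" if "k \<in> K" "l \<in> K" for k l
      using diffK[OF that] by (intro bexI) auto
    show "\<exists>m\<in>K. \<forall>v\<in>range e. m (k v - l v) = v" if kl: "k \<in> K" "l \<in> K" "k \<noteq> l" for k l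
    proof -
      have "(\<lambda>v. k v - l v) \<noteq> Z" using kl by (auto simp: Z_def fun_eq_iff)
      then have "(\<lambda>v. k v - l v) \<in> Units (opring e)"
        using E.field_Units diffK[OF kl(1,2)] carK by (simp add: opring_simps)
      then obtain m where "m \<in> K" "m \<circ> (\<lambda>v. k v - l v) = e"
        using carK by (auto simp: Units_def opring_simps)
      moreover have "e v = v" if v: "v \<in> range e" for v
      proof -
        obtain w where "v = e w" using v by auto
        then show ?thesis using fun_cong[OF eR(2), of w] by simp
      qed
      moreover have "m (k v - l v) = (m \<circ> (\<lambda>v. k v - l v)) v" for v by simp
      ultimately show ?thesis by (intro bexI[of _ m] ballI) (simp_all only:)
    qed
  qed (use K2 in auto)
  then obtain i where "card (range e) = (q ^ d) ^ i" using d by auto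
  moreover obtain k where "d = s * k" using \<open>s dvd d\<close> by blast
  ultimately have "card (range e) = q ^ (s * (k * i))" by (simp add: power_mult[symmetric] mult.assoc)
  then show ?thesis by blast
qed

section \<open>Orbits of primitive idempotents and the dimension of the image\<close>

lemma minimal_\<phi>:
  assumes e: "minimal e"
  shows "minimal (\<phi> e)"
  unfolding minimal_def
proof (intro conjI allI impI)
  have eR: "e \<in> R" "e \<circ> e = e" "e \<noteq> Z" using e by (auto simp: minimal_def)
  show "\<phi> e \<in> R" using \<phi>_R eR by blast
  show "\<phi> e \<circ> \<phi> e = \<phi> e" using \<phi>_comp[OF eR(1) eR(1)] eR by simp
  show "\<phi> e \<noteq> Z" using \<phi>_inj[OF eR(1) zero] \<phi>_zero eR by metis
  fix f assume f: "idem f" "f \<circ> \<phi> e = f" "f \<noteq> Z"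
  \<comment> \<open>The iterate \<open>s - 1\<close> inverts \<open>\<phi>\<close> on
    \<open>R\<close>, so \<open>g\<close> is the preimage of \<open>f\<close>, to be compared with
    \<open>e\<close>.\<close>
  obtain t where t: "s = Suc t" using s(1) prime_gt_0_nat by (metis Suc_pred)
  define g where "g = (\<phi> ^^ t) f"
  have gR: "g \<in> R" using f \<phi>_pow_R by (simp add: g_def)
  have \<phi>g: "\<phi> g = f" using \<phi>_s[of f] f t by (simp add: g_def)
  have "\<phi> (g \<circ> g) = \<phi> g" using \<phi>_comp[OF gR gR] \<phi>g f by simp
  then have "g \<circ> g = g" using \<phi>_inj comp gR by blast
  moreover have "\<phi> (g \<circ> e) = \<phi> g" using \<phi>_comp[OF gR eR(1)] \<phi>g f by simp
  then have "g \<circ> e = g" using \<phi>_inj comp gR eR by blast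
  moreover have "g \<noteq> Z" using \<phi>_zero \<phi>g f by auto
  ultimately have "g = e" using e gR by (auto simp: minimal_def)
  then show "f = \<phi> e" using \<phi>g by simp
qed

lemma minimal_orthogonal:
  assumes e: "minimal e" and f: "minimal f" and ne: "e \<noteq> f"
  shows "e \<circ> f = Z"
proof (rule ccontr)
  assume nz: "e \<circ> f \<noteq> Z"
  have R: "e \<in> R" "f \<in> R" "e \<circ> e = e" "f \<circ> f = f" using e f by (auto simp: minimal_def)
  have cm: "e \<circ> f = f \<circ> e" using comm R by blast
  have id: "idem (e \<circ> f)" using comp R cm by (metis comp_assoc)
  have "e \<circ> f = e" using e id nz cm R(3) unfolding minimal_def by (metis comp_assoc)
  moreover have "e \<circ> f = f" using f id nz R(4) unfolding minimal_def by (metis comp_assoc)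
  ultimately show False using ne by simp
qed

lemma card_range_add:
  assumes e: "idem e" and f: "idem f" and ef: "e \<circ> f = Z"
  shows "card (range (\<lambda>v. e v + f v)) = card (range e) * card (range f)"
proof -
  have fe: "f \<circ> e = Z" using ef comm e f by metis
  have app: "e (e v) = e v" "f (f v) = f v" "e (f v) = 0" "f (e v) = 0" for v
    using e f ef fe by (auto simp: fun_eq_iff Z_def)
  have la: "e (v + w) = e v + e w" "f (v + w) = f v + f w" for v w
    using e f lin linear_op_add by blast+
  let ?h = "\<lambda>(a, b). a + b"
  have "range (\<lambda>v. e v + f v) = ?h ` (range e \<times> range f)"
  proof (intro equalityI subsetI)
    fix y assume "y \<in> ?h ` (range e \<times> range f)"
    then obtain v w where "y = e v + f w" by auto
    then have "y = e (e v + f w) + f (e v + f w)" by (simp add: la app)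
    then show "y \<in> range (\<lambda>v. e v + f v)" by blast
  qed auto
  moreover have "inj_on ?h (range e \<times> range f)"
  proof (rule inj_onI, clarsimp)
    fix a b v w assume eq: "e a + f v = e b + f w"
    have "e (e a + f v) = e (e b + f w)" "f (e a + f v) = f (e b + f w)" using eq by simp_all
    then show "e a = e b \<and> f v = f w" by (simp add: la app)
  qed
  ultimately show ?thesis using card_image[of ?h "range e \<times> range f"]
    by (simp add: card_cartesian_product)
qed

lemma card_range_\<phi>:
  assumes "f \<in> R"
  shows "card (range (\<phi> f)) = card (range f)"
proof -
  have f: "f (\<pi> v) = f v" "\<pi> (f v) = f v" for v
    using one(2)[OF assms] one_right[OF assms] by (metis comp_apply)+
  have xx: "x' (x v) = \<pi> v" for v using x(4) by (metis comp_apply)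
  have "range (\<phi> f) = x ` range f"
  proof (intro equalityI subsetI)
    fix y assume "y \<in> x ` range f"
    then obtain v where "y = x (f v)" by auto
    then have "y = \<phi> f (x v)" by (simp add: \<phi>_def xx f)
    then show "y \<in> range (\<phi> f)" by blast
  qed (auto simp: \<phi>_def)
  moreover have "inj_on x (range f)"
    by (rule inj_on_inverseI[of _ x']) (auto simp: xx f)
  ultimately show ?thesis by (simp add: card_image)
qed

text \<open>A primitive idempotent below \<open>\<epsilon>\<close> is either fixed or has an orbit
  of exactly \<open>s\<close> members, as \<open>s\<close> is prime. In the second case these are
  orthogonal with images of equal size, and their sum is an invariant idempotent whose image has
  that size to the power \<open>s\<close>.\<close>

lemma invariant_block:
  assumes \<epsilon>: "idem \<epsilon>" "\<epsilon> \<noteq> Z" "\<phi> \<epsilon> = \<epsilon>"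
  obtains E k where "idem E" "\<phi> E = E" "E \<circ> \<epsilon> = E" "E \<noteq> Z" "card (range E) = q ^ (s * k)"
proof -
  obtain e where e: "minimal e" "e \<circ> \<epsilon> = e" using exists_minimal[OF \<epsilon>(1,2)] .
  have eR: "e \<in> R" "e \<circ> e = e" "e \<noteq> Z" using e by (auto simp: minimal_def)
  show ?thesis
  proof (cases "\<phi> e = e")
    case True
    then show ?thesis using that[of e] card_minimal_fixed[OF e(1)] e eR by blast
  next
    case False
    define f where "f i = (\<phi> ^^ i) e" for i
    have fmin: "minimal (f i)" for i unfolding f_def by (induction i) (auto simp: e minimal_\<phi>)
    have fR: "f i \<in> R" "f i \<circ> f i = f i" "f i \<noteq> Z" for i using fmin[of i] by (auto simp: minimal_def)
    have f\<epsilon>: "f i \<circ> \<epsilon> = f i" for i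
    proof (induction i)
      case (Suc i)
      have "f (Suc i) = \<phi> (f i)" by (simp add: f_def)
      then show ?case using \<phi>_comp[OF fR(1)[of i], of \<epsilon>] \<epsilon> Suc by metis
    qed (simp add: f_def e)
    have inj_pow: "g = h" if "(\<phi> ^^ k) g = (\<phi> ^^ k) h" "g \<in> R" "h \<in> R" for g h k
      using that(1)
    proof (induction k)
      case (Suc k)
      have "\<phi> ((\<phi> ^^ k) g) = \<phi> ((\<phi> ^^ k) h)" using Suc.prems by simp
      then show ?case using Suc.IH \<phi>_inj[OF \<phi>_pow_R[OF that(2)] \<phi>_pow_R[OF that(3)]] by blast
    qed simp
    \<comment> \<open>A repetition gives \<open>e\<close> a period smaller than \<open>s\<close>,
      hence coprime to \<open>s\<close>, and \<open>e\<close> would be fixed.\<close>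
    have inj: "f i \<noteq> f j" if ij: "i < j" "j < s" for i j
    proof
      assume eq: "f i = f j"
      have "f j = (\<phi> ^^ (i + (j - i))) e" using ij by (simp add: f_def)
      also have "\<dots> = (\<phi> ^^ i) (f (j - i))" unfolding funpow_add by (simp add: f_def)
      finally have "(\<phi> ^^ i) e = (\<phi> ^^ i) (f (j - i))" using eq by (simp add: f_def)
      then have "e = f (j - i)" using inj_pow eR(1) fR(1) by blast
      then have "(\<phi> ^^ (j - i)) e = e" by (simp add: f_def)
      moreover have "\<not> s dvd j - i" using ij by (auto dest: dvd_imp_le)
      then have "coprime (j - i) s" using prime_imp_coprime[OF s(1)] coprime_commute by blast
      ultimately have "\<phi> e = e"
        using fixed_funpow_coprime[where f = \<phi> and x = e] \<phi>_s[OF eR(1)] ij by auto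
      then show False using False by simp
    qed
    have orth: "f i \<circ> f j = Z" if "i \<noteq> j" "i < s" "j < s" for i j
      using minimal_orthogonal[OF fmin fmin] inj that by (metis linorder_neqE_nat)
    define E where "E m = (\<lambda>v. \<Sum>i<m. f i v)" for m
    have ER: "E m \<in> R" for m unfolding E_def using fR by (intro sum_R) auto
    have Ef: "E m \<circ> f j = (if j < m then f j else Z)" if "m \<le> s" "j < s" for m j
    proof
      fix v
      have "(E m \<circ> f j) v = (\<Sum>i<m. if i = j then f j v else 0)"
        unfolding E_def comp_apply
      proof (intro sum.cong refl)
        fix i assume "i \<in> {..<m}"
        then show "f i (f j v) = (if i = j then f j v else 0)"
          using orth[of i j] fR(2)[of j] that by (auto simp: fun_eq_iff Z_def)
      qed
      then show "(E m \<circ> f j) v = (if j < m then f j else Z) v" by (simp add: Z_def)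
    qed
    have Eidem: "E m \<circ> E m = E m" if "m \<le> s" for m
    proof
      fix v
      have "(E m \<circ> E m) v = (\<Sum>j<m. (E m \<circ> f j) v)"
        using linear_op_sum[OF lin[OF ER[of m]]] by (simp add: E_def[of m])
      also have "\<dots> = E m v"
        unfolding E_def[of m, abs_def] using Ef[OF that] that
        by (intro sum.cong) (auto simp: E_def[of m, symmetric])
      finally show "(E m \<circ> E m) v = E m v" .
    qed
    have cardf: "card (range (f i)) = card (range e)" for i
      unfolding f_def by (induction i) (simp_all add: card_range_\<phi> \<phi>_pow_R eR)
    have cardE: "card (range (E m)) = card (range e) ^ m" if "m \<le> s" for m
      using that
    proof (induction m)
      case 0
      then show ?case by (simp add: E_def)
    next
      case (Suc m)
      have "E (Suc m) = (\<lambda>v. E m v + f m v)" by (simp add: E_def)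
      moreover have "card (range (\<lambda>v. E m v + f m v)) = card (range (E m)) * card (range (f m))"
        using Suc.prems Ef[of m m] fR ER Eidem by (intro card_range_add) auto
      ultimately show ?case using Suc by (simp add: cardf)
    qed
    obtain k where k: "card (range e) = q ^ k"
      using card_subspace[OF subspace_range_linear_op[OF lin[OF eR(1)]]] q by blast
    have s0: "s > 0" using s(1) prime_gt_0_nat by blast
    show ?thesis
    proof (rule that[of "E s" k])
      show "idem (E s)" using ER Eidem by blast
      have "\<phi> (E m) = (\<lambda>v. \<Sum>i<m. f (Suc i) v)" for m
      proof (induction m)
        case 0
        then show ?case using \<phi>_zero by (simp add: E_def Z_def)
      next
        case (Suc m)
        have "\<phi> (E (Suc m)) = \<phi> (\<lambda>v. E m v + f m v)" by (simp add: E_def)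
        also have "\<dots> = (\<lambda>v. \<phi> (E m) v + \<phi> (f m) v)" by (rule \<phi>_add)
        finally show ?case using Suc by (simp add: f_def)
      qed
      \<comment> \<open>The shift is cyclic because \<open>f s = f 0\<close>.\<close>
      also have "(\<lambda>v. \<Sum>i<s. f (Suc i) v) = E s"
      proof
        fix v
        have "(\<Sum>i<s. f (Suc i) v) + f 0 v = (\<Sum>i<Suc s. f i v)"
          by (simp add: sum.lessThan_Suc_shift add.commute del: sum.lessThan_Suc)
        also have "\<dots> = E s v + f s v" by (simp add: E_def)
        also have "f s v = f 0 v" using \<phi>_s[OF eR(1)] by (simp add: f_def)
        finally show "(\<Sum>i<s. f (Suc i) v) = E s v" by simp
      qed
      finally show "\<phi> (E s) = E s" .
      show "E s \<circ> \<epsilon> = E s" using f\<epsilon> by (auto simp: E_def fun_eq_iff)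
      show "E s \<noteq> Z"
      proof
        assume "E s = Z"
        then have "Z \<circ> f 0 = f 0" using Ef[of s 0] s0 by simp
        then show False using fR(3)[of 0] by (auto simp: Z_def comp_def)
      qed
      show "card (range (E s)) = q ^ (s * k)"
        using cardE[of s] k by (simp add: power_mult[symmetric] mult.commute)
    qed
  qed
qed

text \<open>An invariant block \<open>E\<close> is split off and the induction continues with the
  complementary idempotent \<open>\<epsilon> - E\<close>, which is again invariant and has a smaller
  image.\<close>

lemma card_range_invariant_idem:
  assumes "idem \<epsilon>" "\<phi> \<epsilon> = \<epsilon>"
  shows "\<exists>k. card (range \<epsilon>) = q ^ (s * k)"
  using assms
proof (induction "card (range \<epsilon>)" arbitrary: \<epsilon> rule: less_induct)
  case less
  show ?case
  proof (cases "\<epsilon> = Z")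
    case True
    then show ?thesis by (auto simp: Z_def intro: exI[of _ 0])
  next
    case False
    obtain E k where E: "idem E" "\<phi> E = E" "E \<circ> \<epsilon> = E" "E \<noteq> Z" "card (range E) = q ^ (s * k)"
      using invariant_block[OF less.prems(1) False less.prems(2)] .
    have \<epsilon>E: "\<epsilon> \<circ> E = E" using E comm less.prems by metis
    define D where "D = (\<lambda>v. \<epsilon> v - E v)"
    have DR: "D \<in> R" using E less.prems diff by (simp add: D_def)
    have app: "\<epsilon> (\<epsilon> v) = \<epsilon> v" "E (E v) = E v" "\<epsilon> (E v) = E v" "E (\<epsilon> v) = E v" for v
      using E less.prems \<epsilon>E by (metis comp_apply)+
    have la: "\<epsilon> (v - w) = \<epsilon> v - \<epsilon> w" "E (v - w) = E v - E w" for v w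
      using E less.prems lin linear_op_diff by blast+
    have Did: "D \<circ> D = D" by (auto simp: D_def app la)
    have ED: "E \<circ> D = Z" by (auto simp: D_def app la Z_def)
    have "\<phi> D = D" using \<phi>_diff E less.prems by (simp add: D_def)
    have sum: "(\<lambda>v. E v + D v) = \<epsilon>" by (simp add: D_def)
    have c: "card (range \<epsilon>) = card (range E) * card (range D)"
      using card_range_add[OF E(1) conjI[OF DR Did] ED] unfolding sum .
    have E2: "card (range E) > 1"
    proof (rule ccontr)
      assume "\<not> ?thesis"
      moreover have "card (range E) > 0" by (simp add: card_gt_0_iff)
      ultimately obtain y where "range E = {y}" by (metis One_nat_def card_1_singletonE less_one linorder_neqE_nat not_less_eq gr0_conv_Suc)
      moreover have "E 0 = 0" using linear_op_zero lin E by blast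
      ultimately have "E v = 0" for v by (metis rangeI singletonD)
      then show False using E(4) by (auto simp: Z_def)
    qed
    moreover have "card (range D) > 0" by (simp add: card_gt_0_iff)
    ultimately have "card (range D) < card (range \<epsilon>)" using c by simp
    then obtain j where "card (range D) = q ^ (s * j)"
      using less.hyps[OF _ conjI[OF DR Did] \<open>\<phi> D = D\<close>] by blast
    then have "card (range \<epsilon>) = q ^ (s * (k + j))" using c E by (simp add: power_add distrib_left)
    then show ?thesis by blast
  qed
qed

lemma prime_dvd_dim:
  assumes "card (range \<pi>) = q ^ n"
  shows "s dvd n"
proof -
  have "\<phi> \<pi> = \<pi>" using x(3,4) by (metis \<phi>_def comp_assoc one)
  then obtain k where "card (range \<pi>) = q ^ (s * k)"
    using card_range_invariant_idem[of \<pi>] one by blast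
  then have "n = s * k" using assms q_ge_2 power_inject_exp[of q n "s * k"] by simp
  then show ?thesis by simp
qed

end

text \<open>The group has the projection \<open>\<pi>\<close> as its unit, because its elements are
  maps of the whole space acting on the image of \<open>\<pi>\<close>. Freeness together with the
  two cardinalities makes the action on nonzero vectors of that image sharply transitive.\<close>

theorem free_linear_group_comm:
  fixes G :: "('a::{field,finite} ^ 'd \<Rightarrow> 'a ^ 'd) set" and \<pi> :: "'a ^ 'd \<Rightarrow> 'a ^ 'd"
  assumes q: "CARD('a) = q" "primepow q" and n: "n > 0"
    and grp: "group \<lparr>carrier = G, monoid.mult = (\<circ>), one = \<pi>\<rparr>"
    and lin: "\<And>g. g \<in> G \<Longrightarrow> linear_op g"
    and free: "\<And>g h v. g \<in> G \<Longrightarrow> h \<in> G \<Longrightarrow> v \<noteq> 0 \<Longrightarrow> \<pi> v = v \<Longrightarrow> g v = h v \<Longrightarrow> g = h"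
    and card: "card G = q ^ n - 1" "card (range \<pi>) = q ^ n"
    and coprime: "\<And>s. prime s \<Longrightarrow> s dvd n \<Longrightarrow> \<not> s dvd q ^ n - 1"
    and gh: "g \<in> G" "h \<in> G"
  shows "g \<circ> h = h \<circ> g"
proof (rule ccontr)
  assume ncomm: "g \<circ> h \<noteq> h \<circ> g"
  define \<G> where "\<G> = \<lparr>carrier = G, monoid.mult = (\<circ>), one = \<pi>\<rparr>"
  interpret group \<G> unfolding \<G>_def by (rule grp)
  have \<G>: "carrier \<G> = G" "a \<otimes>\<^bsub>\<G>\<^esub> b = a \<circ> b" "\<one>\<^bsub>\<G>\<^esub> = \<pi>" for a b
    by (simp_all add: \<G>_def)
  \<comment> \<open>Composition with \<open>\<pi>\<close> only matters for \<open>k = 0\<close>,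
    where the group power is \<open>\<pi>\<close> and the iterate is the identity map.\<close>
  have pow\<G>: "a [^]\<^bsub>\<G>\<^esub> (k::nat) = (a ^^ k) \<circ> \<pi>" if "a \<in> G" for a k
  proof (induction k)
    case (Suc k)
    have "a [^]\<^bsub>\<G>\<^esub> Suc k = (a ^^ k) \<circ> (\<pi> \<circ> a)" by (simp add: Suc \<G> fun_eq_iff)
    also have "\<pi> \<circ> a = a \<circ> \<pi>" using l_one[of a] r_one[of a] that \<G> by simp
    finally show ?case by (metis comp_assoc funpow_Suc_right)
  qed (simp add: \<G>)
  have pow_pos: "a [^]\<^bsub>\<G>\<^esub> (k::nat) = a ^^ k" if "a \<in> G" "k > 0" for a k
  proof -
    have "a \<circ> \<pi> = a" using r_one[of a] that \<G> by simp
    then have "(a ^^ k) \<circ> \<pi> = a ^^ k" using that(2)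
      by (cases k) (simp_all add: comp_assoc funpow_Suc_right del: funpow.simps)
    then show ?thesis using pow\<G>[OF that(1), of k] by simp
  qed
  obtain A y where A: "subgroup A \<G>" "\<And>a b. a \<in> A \<Longrightarrow> b \<in> A \<Longrightarrow> a \<circ> b = b \<circ> a"
    and y: "y \<in> G" "\<And>a. a \<in> A \<Longrightarrow> y \<circ> a \<circ> inv\<^bsub>\<G>\<^esub> y \<in> A" "\<exists>a\<in>A. y \<circ> a \<noteq> a \<circ> y"
    using exists_noncentral_normalizer[of g h] gh ncomm unfolding \<G> by auto
  interpret A: subgroup A \<G> by (rule A(1))
  have AG: "a \<in> G" if "a \<in> A" for a using that A.subset \<G> by auto
  define cen where "cen k \<longleftrightarrow> (\<forall>a\<in>A. (y [^]\<^bsub>\<G>\<^esub> (k::nat)) \<circ> a = a \<circ> (y [^]\<^bsub>\<G>\<^esub> k))" for k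
  have cen_mult: "cen (k * m)" if "cen k" for k m
  proof (induction m)
    case 0
    then show ?case using AG l_one r_one by (auto simp: cen_def \<G>)
  next
    case (Suc m)
    have "y [^]\<^bsub>\<G>\<^esub> (k * Suc m) = y [^]\<^bsub>\<G>\<^esub> k \<circ> y [^]\<^bsub>\<G>\<^esub> (k * m)"
      using nat_pow_mult[of y k "k * m"] y \<G> by simp
    moreover have "(g \<circ> h) \<circ> a = a \<circ> (g \<circ> h)" if "g \<circ> a = a \<circ> g" "h \<circ> a = a \<circ> h"
      for g h a :: "'a ^ 'd \<Rightarrow> 'a ^ 'd"
      using that by (metis comp_assoc)
    ultimately show ?case using Suc that unfolding cen_def by auto
  qed
  let ?N = "q ^ n - 1"
  have "cen ?N"
  proof -
    have "y [^]\<^bsub>\<G>\<^esub> Coset.order \<G> = \<one>\<^bsub>\<G>\<^esub>" using pow_order_eq_1 y \<G> by simp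
    then have "y [^]\<^bsub>\<G>\<^esub> ?N = \<pi>" using card(1) by (simp add: Coset.order_def \<G>)
    then show ?thesis using AG l_one r_one by (auto simp: cen_def \<G>)
  qed
  \<comment> \<open>With \<open>t\<close> least and \<open>s\<close> a prime factor of
    \<open>t\<close>, the element \<open>y\<close> to the power \<open>t div s\<close> does not
    centralize \<open>A\<close> while its \<open>s\<close>-th power does. This is the
    \<open>x\<close> inducing an automorphism of prime order.\<close>
  then obtain t where t: "t dvd ?N" "cen t" and tmin: "\<And>m. m dvd ?N \<Longrightarrow> cen m \<Longrightarrow> t \<le> m"
    using ex_has_least_nat[of "\<lambda>m. m dvd ?N \<and> cen m" ?N id] by auto
  have "q \<ge> 2" using q(2) primepow_gt_Suc_0[of q] by simp
  then have "?N > 0" using one_less_power[of q n] n by simp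
  then have t0: "t > 0" using t(1) by (auto intro: Nat.gr0I)
  have "y [^]\<^bsub>\<G>\<^esub> (1::nat) = y" using y l_one[of y] \<G> by simp
  then have "\<not> cen 1" using y(3) by (auto simp: cen_def)
  then obtain s where sp: "prime s" "s dvd t" using t(2) prime_factor_nat by metis
  then obtain k where k: "t = k * s" by (metis dvdE mult.commute)
  have k0: "k > 0" "k < t" using k t0 prime_gt_1_nat[OF sp(1)] by auto
  have "k dvd ?N" using t(1) k by (metis dvd_mult_left)
  then have "\<not> cen k" using tmin k0 by fastforce
  define x where "x = y [^]\<^bsub>\<G>\<^esub> k"
  define x' where "x' = inv\<^bsub>\<G>\<^esub> x"
  have xG: "x \<in> carrier \<G>" "x' \<in> carrier \<G>" using y \<G> by (auto simp: x_def x'_def)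
  obtain a where a: "a \<in> A" "x \<circ> a \<noteq> a \<circ> x" using \<open>\<not> cen k\<close> by (auto simp: cen_def x_def)
  have xA: "x \<circ> b \<circ> x' \<in> A" if b: "b \<in> A" for b
    unfolding x_def x'_def
  proof (induction k)
    case 0
    then show ?case using b AG[OF b] r_one[of b] l_one[of b] by (simp add: \<G>[symmetric])
  next
    case (Suc k)
    have yc: "y \<in> carrier \<G>" using y \<G> by simp
    let ?p = "y [^]\<^bsub>\<G>\<^esub> k"
    have bc: "b \<in> carrier \<G>" using AG[OF b] \<G> by simp
    have "y [^]\<^bsub>\<G>\<^esub> Suc k \<otimes>\<^bsub>\<G>\<^esub> b \<otimes>\<^bsub>\<G>\<^esub> inv\<^bsub>\<G>\<^esub> (y [^]\<^bsub>\<G>\<^esub> Suc k) =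
        y \<otimes>\<^bsub>\<G>\<^esub> (?p \<otimes>\<^bsub>\<G>\<^esub> b \<otimes>\<^bsub>\<G>\<^esub> inv\<^bsub>\<G>\<^esub> ?p) \<otimes>\<^bsub>\<G>\<^esub> inv\<^bsub>\<G>\<^esub> y"
      using yc bc nat_pow_Suc2[OF yc, of k] by (simp add: inv_mult_group m_assoc del: nat_pow_Suc)
    then show ?case using y(2)[OF Suc.IH] by (simp only: \<G>)
  qed
  have linA: "linear_op b" if "b \<in> A" for b using that AG lin by blast
  have compA: "b \<circ> c \<in> A" if "b \<in> A" "c \<in> A" for b c using A.m_closed[OF that] \<G> by simp
  have \<pi>A: "\<pi> \<in> A" using A.one_closed \<G> by simp
  have linx: "linear_op x" "linear_op x'" using xG lin \<G> by auto
  have \<pi>f: "\<pi> \<circ> f = f" if "f \<in> op_span A" for f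
    using that
  proof induction
    case (base b)
    then show ?case using l_one[of b] AG[OF base] \<G> by simp
  next
    case (add f g)
    then show ?case using linear_op_add[OF linA[OF \<pi>A]] by (simp add: fun_eq_iff)
  next
    case (scale f c)
    then show ?case using linear_op_scale[OF linA[OF \<pi>A]] by (simp add: fun_eq_iff)
  qed
  have f\<pi>: "f \<circ> \<pi> = f" if "f \<in> op_span A" for f
    using \<pi>f[OF that] op_span_commute[OF linA A(2) that op_span.base[OF \<pi>A]] by simp
  interpret op_algebra "op_span A" \<pi> x x' q n s
  proof
    fix f g c
    assume f: "f \<in> op_span A"
    show "linear_op f" using linear_op_span[OF linA f] .
    show "(\<lambda>v. c *s f v) \<in> op_span A" by (rule op_span.scale[OF f])
    show "\<pi> \<circ> f = f" by (rule \<pi>f[OF f])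
    \<comment> \<open>Lagrange on \<open>A\<close>, additivity of the power map on sums, and
      \<open>c ^ (q ^ n) = c\<close> on scalar multiples.\<close>
    show "f ^^ (q ^ n) = f"
      using f
    proof induction
      case (base b)
      have bG: "b \<in> G" using AG[OF base] .
      have "b [^]\<^bsub>\<G>\<^esub> Coset.order \<G> = \<one>\<^bsub>\<G>\<^esub>" using pow_order_eq_1[of b] bG \<G> by simp
      then have "b [^]\<^bsub>\<G>\<^esub> Suc ?N = b"
        using card(1) bG l_one[of b] by (simp add: Coset.order_def \<G>)
      moreover have "Suc ?N = q ^ n" using \<open>?N > 0\<close> by simp
      ultimately show ?case using pow_pos[OF bG, of "q ^ n"] by (metis zero_less_Suc)
    next
      case (add f g)
      then show ?case
        using funpow_card_power_add[OF linear_op_span[OF linA add(1)] linear_op_span[OF linA add(2)]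
            op_span_commute[OF linA A(2) add(1,2)] q, of n] by simp
    next
      case (scale f c)
      have "c ^ (q ^ m) = c" for m
        by (induction m) (simp_all add: power_mult mult.commute field_power_card[of c, unfolded q(1)])
      then show ?case
        using funpow_scale_linear_op[OF linear_op_span[OF linA scale(1)], where c = c and m = "q ^ n"] scale
        by simp
    qed
    show "x \<circ> f \<circ> x' \<in> op_span A"
      using f
    proof induction
      case (base b)
      then show ?case by (intro op_span.base xA)
    next
      case (add f g)
      have eq: "x \<circ> (\<lambda>v. f v + g v) \<circ> x' = (\<lambda>v. (x \<circ> f \<circ> x') v + (x \<circ> g \<circ> x') v)"
        using linear_op_add[OF linx(1)] by (simp add: fun_eq_iff)
      show ?case unfolding eq by (rule op_span.add[OF add.IH])
    next
      case (scale f c)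
      have eq: "x \<circ> (\<lambda>v. c *s f v) \<circ> x' = (\<lambda>v. c *s (x \<circ> f \<circ> x') v)"
        using linear_op_scale[OF linx(1)] by (simp add: fun_eq_iff)
      show ?case unfolding eq by (rule op_span.scale[OF scale.IH])
    qed
    \<comment> \<open>The iterate is conjugation by \<open>x ^^ s\<close>, the \<open>t\<close>-th
      power of \<open>y\<close>, which centralizes \<open>A\<close> and so its span.\<close>
    show "((\<lambda>f. x \<circ> f \<circ> x') ^^ s) f = f"
    proof -
      have conj_pow: "((\<lambda>f. x \<circ> f \<circ> x') ^^ m) f = x ^^ m \<circ> f \<circ> x' ^^ m" for m
        by (induction m) (simp_all add: fun_eq_iff funpow_swap1)
      have s0: "s > 0" using sp(1) prime_gt_0_nat by blast
      have xs: "x ^^ s = y [^]\<^bsub>\<G>\<^esub> t"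
        using pow_pos[of x s] xG s0 \<G> y k by (simp add: x_def nat_pow_pow)
      have "x [^]\<^bsub>\<G>\<^esub> s \<otimes>\<^bsub>\<G>\<^esub> x' [^]\<^bsub>\<G>\<^esub> s = \<one>\<^bsub>\<G>\<^esub>"
        using xG by (simp add: x'_def nat_pow_inv)
      then have inv: "x ^^ s \<circ> x' ^^ s = \<pi>"
        using pow_pos[of x s] pow_pos[of x' s] xG s0 \<G> by simp
      have "f \<circ> x ^^ s = x ^^ s \<circ> f"
      proof (rule op_span_commute_one[OF linear_op_funpow[OF linx(1)] _ f])
        show "b \<circ> x ^^ s = x ^^ s \<circ> b" if "b \<in> A" for b
          by (rule sym, use t(2) that in \<open>unfold cen_def xs, blast\<close>)
      qed
      then have "x ^^ s \<circ> f \<circ> x' ^^ s = f \<circ> (x ^^ s \<circ> x' ^^ s)" by (metis comp_assoc)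
      then show ?thesis using conj_pow inv f\<pi>[OF f] by simp
    qed
    assume g: "g \<in> op_span A"
    show "(\<lambda>v. f v + g v) \<in> op_span A" by (rule op_span.add[OF f g])
    show "f \<circ> g \<in> op_span A" by (rule op_span_comp[OF linA compA f g])
    show "f \<circ> g = g \<circ> f" by (rule op_span_commute[OF linA A(2) f g])
  next
    show "\<pi> \<in> op_span A" by (rule op_span.base[OF \<pi>A])
    show "x \<circ> x' = \<pi>" "x' \<circ> x = \<pi>" using r_inv[OF xG(1)] l_inv[OF xG(1)] \<G> by (auto simp: x'_def)
    \<comment> \<open>Both sides are values of group elements, so agreement at one nonzero vector
      would by freeness mean that \<open>x\<close> commutes with \<open>a\<close>.\<close>
    have "x (a (x' v)) \<noteq> a v" if v: "v \<noteq> 0" "\<pi> v = v" for v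
    proof
      assume "x (a (x' v)) = a v"
      then have "(x \<circ> a \<circ> x') v = a v" by simp
      then have eq: "x \<circ> a \<circ> x' = a" by (rule free[OF AG[OF xA[OF a(1)]] AG[OF a(1)] v])
      have "x \<circ> a = x \<circ> (a \<circ> \<pi>)" using f\<pi>[OF op_span.base[OF a(1)]] by simp
      also have "\<pi> = x' \<circ> x" using l_inv[OF xG(1)] \<G> by (simp add: x'_def)
      also have "x \<circ> (a \<circ> (x' \<circ> x)) = x \<circ> a \<circ> x' \<circ> x" by (simp only: comp_assoc)
      finally show False using a(2) unfolding eq by (rule notE[rotated])
    qed
    then show "\<exists>a\<in>op_span A. \<forall>v. v \<noteq> 0 \<longrightarrow> \<pi> v = v \<longrightarrow> x (a (x' v)) \<noteq> a v"
      using op_span.base[OF a(1)] by blast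
  qed (use q n sp(1) linx in simp_all)
  have "s dvd n" by (rule prime_dvd_dim[OF card(2)])
  moreover have "s dvd ?N" using sp(2) t(1) by (rule dvd_trans)
  ultimately show False using coprime[OF sp(1)] by blast
qed

section \<open>Spreads with a frame of normal elements\<close>

lemma vsubspaces_1_iff:
  "P \<in> vsubspaces 1 \<longleftrightarrow> (\<exists>v. v \<noteq> 0 \<and> P = vec.span {v :: 'a::field ^ 'd})"
proof
  assume "P \<in> vsubspaces 1"
  then have P: "vec.subspace P" "vec.dim P = 1" by (auto simp: vsubspaces_def)
  obtain B where B: "B \<subseteq> P" "vec.independent B" "P \<subseteq> vec.span B" "card B = vec.dim P"
    using vec.basis_exists[of P] by blast
  then obtain v where v: "B = {v}" using P by (metis card_1_singletonE)
  then have "v \<noteq> 0" using B(2) vec.dependent_zero by blast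
  moreover have "P = vec.span {v}" using B P v by (metis vec.span_subspace)
  ultimately show "\<exists>v. v \<noteq> 0 \<and> P = vec.span {v}" by blast
next
  assume "\<exists>v. v \<noteq> 0 \<and> P = vec.span {v}"
  then obtain v where v: "v \<noteq> 0" "P = vec.span {v}" by blast
  then have "vec.independent {v}" by simp
  then have "vec.dim (vec.span {v}) = 1" using vec.dim_span_eq_card_independent by fastforce
  then show "P \<in> vsubspaces 1" using v by (simp add: vsubspaces_def)
qed

lemma partitions_points_iff:
  fixes U :: "('a::field ^ 'd) set"
  assumes U: "vec.subspace U" and T: "\<And>E. E \<in> T \<Longrightarrow> vec.subspace E"
    and part: "partitions_points U T"
  shows "E \<in> T \<Longrightarrow> E \<subseteq> U"
    and "v \<in> U \<Longrightarrow> v \<noteq> 0 \<Longrightarrow> \<exists>E\<in>T. v \<in> E"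
    and "E \<in> T \<Longrightarrow> F \<in> T \<Longrightarrow> v \<in> E \<Longrightarrow> v \<in> F \<Longrightarrow> v \<noteq> 0 \<Longrightarrow> E = F"
proof -
  have pg: "vec.span {v} \<in> pg_points E \<longleftrightarrow> v \<in> E" if "vec.subspace E" "v \<noteq> 0" for E and v :: "'a ^ 'd"
  proof
    assume "vec.span {v} \<in> pg_points E"
    then show "v \<in> E" using vec.span_base[of v "{v}"] by (auto simp: pg_points_def)
  next
    assume "v \<in> E"
    then have "vec.span {v} \<subseteq> E" using that vec.span_minimal by blast
    then show "vec.span {v} \<in> pg_points E"
      using that vsubspaces_1_iff by (auto simp: pg_points_def)
  qed
  have un: "\<Union> (pg_points ` T) = pg_points U" and dis: "disjoint (pg_points ` T)"
    using part by (auto simp: partitions_points_def partition_on_def)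
  show sub: "E \<subseteq> U" if E: "E \<in> T" for E
  proof
    fix v assume v: "v \<in> E"
    show "v \<in> U"
    proof (cases "v = 0")
      case True
      then show ?thesis using U by (simp add: vec.subspace_0)
    next
      case False
      then have "vec.span {v} \<in> pg_points U" using un pg[OF T[OF E]] E v by blast
      then show ?thesis using pg[OF U False] by blast
    qed
  qed
  show "\<exists>E\<in>T. v \<in> E" if v: "v \<in> U" "v \<noteq> 0" for v
  proof -
    have "vec.span {v} \<in> \<Union> (pg_points ` T)" using v pg[OF U v(2)] un by blast
    then show ?thesis using pg[OF T v(2)] by blast
  qed
  show "E = F" if EF: "E \<in> T" "F \<in> T" "v \<in> E" "v \<in> F" "v \<noteq> 0" for E F v
  proof -
    have "vec.span {v} \<in> pg_points E \<inter> pg_points F" using EF pg T by blast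
    then have eq: "pg_points E = pg_points F"
      using dis EF(1,2) unfolding disjoint_def by blast
    have "w \<in> E \<longleftrightarrow> w \<in> F" for w
      using eq pg[OF T[OF EF(1)], of w] pg[OF T[OF EF(2)], of w] T[OF EF(1)] T[OF EF(2)]
      by (cases "w = 0") (auto simp: vec.subspace_0)
    then show ?thesis by blast
  qed
qed

text \<open>\<open>normal\<close> expresses that the sum of \<open>E i\<close> and \<open>F\<close>
  is a union of spread elements: a spread element meeting it outside \<open>0\<close> is contained
  in it. \<open>spanning\<close> is what general position gives for exactly \<open>r\<close>
  elements.\<close>

locale normal_frame =
  fixes S :: "('a::{field,finite} ^ 'd) set set" and E :: "nat \<Rightarrow> ('a ^ 'd) set" and q n r :: nat
  assumes q: "CARD('a) = q" "primepow q" and n: "n > 0" and r: "r > 2"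
    and dim: "CARD('d) = r * n"
    and sub: "F \<in> S \<Longrightarrow> vec.subspace F" and cardS: "F \<in> S \<Longrightarrow> card F = q ^ n"
    and cover: "v \<noteq> 0 \<Longrightarrow> \<exists>F\<in>S. v \<in> F"
    and uniq: "F \<in> S \<Longrightarrow> F' \<in> S \<Longrightarrow> v \<in> F \<Longrightarrow> v \<in> F' \<Longrightarrow> v \<noteq> 0 \<Longrightarrow> F = F'"
    and frame: "i < r \<Longrightarrow> E i \<in> S"
    and normal: "i < r \<Longrightarrow> F \<in> S \<Longrightarrow> F \<noteq> E i \<Longrightarrow> a \<in> E i \<Longrightarrow> b \<in> F \<Longrightarrow> F' \<in> S \<Longrightarrow>
        a + b \<in> F' \<Longrightarrow> a + b \<noteq> 0 \<Longrightarrow> w \<in> F' \<Longrightarrow> \<exists>c\<in>E i. \<exists>d\<in>F. w = c + d"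
    and spanning: "\<exists>x. (\<forall>i<r. x i \<in> E i) \<and> v = (\<Sum>i<r. x i)"
begin

lemma q2: "q \<ge> 2"
  using q(2) primepow_gt_Suc_0[of q] by simp

lemma qn: "q ^ n \<ge> 2"
  using one_less_power[of q n] q2 n by simp

lemma E_closed:
  assumes "i < r"
  shows "0 \<in> E i" "v \<in> E i \<Longrightarrow> w \<in> E i \<Longrightarrow> v + w \<in> E i"
    "v \<in> E i \<Longrightarrow> w \<in> E i \<Longrightarrow> v - w \<in> E i" "v \<in> E i \<Longrightarrow> c *s v \<in> E i"
  using sub[OF frame[OF assms]]
  by (auto simp: vec.subspace_0 vec.subspace_add vec.subspace_diff vec.subspace_scale)

text \<open>Surjectivity is the spanning property, and both sides have \<open>q ^ (r * n)\<close>
  elements, so the sum of the frame elements is direct.\<close>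

lemma components_bij:
  "bij_betw (\<lambda>x. \<Sum>i<r. x i) (PiE {..<r} E) UNIV"
proof -
  have "(\<lambda>x. \<Sum>i<r. x i) ` PiE {..<r} E = UNIV"
  proof (intro equalityI subsetI)
    fix v :: "'a ^ 'd"
    obtain x where x: "\<And>i. i < r \<Longrightarrow> x i \<in> E i" "v = (\<Sum>i<r. x i)" using spanning by blast
    have "restrict x {..<r} \<in> PiE {..<r} E" using x by auto
    moreover have "v = (\<Sum>i<r. restrict x {..<r} i)" using x by simp
    ultimately show "v \<in> (\<lambda>x. \<Sum>i<r. x i) ` PiE {..<r} E" by blast
  qed simp
  moreover have "card (PiE {..<r} E) = card (UNIV :: ('a ^ 'd) set)"
  proof -
    have "card (PiE {..<r} E) = (\<Prod>i<r. q ^ n)"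
      using cardS frame by (subst card_PiE) auto
    also have "\<dots> = q ^ CARD('d)" by (simp add: dim power_mult[symmetric] mult.commute)
    also have "\<dots> = card (UNIV :: ('a ^ 'd) set)"
      using card_subspace[of "UNIV :: ('a ^ 'd) set"] q by (simp add: vec_dim_card)
    finally show ?thesis .
  qed
  ultimately show ?thesis
    by (metis bij_betw_def eq_card_imp_inj_on finite finite_PiE finite_lessThan)
qed

definition comps :: "'a ^ 'd \<Rightarrow> nat \<Rightarrow> 'a ^ 'd" where
  "comps = inv_into (PiE {..<r} E) (\<lambda>x. \<Sum>i<r. x i)"

text \<open>The value \<open>0\<close> for \<open>i \<ge> r\<close> makes \<open>P i\<close> linear
  for every index.\<close>

definition P :: "nat \<Rightarrow> 'a ^ 'd \<Rightarrow> 'a ^ 'd" where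
  "P i v = (if i < r then comps v i else 0)"

lemma P_mem: "i < r \<Longrightarrow> P i v \<in> E i"
  using bij_betwE[OF bij_betw_inv_into[OF components_bij]]
  by (auto simp: P_def comps_def PiE_iff)

lemma sum_P: "(\<Sum>i<r. P i v) = v"
proof -
  have "(\<Sum>i<r. comps v i) = v"
    using bij_betw_inv_into_right[OF components_bij, of v] by (simp add: comps_def)
  then show ?thesis by (simp add: P_def)
qed

lemma P_unique:
  assumes "\<And>i. i < r \<Longrightarrow> x i \<in> E i" "v = (\<Sum>i<r. x i)" "j < r"
  shows "P j v = x j"
proof -
  let ?x = "restrict x {..<r}"
  have "?x \<in> PiE {..<r} E" using assms by auto
  then have "comps (\<Sum>i<r. ?x i) = ?x"
    unfolding comps_def using bij_betw_inv_into_left[OF components_bij] by blast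
  then show ?thesis using assms by (simp add: P_def)
qed

lemma linear_P: "linear_op (P i)"
proof (cases "i < r")
  case True
  have "P i (v + w) = P i v + P i w" for v w
    by (rule P_unique) (auto simp: True P_mem E_closed sum.distrib sum_P)
  moreover have "P i (c *s v) = c *s P i v" for c v
    by (rule P_unique)
      (auto simp: True P_mem E_closed vec.scale_sum_right[symmetric] sum_P)
  ultimately show ?thesis by (simp add: linear_op_def)
qed (simp add: P_def linear_op_def)

lemmas P_add = linear_op_add[OF linear_P] and P_scale = linear_op_scale[OF linear_P]
  and P_diff = linear_op_diff[OF linear_P] and P_0 = linear_op_zero[OF linear_P]
  and P_sum = linear_op_sum[OF linear_P]

lemma P_E:
  assumes "v \<in> E j" "j < r"
  shows "P i v = (if i = j then v else 0)"
proof (cases "i < r")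
  case True
  show ?thesis
    by (rule P_unique[where x = "\<lambda>i. if i = j then v else 0"]) (use assms True in \<open>auto simp: E_closed\<close>)
qed (use assms in \<open>simp add: P_def\<close>)

lemma P_P: "j < r \<Longrightarrow> P i (P j v) = (if i = j then P j v else 0)"
  using P_E[OF P_mem] by blast

lemma eq_iff_P: "v = w \<longleftrightarrow> (\<forall>i<r. P i v = P i w)"
  using sum_P[of v] sum_P[of w] by (metis (no_types, lifting) lessThan_iff sum.cong)

lemma eq_0_iff_P: "v = 0 \<longleftrightarrow> (\<forall>i<r. P i v = 0)"
  using eq_iff_P[of v 0] by (simp add: P_0)

section \<open>Projections of spread elements along the frame\<close>

definition Sp :: "'a ^ 'd \<Rightarrow> ('a ^ 'd) set" where
  "Sp v = (THE F. F \<in> S \<and> v \<in> F)"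

lemma Sp:
  assumes "v \<noteq> 0"
  shows "Sp v \<in> S" "v \<in> Sp v"
proof -
  have "\<exists>!F. F \<in> S \<and> v \<in> F" using cover[OF assms] uniq[OF _ _ _ _ assms] by blast
  from theI'[OF this] show "Sp v \<in> S" "v \<in> Sp v" by (auto simp: Sp_def)
qed

lemma Sp_eq: "F \<in> S \<Longrightarrow> v \<in> F \<Longrightarrow> v \<noteq> 0 \<Longrightarrow> Sp v = F"
  using Sp uniq by blast

lemma Sp_closed:
  assumes "u \<noteq> 0"
  shows "0 \<in> Sp u" "v \<in> Sp u \<Longrightarrow> w \<in> Sp u \<Longrightarrow> v + w \<in> Sp u"
    "v \<in> Sp u \<Longrightarrow> w \<in> Sp u \<Longrightarrow> v - w \<in> Sp u" "v \<in> Sp u \<Longrightarrow> c *s v \<in> Sp u"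
  using sub[OF Sp(1)[OF assms]]
  by (auto simp: vec.subspace_0 vec.subspace_add vec.subspace_diff vec.subspace_scale)

text \<open>Sums of frame elements are unions of spread elements.\<close>

lemma Sp_support:
  assumes "finite J" "v \<noteq> 0" "\<And>i. i < r \<Longrightarrow> i \<notin> J \<Longrightarrow> P i v = 0" "w \<in> Sp v" "i < r" "i \<notin> J"
  shows "P i w = 0"
  using assms
proof (induction J arbitrary: v w i)
  case empty
  then show ?case using eq_0_iff_P by blast
next
  case (insert j J)
  show ?case
  proof (cases "j < r")
    case False
    then show ?thesis using insert.IH[of v w i] insert.prems by (metis insert_iff)
  next
    case True
    \<comment> \<open>As \<open>v\<close> is the sum of \<open>P j v\<close> and \<open>?u\<close>,
      normality of \<open>E j\<close> puts \<open>Sp v\<close> inside the sum of \<open>E j\<close>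
      and \<open>Sp ?u\<close>, and \<open>?u\<close> has the smaller support
      \<open>J\<close>.\<close>
    let ?u = "v - P j v"
    have Pu: "P i ?u = 0" if "i < r" "i \<notin> J" for i
      using that insert.prems(2)[of i] P_P[OF True, of i v] by (cases "i = j") (auto simp: P_diff)
    show ?thesis
    proof (cases "?u = 0")
      case True
      then have "Sp v = E j"
        using P_mem[OF \<open>j < r\<close>, of v] frame[OF \<open>j < r\<close>] insert.prems(1) Sp_eq by auto
      then show ?thesis using insert.prems P_E[of w j i] \<open>j < r\<close> by auto
    next
      case False
      have "Sp ?u \<noteq> E j"
      proof
        assume "Sp ?u = E j"
        then have "P j ?u = ?u" using Sp(2)[OF False] P_E[of ?u j j] True by simp
        then show False using Pu[OF True] insert.hyps False by simp
      qed
      then obtain c d where cd: "c \<in> E j" "d \<in> Sp ?u" "w = c + d"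
        using normal[OF True Sp(1)[OF False] _ P_mem[OF True] Sp(2)[OF False] Sp(1)[OF insert.prems(1)], of v w]
          Sp(2)[OF insert.prems(1)] insert.prems(1,3) by auto
      have "P i d = 0" by (rule insert.IH[OF False Pu cd(2)]) (use insert.prems in auto)
      moreover have "P i c = 0" using P_E[OF cd(1) True, of i] insert.prems by auto
      ultimately show ?thesis using cd by (simp add: P_add)
    qed
  qed
qed

lemma Sp_zero_component:
  assumes "v \<noteq> 0" "P i v = 0" "w \<in> Sp v"
  shows "P i w = 0"
proof (cases "i < r")
  case True
  show ?thesis
    by (rule Sp_support[of "{..<r} - {i}" v w i]) (use assms True in auto)
qed (simp add: P_def)

text \<open>Projecting along \<open>E j\<close> maps spread elements onto spread elements.
  Normality, applied to \<open>v\<close> plus \<open>- P j v\<close>, puts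
  \<open>Sp (v - P j v)\<close> into the sum of \<open>E j\<close> and \<open>Sp v\<close>; since
  its vectors have no \<open>j\<close>-th component, they are projections of vectors of
  \<open>Sp v\<close>, and cardinalities give equality.\<close>

lemma Sp_remove:
  assumes v: "v - P j v \<noteq> 0" and j: "j < r" and w: "w \<in> Sp v"
  shows "w - P j w \<in> Sp (v - P j v)"
proof -
  let ?u = "v - P j v"
  have v0: "v \<noteq> 0" using v by (auto simp: P_0)
  have ne: "Sp v \<noteq> E j"
  proof
    assume "Sp v = E j"
    then have "P j v = v" using Sp(2)[OF v0] P_E[of v j j] j by simp
    then show False using v by simp
  qed
  have "Sp ?u \<subseteq> (\<lambda>w. w - P j w) ` Sp v"
  proof
    fix y assume y: "y \<in> Sp ?u"
    have "- P j v \<in> E j" using E_closed(3)[OF j E_closed(1)[OF j] P_mem[OF j]] by simp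
    then obtain c d where cd: "c \<in> E j" "d \<in> Sp v" "y = c + d"
      using normal[OF j Sp(1)[OF v0] ne _ Sp(2)[OF v0] Sp(1)[OF v], of "- P j v" y] Sp(2)[OF v] v y
      by auto
    have "P j ?u = 0" using P_P[OF j, of j v] by (simp add: P_diff)
    then have "P j y = 0" using Sp_zero_component[OF v _ y] by blast
    then have "y = d - P j d" using cd P_E[OF cd(1) j, of j] by (simp add: P_add algebra_simps eq_neg_iff_add_eq_0)
    then show "y \<in> (\<lambda>w. w - P j w) ` Sp v" using cd by blast
  qed
  moreover have "card ((\<lambda>w. w - P j w) ` Sp v) \<le> card (Sp ?u)"
    using card_image_le[of "Sp v" "\<lambda>w. w - P j w"] cardS Sp v v0 by simp
  ultimately have "Sp ?u = (\<lambda>w. w - P j w) ` Sp v"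
    by (intro card_seteq) auto
  then show ?thesis using w by blast
qed

lemma Sp_restrict:
  assumes "finite J" "J \<subseteq> {..<r}" "(\<Sum>i\<in>{..<r} - J. P i v) \<noteq> 0" "w \<in> Sp v"
  shows "(\<Sum>i\<in>{..<r} - J. P i w) \<in> Sp (\<Sum>i\<in>{..<r} - J. P i v)"
  using assms(1-3)
proof (induction J rule: finite_induct)
  case empty
  then show ?case using assms(4) by (simp add: sum_P)
next
  case (insert j J)
  let ?Q = "\<lambda>J v. \<Sum>i\<in>{..<r} - J. P i v"
  have j: "j < r" using insert.prems by auto
  have step: "?Q (insert j J) v = ?Q J v - P j (?Q J v)" for v
  proof -
    have "P j (?Q J v) = (\<Sum>i\<in>{..<r} - J. if i = j then P j v else 0)"
      unfolding P_sum by (intro sum.cong) (auto simp: P_P)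
    also have "\<dots> = P j v" using j insert.hyps by simp
    finally have 1: "P j (?Q J v) = P j v" .
    have "?Q J v = P j v + (\<Sum>i\<in>({..<r} - J) - {j}. P i v)"
      using j insert.hyps by (intro sum.remove) auto
    moreover have "{..<r} - J - {j} = {..<r} - insert j J" by auto
    ultimately show ?thesis using 1 by simp
  qed
  have "?Q J v \<noteq> 0" using step[of v] insert.prems(2) by (auto simp: P_0)
  then have mem: "?Q J w \<in> Sp (?Q J v)" using insert.IH insert.prems by auto
  have "?Q J v - P j (?Q J v) \<noteq> 0" using insert.prems(2) unfolding step .
  then show ?case unfolding step using Sp_remove j mem by blast
qed

text \<open>Allows the relation that \<open>Sp v\<close> induces between coordinates
  \<open>i\<close> and \<open>j\<close> to be computed from those two components of \<open>v\<close>
  alone.\<close>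

lemma Sp_pair:
  assumes ij: "i < r" "j < r" "i \<noteq> j" and nz: "P i v + P j v \<noteq> 0" and w: "w \<in> Sp v"
  shows "P i w + P j w \<in> Sp (P i v + P j v)"
proof -
  have eq: "{..<r} - ({..<r} - {i, j}) = {i, j}" using ij by auto
  have s: "(\<Sum>k\<in>{..<r} - ({..<r} - {i, j}). P k v) = P i v + P j v" for v
    unfolding eq using ij by simp
  show ?thesis using Sp_restrict[of "{..<r} - {i, j}" v w] nz w unfolding s by auto
qed

text \<open>A nonzero difference \<open>w - w'\<close> without \<open>i\<close>-th component would
  determine the same spread element as \<open>v\<close>, and then \<open>v\<close> would have no
  \<open>i\<close>-th component either.\<close>

lemma P_inj_on_Sp:
  assumes "v \<noteq> 0" "P i v \<noteq> 0" "w \<in> Sp v" "w' \<in> Sp v" "P i w = P i w'"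
  shows "w = w'"
proof (rule ccontr)
  assume "w \<noteq> w'"
  then have nz: "w - w' \<noteq> 0" by simp
  have mem: "w - w' \<in> Sp v" using assms Sp_closed by blast
  then have "Sp (w - w') = Sp v" using Sp_eq Sp(1) assms(1) nz by blast
  then have "v \<in> Sp (w - w')" using Sp(2) assms(1) by simp
  then have "P i v = 0"
    using Sp_zero_component[OF nz, of i v] assms(5) by (simp add: P_diff)
  then show False using assms by simp
qed

lemma P_surj_on_Sp:
  assumes "i < r" "v \<noteq> 0" "P i v \<noteq> 0" "x \<in> E i"
  shows "\<exists>!w. w \<in> Sp v \<and> P i w = x"
proof -
  have "inj_on (P i) (Sp v)" using P_inj_on_Sp[OF assms(2,3)] by (auto intro: inj_onI)
  then have "card (P i ` Sp v) = card (E i)"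
    using cardS Sp(1)[OF assms(2)] frame[OF assms(1)] by (simp add: card_image)
  moreover have "P i ` Sp v \<subseteq> E i" using P_mem assms by auto
  ultimately have "P i ` Sp v = E i" by (intro card_seteq) auto
  then have "x \<in> P i ` Sp v" using assms(4) by simp
  then obtain w where "w \<in> Sp v" "P i w = x" by auto
  then show ?thesis using P_inj_on_Sp[OF assms(2,3)] by (intro ex1I[of _ w]) auto
qed

lemma exists_unit: "\<exists>u. \<forall>i<r. P i u \<noteq> 0"
proof -
  have "\<exists>e. e \<in> E i \<and> e \<noteq> 0" if i: "i < r" for i
  proof (rule ccontr)
    assume "\<not> ?thesis"
    then have "E i \<subseteq> {0}" by auto
    then have "card (E i) \<le> card {0 :: 'a ^ 'd}" by (intro card_mono) auto
    then show False using cardS[OF frame[OF i]] qn by simp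
  qed
  then obtain e where e: "\<And>i. i < r \<Longrightarrow> e i \<in> E i \<and> e i \<noteq> 0" by metis
  have "P i (\<Sum>i<r. e i) = e i" if "i < r" for i
    by (rule P_unique) (use e that in auto)
  then show ?thesis using e by metis
qed

text \<open>A unit point of the frame. The spread element \<open>D\<close> through it serves as the
  diagonal, and \<open>u\<close> becomes the one of the field built on \<open>D\<close>.\<close>

definition u :: "'a ^ 'd" where "u = (SOME u. \<forall>i<r. P i u \<noteq> 0)"

definition D :: "('a ^ 'd) set" where "D = Sp u"

lemma P_u: "i < r \<Longrightarrow> P i u \<noteq> 0"
  using someI_ex[OF exists_unit] by (simp add: u_def)

lemma u0: "u \<noteq> 0"
  using P_u[of 0] r by (auto simp: P_0)

lemma D_closed:
  "u \<in> D" "0 \<in> D" "v \<in> D \<Longrightarrow> w \<in> D \<Longrightarrow> v + w \<in> D"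
  "v \<in> D \<Longrightarrow> w \<in> D \<Longrightarrow> v - w \<in> D" "v \<in> D \<Longrightarrow> c *s v \<in> D"
  using Sp_closed[OF u0] Sp(2)[OF u0] by (auto simp: D_def)

lemma D_S: "D \<in> S" and card_D: "card D = q ^ n"
  using Sp(1)[OF u0] cardS by (auto simp: D_def)

lemma Sp_D: "x \<in> D \<Longrightarrow> x \<noteq> 0 \<Longrightarrow> Sp x = D"
  using Sp_eq[OF D_S] .

lemma P_D_eq_0: "i < r \<Longrightarrow> x \<in> D \<Longrightarrow> P i x = 0 \<longleftrightarrow> x = 0"
  using P_inj_on_Sp[OF u0 P_u, of i x 0] D_closed(2) by (auto simp: D_def P_0)

text \<open>All \<open>E i\<close> are identified with \<open>D\<close> along the projections \<open>P i\<close>; \<open>crd i v\<close> is the \<open>i\<close>-th coordinate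
  of \<open>v\<close> with values in \<open>D\<close>.\<close>

definition crd :: "nat \<Rightarrow> 'a ^ 'd \<Rightarrow> 'a ^ 'd" where
  "crd i v = (THE w. w \<in> D \<and> P i w = P i v)"

lemma crd:
  assumes "i < r"
  shows "crd i v \<in> D" "P i (crd i v) = P i v"
  using theI'[OF P_surj_on_Sp[OF assms u0 P_u[OF assms] P_mem[OF assms, of v]]]
  by (auto simp: crd_def D_def)

lemma crd_eq: "i < r \<Longrightarrow> w \<in> D \<Longrightarrow> P i w = P i v \<Longrightarrow> crd i v = w"
  using P_inj_on_Sp[OF u0 P_u, of i "crd i v" w] crd[of i v] by (simp add: D_def)

lemma crd_D: "i < r \<Longrightarrow> v \<in> D \<Longrightarrow> crd i v = v"
  by (rule crd_eq) auto

lemma crd_cong: "i < r \<Longrightarrow> P i v = P i w \<Longrightarrow> crd i v = crd i w"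
  by (rule crd_eq) (auto simp: crd)

lemma linear_crd: "i < r \<Longrightarrow> linear_op (crd i)"
  unfolding linear_op_def by (auto intro!: crd_eq simp: crd D_closed P_add P_scale)

lemma crd_eq_0_iff: "i < r \<Longrightarrow> crd i v = 0 \<longleftrightarrow> P i v = 0"
  using crd[of i v] P_D_eq_0[of i "crd i v"] by (simp add: P_0)

lemma sum_P_crd: "(\<Sum>i<r. P i (crd i v)) = v"
  using sum_P[of v] by (simp add: crd)

section \<open>Linear maps whose graphs lie in the spread\<close>

definition lift :: "nat \<Rightarrow> 'a ^ 'd \<Rightarrow> 'a ^ 'd \<Rightarrow> 'a ^ 'd" where
  "lift i v w = (THE w'. w' \<in> Sp v \<and> P i w' = P i w)"

text \<open>For \<open>P i v \<noteq> 0\<close>, the slope of \<open>Sp v\<close> from coordinate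
  \<open>i\<close> to coordinate \<open>j\<close>, with values transported to \<open>D\<close>. It
  depends on its argument only through the \<open>i\<close>-th component.\<close>

definition M :: "nat \<Rightarrow> nat \<Rightarrow> 'a ^ 'd \<Rightarrow> 'a ^ 'd \<Rightarrow> 'a ^ 'd" where
  "M i j v w = crd j (lift i v w)"

lemma lift:
  assumes "i < r" "P i v \<noteq> 0"
  shows "lift i v w \<in> Sp v" "P i (lift i v w) = P i w"
proof -
  have "v \<noteq> 0" using assms by (auto simp: P_0)
  from theI'[OF P_surj_on_Sp[OF assms(1) this assms(2) P_mem[OF assms(1), of w]]]
  show "lift i v w \<in> Sp v" "P i (lift i v w) = P i w" by (auto simp: lift_def)
qed

lemma M_apply:
  assumes "i < r" "P i v \<noteq> 0" "w' \<in> Sp v" "P i w' = P i w"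
  shows "M i j v w = crd j w'"
proof -
  have "v \<noteq> 0" using assms by (auto simp: P_0)
  then have "lift i v w = w'"
    using P_inj_on_Sp[OF _ assms(2)] lift[OF assms(1,2), of w] assms by metis
  then show ?thesis by (simp add: M_def)
qed

lemma linear_M:
  assumes ij: "i < r" "j < r" and v: "P i v \<noteq> 0"
  shows "linear_op (M i j v)"
proof -
  have v0: "v \<noteq> 0" using v by (auto simp: P_0)
  note l = lift[OF ij(1) v]
  have "M i j v (w + w') = M i j v w + M i j v w'" for w w'
    using M_apply[OF ij(1) v Sp_closed(2)[OF v0 l(1)[of w] l(1)[of w']], of "w + w'" j]
    by (simp add: P_add l M_def linear_op_add[OF linear_crd[OF ij(2)]])
  moreover have "M i j v (c *s w) = c *s M i j v w" for c w
    using M_apply[OF ij(1) v Sp_closed(4)[OF v0 l(1)[of w]], of c "c *s w" j]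
    by (simp add: P_scale l M_def linear_op_scale[OF linear_crd[OF ij(2)]])
  ultimately show ?thesis by (simp add: linear_op_def)
qed

lemma P_pair:
  assumes "i < r" "j < r" "i \<noteq> j"
  shows "P i (P i x + P j y) = P i x" "P j (P i x + P j y) = P j y"
  using assms by (auto simp: P_add P_P)

lemma M_pair:
  assumes ij: "i < r" "j < r" "i \<noteq> j" and v: "P i v \<noteq> 0"
  shows "M i j v = M i j (P i v + P j v)"
proof
  fix w
  let ?v = "P i v + P j v"
  let ?w = "lift i v w"
  note l = lift[OF ij(1) v]
  note Pv = P_pair[OF ij]
  have nz: "?v \<noteq> 0" using Pv(1)[of v v] v by (auto simp: P_0)
  have "P i ?w + P j ?w \<in> Sp ?v" using Sp_pair[OF ij nz l(1)] .
  then have "M i j ?v w = crd j (P i ?w + P j ?w)"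
    by (intro M_apply) (use ij v Pv l in auto)
  also have "\<dots> = crd j ?w" using ij Pv by (intro crd_cong) auto
  finally show "M i j v w = M i j ?v w" by (simp add: M_def)
qed

text \<open>The slope from coordinate \<open>i\<close> to coordinate \<open>j\<close> that takes
  \<open>x\<close> to \<open>y\<close>, for \<open>x\<close>, \<open>y\<close> in \<open>D\<close>
  with \<open>x\<close> nonzero.\<close>

definition \<rho> :: "nat \<Rightarrow> nat \<Rightarrow> 'a ^ 'd \<Rightarrow> 'a ^ 'd \<Rightarrow> 'a ^ 'd \<Rightarrow> 'a ^ 'd" where
  "\<rho> i j x y = M i j (P i x + P j y)"

lemma M_eq_\<rho>:
  assumes "i < r" "j < r" "i \<noteq> j" "P i v \<noteq> 0"
  shows "M i j v = \<rho> i j (crd i v) (crd j v)"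
  using M_pair[OF assms] assms by (simp add: \<rho>_def crd)

lemma linear_\<rho>: "i < r \<Longrightarrow> j < r \<Longrightarrow> i \<noteq> j \<Longrightarrow> x \<in> D \<Longrightarrow> x \<noteq> 0 \<Longrightarrow> linear_op (\<rho> i j x y)"
  unfolding \<rho>_def by (rule linear_M) (auto simp: P_pair P_D_eq_0)

lemma \<rho>_mem: "j < r \<Longrightarrow> \<rho> i j x y w \<in> D"
  by (simp add: \<rho>_def M_def crd)

lemma \<rho>_cong: "P i w = P i w' \<Longrightarrow> \<rho> i j x y w = \<rho> i j x y w'"
  by (simp add: \<rho>_def M_def lift_def)

lemma \<rho>_apply:
  assumes "i < r" "j < r" "i \<noteq> j" "x \<in> D" "x \<noteq> 0" "y \<in> D"
  shows "\<rho> i j x y x = y"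
proof -
  let ?v = "P i x + P j y"
  have v: "P i ?v \<noteq> 0" using assms by (simp add: P_pair P_D_eq_0)
  then have "?v \<in> Sp ?v" by (intro Sp(2)) (auto simp: P_0)
  then have "\<rho> i j x y x = crd j ?v"
    unfolding \<rho>_def using assms v by (intro M_apply) (auto simp: P_pair)
  also have "\<dots> = y" using assms by (intro crd_eq) (auto simp: P_pair)
  finally show ?thesis .
qed

text \<open>All three slopes are read off one spread element, through the vector with coordinates
  \<open>x\<close>, \<open>y\<close>, \<open>z\<close> in places \<open>i\<close>, \<open>j\<close>,
  \<open>k\<close>.\<close>

lemma \<rho>_comp:
  assumes ijk: "i < r" "j < r" "k < r" "i \<noteq> j" "j \<noteq> k" "i \<noteq> k"
    and xyz: "x \<in> D" "x \<noteq> 0" "y \<in> D" "y \<noteq> 0" "z \<in> D"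
  shows "\<rho> j k y z (\<rho> i j x y w) = \<rho> i k x z w"
proof -
  define v where "v = P i x + P j y + P k z"
  have Pv: "P i v = P i x" "P j v = P j y" "P k v = P k z"
    using ijk by (auto simp: v_def P_add P_P)
  have Xv: "crd i v = x" "crd j v = y" "crd k v = z"
    using ijk xyz Pv by (auto intro!: crd_eq)
  have nz: "P i v \<noteq> 0" "P j v \<noteq> 0" using ijk xyz Pv P_D_eq_0 by auto
  let ?w = "lift i v w"
  note l = lift[OF ijk(1) nz(1)]
  have "\<rho> i j x y w = crd j ?w"
    using fun_cong[OF M_eq_\<rho>[OF ijk(1,2,4) nz(1)], of w] unfolding Xv M_def by simp
  moreover have "\<rho> j k y z (crd j ?w) = crd k ?w"
    using M_eq_\<rho>[OF ijk(2,3,5) nz(2)] Xv M_apply[OF ijk(2) nz(2) l(1)[of w], of "crd j ?w" k]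
    by (simp add: crd ijk)
  moreover have "\<rho> i k x z w = crd k ?w"
    using fun_cong[OF M_eq_\<rho>[OF ijk(1,3,6) nz(1)], of w] unfolding Xv M_def by simp
  ultimately show ?thesis by simp
qed

text \<open>The diagonal \<open>D\<close> contains \<open>x\<close>, so its slopes, which are
  identities on \<open>D\<close>, are the ones taking \<open>x\<close> to itself.\<close>

lemma \<rho>_same:
  assumes ij: "i < r" "j < r" "i \<noteq> j" and x: "x \<in> D" "x \<noteq> 0"
  shows "\<rho> i j x x w = crd i w"
proof -
  let ?v = "P i x + P j x"
  have v: "P i ?v \<noteq> 0" using assms by (simp add: P_pair P_D_eq_0)
  then have nz: "?v \<noteq> 0" by (auto simp: P_0)
  have "crd i w \<in> Sp x" using crd ij Sp_D[OF x] by simp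
  then have "P i (crd i w) + P j (crd i w) \<in> Sp ?v" by (rule Sp_pair[OF ij nz])
  then have "\<rho> i j x x w = crd j (P i (crd i w) + P j (crd i w))"
    unfolding \<rho>_def using ij v by (intro M_apply) (auto simp: P_pair crd)
  also have "\<dots> = crd i w" using ij by (intro crd_eq) (auto simp: P_pair crd)
  finally show ?thesis .
qed

lemma \<rho>_zero:
  assumes ij: "i < r" "j < r" "i \<noteq> j" and x: "x \<in> D" "x \<noteq> 0"
  shows "\<rho> i j x 0 w = 0"
proof -
  let ?v = "P i x + P j 0"
  have v: "P i ?v \<noteq> 0" "P j ?v = 0" using assms by (simp_all add: P_pair P_D_eq_0) (simp add: P_0)
  then have nz: "?v \<noteq> 0" by (auto simp: P_0)
  have "P j (lift i ?v w) = 0"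
    using Sp_zero_component[OF nz v(2) lift(1)[OF ij(1) v(1)]] .
  then show ?thesis using ij by (simp add: \<rho>_def M_def crd_eq_0_iff)
qed

text \<open>Composition with the identity slope from \<open>i\<close> to \<open>j\<close> changes
  the source; the target is changed in the same way below, with \<open>z = 0\<close> apart because
  \<open>\<rho>_comp\<close> then gives no slope out of \<open>j\<close>.\<close>

lemma \<rho>_change_source:
  assumes ijk: "i < r" "j < r" "k < r" "i \<noteq> k" "j \<noteq> k"
    and "x \<in> D" "x \<noteq> 0" "z \<in> D" "w \<in> D"
  shows "\<rho> i k x z w = \<rho> j k x z w"
proof (cases "i = j")
  case False
  then show ?thesis
    using \<rho>_comp[of i j k x x z w] \<rho>_same[of i j x w] assms by (simp add: crd_D)
qed simp

lemma \<rho>_change_target: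
  assumes ijk: "i < r" "j < r" "k < r" "i \<noteq> k" "i \<noteq> j"
    and "x \<in> D" "x \<noteq> 0" "z \<in> D" "w \<in> D"
  shows "\<rho> i j x z w = \<rho> i k x z w"
proof (cases "j = k \<or> z = 0")
  case True
  then show ?thesis using assms \<rho>_zero by auto
next
  case False
  then show ?thesis
    using \<rho>_comp[of i j k x z z w] \<rho>_same[of j k z "\<rho> i j x z w"] assms by (simp add: crd_D \<rho>_mem)
qed

definition \<tau> :: "'a ^ 'd \<Rightarrow> 'a ^ 'd \<Rightarrow> 'a ^ 'd \<Rightarrow> 'a ^ 'd" where
  "\<tau> = \<rho> 0 1"

lemma r012: "0 < r" "1 < r" "2 < r"
  using r by auto

lemma \<rho>_eq_\<tau>:
  assumes "i < r" "j < r" "i \<noteq> j" "x \<in> D" "x \<noteq> 0" "z \<in> D" "w \<in> D"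
  shows "\<rho> i j x z w = \<tau> x z w"
proof -
  \<comment> \<open>The index pair travels from \<open>(i, j)\<close> over \<open>(i, k)\<close> and
    \<open>(0, k)\<close> to \<open>(0, 1)\<close>; \<open>k\<close> avoids \<open>i\<close> and
    \<open>0\<close> so that no pair on the way is degenerate.\<close>
  obtain k where k: "k < r" "k \<noteq> i" "k \<noteq> 0"
    using r012 by (cases "i = 1") (auto intro: that[of 1] that[of 2])
  have "\<rho> i j x z w = \<rho> i k x z w" using assms k by (intro \<rho>_change_target) auto
  also have "\<dots> = \<rho> 0 k x z w" using assms k r012 by (intro \<rho>_change_source) auto
  also have "\<dots> = \<rho> 0 1 x z w" using assms k r012 by (intro \<rho>_change_target) auto
  finally show ?thesis by (simp add: \<tau>_def)
qed

lemma \<tau>_crd: "\<tau> x y (crd 0 w) = \<tau> x y w"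
  unfolding \<tau>_def by (rule \<rho>_cong) (simp add: crd r012)

lemma \<tau>_mem: "\<tau> x y w \<in> D"
  using r012 by (simp add: \<tau>_def \<rho>_mem)

lemma \<tau>_apply: "x \<in> D \<Longrightarrow> x \<noteq> 0 \<Longrightarrow> y \<in> D \<Longrightarrow> \<tau> x y x = y"
  using r012 by (simp add: \<tau>_def \<rho>_apply)

lemma linear_\<tau>: "x \<in> D \<Longrightarrow> x \<noteq> 0 \<Longrightarrow> linear_op (\<tau> x y)"
  using r012 by (simp add: \<tau>_def linear_\<rho>)

lemma \<tau>_comp:
  assumes "x \<in> D" "x \<noteq> 0" "y \<in> D" "y \<noteq> 0" "z \<in> D" "w \<in> D"
  shows "\<tau> y z (\<tau> x y w) = \<tau> x z w"
proof -
  have "\<tau> y z (\<tau> x y w) = \<rho> 1 2 y z (\<rho> 0 1 x y w)"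
    using assms r012 \<tau>_mem[of x y w] \<rho>_eq_\<tau>[of 1 2 y z "\<tau> x y w"] by (simp add: \<tau>_def)
  also have "\<dots> = \<rho> 0 2 x z w" using assms r012 by (intro \<rho>_comp) auto
  also have "\<dots> = \<tau> x z w" using assms r012 by (intro \<rho>_eq_\<tau>) auto
  finally show ?thesis .
qed

text \<open>The vector with coordinates \<open>w\<close> and \<open>\<tau> x y w\<close> lies in the
  spread element that is the graph of \<open>\<tau> x y\<close>, and any nonzero vector determines
  its spread element. This gives sharp transitivity.\<close>

lemma \<tau>_unique:
  assumes x: "x \<in> D" "x \<noteq> 0" and y: "y \<in> D" and w: "w \<in> D" "w \<noteq> 0"
  shows "\<tau> w (\<tau> x y w) = \<tau> x y"
proof -
  define v where "v = P 0 x + P 1 y"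
  have v: "P 0 v = P 0 x" "P 1 v = P 1 y" using r012 by (auto simp: v_def P_add P_P)
  have nz: "P 0 v \<noteq> 0" using v x r012 P_D_eq_0 by auto
  then have v0: "v \<noteq> 0" by (auto simp: P_0)
  let ?w = "lift 0 v w"
  define v' where "v' = P 0 ?w + P 1 ?w"
  note l = lift[OF r012(1) nz]
  have t: "\<tau> x y w = crd 1 ?w" by (simp add: \<tau>_def \<rho>_def M_def v_def)
  then have v'_eq: "v' = P 0 w + P 1 (\<tau> x y w)" using r012 by (simp add: v'_def l crd)
  have "v' \<in> Sp (P 0 v + P 1 v)"
    unfolding v'_def using r012 v0 l v by (intro Sp_pair) (auto simp: v_def)
  then have "v' \<in> Sp v" using v by (simp add: v_def)
  moreover have "v' \<noteq> 0"
  proof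
    assume "v' = 0"
    then have "P 0 v' = 0" by (simp add: P_0)
    then show False using r012 w P_D_eq_0 by (simp add: v'_eq P_pair)
  qed
  ultimately have "Sp v' = Sp v" using Sp_eq Sp(1)[OF v0] by blast
  then have "M 0 1 v' = M 0 1 v" by (simp add: M_def[abs_def] lift_def[abs_def])
  then show ?thesis by (simp add: \<tau>_def \<rho>_def v'_eq v_def)
qed

text \<open>Left multiplication by \<open>y\<close>: the slope that takes the unit \<open>u\<close>
  to \<open>y\<close>.\<close>

definition \<mu> :: "'a ^ 'd \<Rightarrow> 'a ^ 'd \<Rightarrow> 'a ^ 'd" where
  "\<mu> = \<tau> u"

lemma linear_\<mu>: "linear_op (\<mu> y)"
  using linear_\<tau>[OF D_closed(1) u0] by (simp add: \<mu>_def)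

lemma \<mu>_mem: "\<mu> y w \<in> D"
  by (simp add: \<mu>_def \<tau>_mem)

lemma \<mu>_u: "y \<in> D \<Longrightarrow> \<mu> y u = y"
  using \<tau>_apply[OF D_closed(1) u0] by (simp add: \<mu>_def)

lemma \<mu>_crd: "\<mu> y (crd 0 w) = \<mu> y w"
  by (simp add: \<mu>_def \<tau>_crd)

lemma \<mu>_zero: "\<mu> 0 w = 0"
  using \<rho>_zero[OF r012(1,2) _ D_closed(1) u0] by (simp add: \<mu>_def \<tau>_def)

lemma \<mu>_one: "\<mu> u = crd 0"
  using \<rho>_same[OF r012(1,2) _ D_closed(1) u0] by (simp add: \<mu>_def \<tau>_def fun_eq_iff)

lemma \<mu>_eq_\<tau>: "y \<in> D \<Longrightarrow> x \<in> D \<Longrightarrow> x \<noteq> 0 \<Longrightarrow> \<mu> y = \<tau> x (\<mu> y x)"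
  using \<tau>_unique[OF D_closed(1) u0] by (simp add: \<mu>_def)

lemma \<tau>_eq_\<mu>: "x \<in> D \<Longrightarrow> x \<noteq> 0 \<Longrightarrow> y \<in> D \<Longrightarrow> \<tau> x y = \<mu> (\<tau> x y u)"
  using \<tau>_unique[OF _ _ _ D_closed(1) u0] by (simp add: \<mu>_def)

lemma \<mu>_comp:
  assumes "y \<in> D" "z \<in> D"
  shows "\<mu> z \<circ> \<mu> y = \<mu> (\<mu> z y)"
proof
  fix w
  show "(\<mu> z \<circ> \<mu> y) w = \<mu> (\<mu> z y) w"
  proof (cases "y = 0")
    case True
    then show ?thesis using linear_op_zero[OF linear_\<mu>] by (simp add: \<mu>_zero)
  next
    case False
    \<comment> \<open>By uniqueness \<open>\<mu> z\<close> is also the slope taking \<open>y\<close>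
      to \<open>\<mu> z y\<close>, so \<open>y\<close> becomes the intermediate point of a
      composition of slopes.\<close>
    have "\<mu> z (\<mu> y (crd 0 w)) = \<tau> y (\<mu> z y) (\<tau> u y (crd 0 w))"
      using \<mu>_eq_\<tau>[OF assms(2,1) False] by (simp add: \<mu>_def)
    also have "\<dots> = \<mu> (\<mu> z y) (crd 0 w)"
      using \<tau>_comp[OF D_closed(1) u0 assms(1) False \<mu>_mem crd(1)[OF r012(1)]] by (simp add: \<mu>_def)
    finally show ?thesis by (simp add: \<mu>_crd)
  qed
qed

lemma \<mu>_eq_0_iff:
  assumes "y \<in> D" "x \<in> D"
  shows "\<mu> y x = 0 \<longleftrightarrow> y = 0 \<or> x = 0"
proof
  assume *: "\<mu> y x = 0"
  show "y = 0 \<or> x = 0"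
  proof (rule ccontr)
    assume nz: "\<not> (y = 0 \<or> x = 0)"
    then have "\<mu> y = \<tau> x 0" "x \<noteq> 0" using \<mu>_eq_\<tau>[OF assms] * by auto
    then have "\<mu> y u = 0" using \<rho>_zero[OF r012(1,2) _ assms(2)] by (simp add: \<tau>_def)
    then show False using \<mu>_u[OF assms(1)] nz by simp
  qed
qed (auto simp: \<mu>_zero linear_op_zero[OF linear_\<mu>])

lemma \<mu>_inverse:
  assumes "y \<in> D" "y \<noteq> 0"
  obtains z where "z \<in> D" "z \<noteq> 0" "\<mu> z y = u"
proof -
  let ?z = "\<tau> y u u"
  have "\<mu> ?z y = u" using \<tau>_eq_\<mu>[OF assms D_closed(1)] \<tau>_apply[OF assms D_closed(1)] by simp
  moreover from this have "?z \<noteq> 0" using u0 \<mu>_zero by metis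
  ultimately show ?thesis using that \<tau>_mem by blast
qed

lemma \<mu>_free:
  assumes "y \<in> D" "z \<in> D" "w \<in> D" "w \<noteq> 0" "\<mu> y w = \<mu> z w"
  shows "\<mu> y = \<mu> z"
  using \<mu>_eq_\<tau>[OF assms(1,3,4)] \<mu>_eq_\<tau>[OF assms(2,3,4)] assms(5) by simp

lemma group_\<mu>: "group \<lparr>carrier = \<mu> ` (D - {0}), monoid.mult = (\<circ>), one = crd 0\<rparr>"
proof (rule groupI; simp)
  show "crd 0 \<in> \<mu> ` (D - {0})" using \<mu>_one D_closed(1) u0 by (metis Diff_iff image_eqI singletonD)
  fix f assume "f \<in> \<mu> ` (D - {0})"
  then obtain y where y: "f = \<mu> y" "y \<in> D" "y \<noteq> 0" by auto
  show "crd 0 \<circ> f = f" using y r012 by (auto simp: fun_eq_iff crd_D \<mu>_mem)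
  obtain z where z: "z \<in> D" "z \<noteq> 0" "\<mu> z y = u" using \<mu>_inverse[OF y(2,3)] .
  then show "\<exists>g\<in>D - {0}. \<mu> g \<circ> f = crd 0"
    using \<mu>_comp[OF y(2) z(1)] y \<mu>_one by (intro bexI[of _ z]) auto
  fix g assume "g \<in> \<mu> ` (D - {0})"
  then obtain z where z: "g = \<mu> z" "z \<in> D" "z \<noteq> 0" by auto
  have "f \<circ> g = \<mu> (\<mu> y z)" using \<mu>_comp y z by simp
  then show "f \<circ> g \<in> \<mu> ` (D - {0})" using \<mu>_mem \<mu>_eq_0_iff y z by simp
qed (simp add: comp_assoc)

lemma inj_on_\<mu>: "inj_on \<mu> D"
  by (rule inj_on_inverseI[of _ "\<lambda>f. f u"]) (rule \<mu>_u)

end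

section \<open>Coordinates over the field on the diagonal\<close>

locale coprime_normal_frame = normal_frame S E q n r
  for S :: "('a::{field,finite} ^ 'd) set set" and E :: "nat \<Rightarrow> ('a ^ 'd) set" and q n r :: nat +
  assumes coprime: "prime s \<Longrightarrow> s dvd n \<Longrightarrow> \<not> s dvd q ^ n - 1"
begin

lemma \<mu>_comm_comp:
  assumes "y \<in> D" "z \<in> D"
  shows "\<mu> y \<circ> \<mu> z = \<mu> z \<circ> \<mu> y"
proof (cases "y = 0 \<or> z = 0")
  case True
  then show ?thesis using linear_op_zero[OF linear_\<mu>] by (auto simp: fun_eq_iff \<mu>_zero)
next
  case False
  show ?thesis
  proof (rule free_linear_group_comm[where q = q and n = n and \<pi> = "crd 0" and G = "\<mu> ` (D - {0})"])
    show "group \<lparr>carrier = \<mu> ` (D - {0}), monoid.mult = (\<circ>), one = crd 0\<rparr>" by (rule group_\<mu>)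
    show "linear_op g" if "g \<in> \<mu> ` (D - {0})" for g using that linear_\<mu> by auto
    show "g = h" if gh: "g \<in> \<mu> ` (D - {0})" "h \<in> \<mu> ` (D - {0})" "v \<noteq> 0" "crd 0 v = v" "g v = h v" for g h v
    proof -
      have "v \<in> D" using crd(1)[OF r012(1), of v] gh(4) by simp
      then show ?thesis using gh \<mu>_free by auto
    qed
    have "card (\<mu> ` (D - {0})) = card (D - {0})"
      by (rule card_image, rule inj_on_subset[OF inj_on_\<mu>]) auto
    then show "card (\<mu> ` (D - {0})) = q ^ n - 1" using D_closed(2) card_D by simp
    have "range (crd 0) = D"
    proof (intro equalityI subsetI)
      fix v assume "v \<in> D"
      then show "v \<in> range (crd 0)" using crd_D[OF r012(1), of v] by (intro range_eqI[of _ _ v]) simp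
    qed (use crd(1)[OF r012(1)] in auto)
    then show "card (range (crd 0)) = q ^ n" using card_D by simp
  qed (use q n coprime assms False in auto)
qed

lemma \<mu>_commute: "y \<in> D \<Longrightarrow> z \<in> D \<Longrightarrow> \<mu> y (\<mu> z w) = \<mu> z (\<mu> y w)"
  using \<mu>_comm_comp by (metis comp_apply)

lemma \<mu>_sym: "y \<in> D \<Longrightarrow> z \<in> D \<Longrightarrow> \<mu> y z = \<mu> z y"
  using \<mu>_commute[of y z u] by (simp add: \<mu>_u)

text \<open>With \<open>x\<close> a nonzero coordinate of \<open>v\<close>, another coordinate is
  \<open>\<mu> t x\<close>, and the corresponding one of a vector of \<open>Sp v\<close> is
  \<open>\<mu> t (\<mu> y x)\<close>. Commutativity moves \<open>y\<close> to the front, so the same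
  \<open>y\<close> scales all coordinates; cardinalities give the other inclusion.\<close>

lemma Sp_coords:
  assumes v: "v \<noteq> 0"
  shows "Sp v = (\<lambda>y. \<Sum>i<r. P i (\<mu> y (crd i v))) ` D"
proof -
  obtain k where k: "k < r" "P k v \<noteq> 0" using v eq_0_iff_P by blast
  let ?x = "crd k v"
  have x: "?x \<in> D" "?x \<noteq> 0" using k crd crd_eq_0_iff by auto
  have "Sp v \<subseteq> (\<lambda>y. \<Sum>i<r. P i (\<mu> y (crd i v))) ` D"
  proof
    fix w' assume w': "w' \<in> Sp v"
    let ?w = "crd k w'"
    have w: "?w \<in> D" using crd k by blast
    define y where "y = \<tau> ?x ?w u"
    have yD: "y \<in> D" by (simp add: y_def \<tau>_mem)
    have yx: "\<mu> y ?x = ?w" using \<tau>_eq_\<mu>[OF x w] \<tau>_apply[OF x w] by (simp add: y_def)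
    have "crd i w' = \<mu> y (crd i v)" if i: "i < r" for i
    proof (cases "i = k")
      case False
      have Xi: "crd i v \<in> D" using crd i by blast
      define t where "t = \<tau> ?x (crd i v) u"
      have tD: "t \<in> D" by (simp add: t_def \<tau>_mem)
      have t: "\<tau> ?x (crd i v) = \<mu> t" using \<tau>_eq_\<mu>[OF x Xi] by (simp add: t_def)
      have "crd i w' = M k i v ?w" using k i w' by (intro M_apply[symmetric]) (auto simp: crd)
      also have "\<dots> = \<rho> k i ?x (crd i v) ?w" using M_eq_\<rho>[OF k(1) i _ k(2)] False by simp
      also have "\<dots> = \<mu> t (\<mu> y ?x)" using \<rho>_eq_\<tau>[OF k(1) i _ x Xi w] False t yx by simp
      also have "\<dots> = \<mu> y (\<mu> t ?x)" using \<mu>_commute tD yD by blast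
      also have "\<mu> t ?x = crd i v" using \<tau>_apply[OF x Xi] t by simp
      finally show ?thesis .
    qed (use yx in simp)
    then have "w' = (\<Sum>i<r. P i (\<mu> y (crd i v)))" using sum_P_crd[of w'] by simp
    then show "w' \<in> (\<lambda>y. \<Sum>i<r. P i (\<mu> y (crd i v))) ` D" using yD by blast
  qed
  moreover have "card ((\<lambda>y. \<Sum>i<r. P i (\<mu> y (crd i v))) ` D) \<le> card (Sp v)"
    using card_image_le[of D "\<lambda>y. \<Sum>i<r. P i (\<mu> y (crd i v))"] card_D cardS Sp(1)[OF v] by simp
  ultimately show ?thesis by (intro card_seteq) auto
qed

definition K :: "('a ^ 'd) ring" where
  "K = \<lparr>carrier = D, monoid.mult = \<mu>, one = u, ring.zero = 0, add = (+)\<rparr>"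

lemma K_simps:
  "carrier K = D" "x \<otimes>\<^bsub>K\<^esub> y = \<mu> x y" "\<one>\<^bsub>K\<^esub> = u" "\<zero>\<^bsub>K\<^esub> = 0" "x \<oplus>\<^bsub>K\<^esub> y = x + y"
  by (simp_all add: K_def)

lemma field_K: "field K"
proof -
  have one: "\<mu> u x = x" if "x \<in> D" for x using that r012 by (simp add: \<mu>_one crd_D)
  have add: "\<mu> x (y + z) = \<mu> x y + \<mu> x z" for x y z by (rule linear_op_add[OF linear_\<mu>])
  have cring: "cring K"
  proof (intro cringI abelian_groupI comm_monoidI, unfold K_simps)
    fix x assume x: "x \<in> D"
    show "\<exists>y\<in>D. y + x = 0" using x D_closed(4)[OF D_closed(2) x] by (intro bexI[of _ "- x"]) auto
    fix y assume y: "y \<in> D"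
    fix z assume z: "z \<in> D"
    show "\<mu> (\<mu> x y) z = \<mu> x (\<mu> y z)" using \<mu>_comp[OF y x] by (metis comp_apply)
    \<comment> \<open>Linearity of slopes gives distributivity in the second argument only; the
      first needs commutativity.\<close>
    show "\<mu> (x + y) z = \<mu> x z + \<mu> y z"
      using add[of z x y] \<mu>_sym x y z D_closed(3) by simp
  qed (auto simp: D_closed \<mu>_mem one \<mu>_u \<mu>_sym add_ac)
  interpret cring K by (rule cring)
  show ?thesis
  proof (rule cring_fieldI, intro equalityI subsetI)
    fix x assume x: "x \<in> carrier K - {\<zero>\<^bsub>K\<^esub>}"
    then obtain z where z: "z \<in> D" "\<mu> z x = u" using \<mu>_inverse[of x] by (auto simp: K_simps)
    then show "x \<in> Units K" using x \<mu>_sym[of x z] by (auto simp: Units_def K_simps)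
  next
    fix x assume "x \<in> Units K"
    then obtain z where "x \<in> D" "\<mu> z x = u" by (auto simp: Units_def K_simps)
    then show "x \<in> carrier K - {\<zero>\<^bsub>K\<^esub>}"
      using u0 linear_op_zero[OF linear_\<mu>] by (auto simp: K_simps)
  qed
qed

lemma \<mu>_scalar:
  assumes "z \<in> D"
  shows "\<mu> (c *s u) z = c *s z"
  using \<mu>_sym[OF D_closed(5)[OF D_closed(1)] assms, of c]
  by (simp add: linear_op_scale[OF linear_\<mu>] \<mu>_u assms)

theorem desarguesian: "desarguesian_spread n r S"
proof -
  interpret K: field K by (rule field_K)
  \<comment> \<open>An arbitrary numbering of \<open>D\<close>, transporting the field
    \<open>K\<close> to natural numbers as \<open>desarguesian_spread\<close> demands.\<close>
  obtain b :: "'a ^ 'd \<Rightarrow> nat" where inj: "inj_on b D"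
    using ex_bij_betw_finite_nat[of D] by (auto simp: bij_betw_def)
  define L where "L = image_ring b K"
  define b' where "b' = inv_into D b"
  have b'b: "b' (b x) = x" if "x \<in> D" for x using inj that by (simp add: b'_def)
  have carL: "carrier L = b ` D" by (simp add: L_def image_ring_carrier K_simps)
  have b'D: "b' x \<in> D" and bb': "b (b' x) = x" if "x \<in> b ` D" for x
    using that by (auto simp: b'_def inv_into_into f_inv_into_f)
  have L_add: "x \<oplus>\<^bsub>L\<^esub> y = b (b' x + b' y)" and L_mult: "x \<otimes>\<^bsub>L\<^esub> y = b (\<mu> (b' x) (b' y))"
    and L_zero: "\<zero>\<^bsub>L\<^esub> = b 0" for x y
    by (simp_all add: L_def image_ring_def image_group_def monoid.defs K_simps b'_def)
  have fieldL: "field L" unfolding L_def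
    using inj by (intro K.inj_imp_image_ring_is_field) (simp add: K_simps)
  have cardL: "card (carrier L) = CARD('a) ^ n"
    using card_image[OF inj] card_D q by (simp add: carL)
  \<comment> \<open>The ground field is embedded as the multiples of \<open>u\<close>; by
    \<open>\<mu>_scalar\<close> multiplication by \<open>c *s u\<close> is scaling by
    \<open>c\<close>.\<close>
  define \<iota> where "\<iota> c = b (c *s u)" for c :: 'a
  have \<iota>hom: "\<iota> \<in> ring_hom (ring_of_type_algebra :: 'a ring) L"
  proof (rule ring_hom_memI)
    show "\<iota> c \<in> carrier L" for c using D_closed by (simp add: \<iota>_def carL)
    show "\<iota> (c \<otimes>\<^bsub>ring_of_type_algebra\<^esub> c') = \<iota> c \<otimes>\<^bsub>L\<^esub> \<iota> c'" for c c'
      using D_closed by (simp add: \<iota>_def L_mult b'b \<mu>_scalar ring_of_type_algebra_def vector_smult_assoc)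
    show "\<iota> (c \<oplus>\<^bsub>ring_of_type_algebra\<^esub> c') = \<iota> c \<oplus>\<^bsub>L\<^esub> \<iota> c'" for c c'
      using D_closed by (simp add: \<iota>_def L_add b'b ring_of_type_algebra_def vector_sadd_rdistrib)
    show "\<iota> \<one>\<^bsub>ring_of_type_algebra\<^esub> = \<one>\<^bsub>L\<^esub>"
      by (simp add: \<iota>_def ring_of_type_algebra_def L_def image_ring_one K_simps)
  qed
  define f where "f v = (\<Sum>i<r. P i (b' (v i)))" for v :: "nat \<Rightarrow> nat"
  have cs: "v i \<in> b ` D" if "v \<in> coord_space L r" "i < r" for v i
    using that by (auto simp: coord_space_def carL PiE_iff)
  have P_sum_D: "P i (\<Sum>i<r. P i (x i)) = P i (x i)" if "i < r" for x i
    by (rule P_unique) (use that P_mem in auto)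
  have Xf: "crd i (f v) = b' (v i)" if "v \<in> coord_space L r" "i < r" for v i
    using that b'D cs by (intro crd_eq) (auto simp: f_def P_sum_D)
  define g where "g w = (\<lambda>i\<in>{..<r}. b (crd i w))" for w
  have g_mem: "g w \<in> coord_space L r" for w using crd by (auto simp: g_def coord_space_def carL)
  have fg: "f (g w) = w" for w using sum_P_crd[of w] crd by (simp add: f_def g_def b'b)
  have gf: "g (f v) = v" if v: "v \<in> coord_space L r" for v
  proof
    fix i
    show "g (f v) i = v i"
      using v cs[OF v] bb' by (cases "i < r") (auto simp: g_def Xf coord_space_def PiE_iff extensional_def)
  qed
  have bij: "bij_betw f (coord_space L r) UNIV"
    using g_mem fg gf by (intro bij_betwI[of f _ _ g]) auto
  have f_scale: "f (coord_scale L r c v) = (\<Sum>i<r. P i (\<mu> (b' c) (crd i (f v))))"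
    if "v \<in> coord_space L r" for v c
    unfolding f_def[of "coord_scale L r c v"]
    using that \<mu>_mem by (simp add: coord_scale_def L_mult b'b Xf)
  have frm: "field_reduction_map L \<iota> r f"
    unfolding field_reduction_map_def
  proof (intro conjI ballI allI)
    show "bij_betw f (coord_space L r) UNIV" by (rule bij)
    fix v assume v: "v \<in> coord_space L r"
    show "f (coord_add L r v w) = f v + f w" if w: "w \<in> coord_space L r" for w
      using v w cs b'D by (simp add: f_def coord_add_def L_add b'b D_closed P_add sum.distrib)
    show "f (coord_scale L r (\<iota> c) v) = c *s f v" for c
    proof -
      have "f (coord_scale L r (\<iota> c) v) = (\<Sum>i<r. P i (c *s crd i (f v)))"
        using f_scale[OF v] crd D_closed by (simp add: \<iota>_def b'b \<mu>_scalar)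
      also have "\<dots> = c *s (\<Sum>i<r. P i (crd i (f v)))" by (simp add: P_scale vec.scale_sum_right)
      finally show ?thesis by (simp add: sum_P_crd)
    qed
  qed
  have f0: "f v = 0 \<longleftrightarrow> v = coord_zero L r" if v: "v \<in> coord_space L r" for v
  proof -
    have z: "coord_zero L r \<in> coord_space L r"
      using D_closed by (auto simp: coord_zero_def coord_space_def carL L_zero)
    have "f (coord_zero L r) = 0" using D_closed by (simp add: f_def coord_zero_def L_zero b'b P_0)
    then show ?thesis using gf[OF v] gf[OF z] by metis
  qed
  have line: "f ` {coord_scale L r c v | c. c \<in> carrier L} = Sp (f v)"
    if v: "v \<in> coord_space L r" "v \<noteq> coord_zero L r" for v
  proof -
    have "f ` {coord_scale L r c v | c. c \<in> carrier L} = (\<lambda>c. f (coord_scale L r c v)) ` b ` D"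
      by (auto simp: carL)
    also have "\<dots> = (\<lambda>y. \<Sum>i<r. P i (\<mu> y (crd i (f v)))) ` D"
      unfolding image_image using f_scale[OF v(1)] b'b by (intro image_cong) auto
    also have "\<dots> = Sp (f v)" using Sp_coords f0[OF v(1)] v(2) by simp
    finally show ?thesis .
  qed
  have "S = field_reduction_spread L r f"
  proof (intro equalityI subsetI)
    fix F assume F: "F \<in> S"
    obtain w where w: "w \<in> F" "w \<noteq> 0"
    proof -
      have "\<not> F \<subseteq> {0}" using card_mono[of "{0}" F] cardS[OF F] qn by auto
      then show ?thesis using that by blast
    qed
    have "g w \<noteq> coord_zero L r" using f0[OF g_mem] fg w by metis
    then have "f ` {coord_scale L r c (g w) | c. c \<in> carrier L} = F"
      using line[OF g_mem] fg Sp_eq[OF F w] by simp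
    then show "F \<in> field_reduction_spread L r f"
      using g_mem \<open>g w \<noteq> _\<close> unfolding field_reduction_spread_def one_dim_subspaces_def by blast
  next
    fix F assume "F \<in> field_reduction_spread L r f"
    then obtain v where v: "v \<in> coord_space L r" "v \<noteq> coord_zero L r"
      and F: "F = f ` {coord_scale L r c v | c. c \<in> carrier L}"
      unfolding field_reduction_spread_def one_dim_subspaces_def by blast
    then show "F \<in> S" using line[OF v] Sp(1) f0[OF v(1)] by simp
  qed
  \<comment> \<open>The identification \<open>f\<close> already carries the lines onto
    \<open>S\<close> itself, so the projectivity is the identity.\<close>
  then have "projectively_equivalent S (field_reduction_spread L r f)"
    unfolding projectively_equivalent_def by (intro exI[of _ id]) (simp add: vec.linear_id)
  then show ?thesis
    unfolding desarguesian_spread_def using fieldL cardL \<iota>hom frm by blast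
qed

end

section \<open>Reduction of the stated hypotheses to a frame and a coprimality condition\<close>

theorem theorem4p2:
  fixes q n r :: nat
    and S :: "('a::{field,finite} ^ 'd) set set"
  assumes "primepow q" and "CARD('a) = q"
    and "n \<ge> 1" and "r > 2"
    and "CARD('d) = r * n"
    and "\<And>k. k dvd n \<Longrightarrow> k < n \<Longrightarrow>
           \<not> dickson_number_pair (q ^ k) (n div k) \<and>
           (q ^ k, n div k) \<notin> {(5, 2), (7, 2), (11, 2), (23, 2), (29, 2), (59, 2)}"
    and "spread n S"
    and "\<exists>A. card A = r \<and> (\<forall>E\<in>A. normal_element S E) \<and> general_position r A"
  shows "desarguesian_spread n r S"
proof -
  obtain A where A: "card A = r" "\<And>E. E \<in> A \<Longrightarrow> normal_element S E" "vec.span (\<Union>A) = UNIV"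
    using assms(8) by (auto simp: general_position_def)
  have "finite A" using A(1) assms(4) by (intro card_ge_0_finite) simp
  then obtain E where E: "bij_betw E {..<r} A"
    using ex_bij_betw_nat_finite[of A] A(1) by (auto simp: atLeast0LessThan)
  have EA: "E i \<in> A" if "i < r" for i using E that by (auto simp: bij_betw_def)
  have sub: "vec.subspace F" "vec.dim F = n" if "F \<in> S" for F
    using assms(7) that by (auto simp: spread_def vsubspaces_def)
  note part = partitions_points_iff[OF vec.subspace_UNIV sub(1), of S]
  have sp: "partitions_points UNIV S" using assms(7) by (simp add: spread_def)
  have nor: "normal_element S (E i)" if "i < r" for i using A(2) EA that by blast
  interpret coprime_normal_frame S E q n r
  proof
    show "CARD('a) = q" "primepow q" "n > 0" "r > 2" "CARD('d) = r * n" using assms by auto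
    show "vec.subspace F" if "F \<in> S" for F using sub that by blast
    show "card F = q ^ n" if "F \<in> S" for F using card_subspace sub[OF that] assms(2) by metis
    show "\<exists>F\<in>S. v \<in> F" if "v \<noteq> 0" for v using part(2)[OF _ sp _ that] by simp
    show "F = F'" if "F \<in> S" "F' \<in> S" "v \<in> F" "v \<in> F'" "v \<noteq> 0" for F F' v
      using part(3)[OF _ sp that] by simp
    show "E i \<in> S" if "i < r" for i using nor[OF that] by (simp add: normal_element_def)
    show "\<exists>c\<in>E i. \<exists>d\<in>F. w = c + d"
      if h: "i < r" "F \<in> S" "F \<noteq> E i" "a \<in> E i" "b \<in> F" "F' \<in> S" "a + b \<in> F'" "a + b \<noteq> 0" "w \<in> F'"
      for i F a b F' w
    proof -
      let ?U = "vec.span (E i \<union> F)"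
      obtain T where T: "T \<subseteq> S" "partitions_points ?U T"
        using nor[OF h(1)] h(2,3) by (auto simp: normal_element_def)
      note partT = partitions_points_iff[OF vec.subspace_span sub(1) T(2)]
      have ab: "a + b \<in> ?U" using h(4,5) by (intro vec.span_add) (auto intro: vec.span_base)
      obtain F'' where F'': "F'' \<in> T" "a + b \<in> F''" using partT(2)[OF _ ab h(8)] T(1) by blast
      \<comment> \<open>The member of \<open>T\<close> through \<open>a + b\<close> is the unique
        spread element there, so \<open>F'\<close> is contained in the span.\<close>
      then have "F'' = F'" using part(3)[OF _ sp, of F'' F' "a + b"] T(1) h by blast
      then have "w \<in> ?U" using partT(1)[OF _ F''(1)] T(1) h(9) by blast
      moreover have "vec.span (E i) = E i" "vec.span F = F"
        using sub(1)[OF h(2)] nor[OF h(1)] sub(1) by (auto simp: normal_element_def)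
      ultimately show ?thesis by (auto simp: vec.span_Un)
    qed
    show "\<exists>x. (\<forall>i<r. x i \<in> E i) \<and> v = (\<Sum>i<r. x i)" for v
    proof -
      let ?W = "{v. \<exists>x. (\<forall>i<r. x i \<in> E i) \<and> v = (\<Sum>i<r. x i)}"
      have Esub: "vec.subspace (E i)" if "i < r" for i
        using nor[OF that] sub(1) by (auto simp: normal_element_def)
      have "vec.subspace ?W"
      proof (rule vec.subspaceI)
        show "0 \<in> ?W" using Esub vec.subspace_0 by (auto intro!: exI[of _ "\<lambda>_. 0"])
        show "v + w \<in> ?W" if vw: "v \<in> ?W" "w \<in> ?W" for v w
        proof -
          obtain x y where "\<forall>i<r. x i \<in> E i" "v = (\<Sum>i<r. x i)" "\<forall>i<r. y i \<in> E i" "w = (\<Sum>i<r. y i)"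
            using vw by blast
          then show ?thesis using Esub
            by (auto intro!: exI[of _ "\<lambda>i. x i + y i"] vec.subspace_add simp: sum.distrib)
        qed
        show "c *s v \<in> ?W" if v: "v \<in> ?W" for c v
        proof -
          obtain x where "\<forall>i<r. x i \<in> E i" "v = (\<Sum>i<r. x i)" using v by blast
          then show ?thesis using Esub
            by (auto intro!: exI[of _ "\<lambda>i. c *s x i"] vec.subspace_scale simp: vec.scale_sum_right)
        qed
      qed
      moreover have "\<Union>A \<subseteq> ?W"
      proof
        fix v assume "v \<in> \<Union>A"
        then obtain i where i: "i < r" "v \<in> E i" using E by (auto simp: bij_betw_def)
        then have "v = (\<Sum>j<r. if j = i then v else 0)" by simp
        moreover have "\<forall>j<r. (if j = i then v else 0) \<in> E j" using i Esub vec.subspace_0 by auto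
        ultimately show "v \<in> ?W" by (intro CollectI exI[of _ "\<lambda>j. if j = i then v else 0"] conjI)
      qed
      ultimately have "vec.span (\<Union>A) \<subseteq> ?W" by (rule vec.span_minimal[rotated])
      then have "v \<in> ?W" unfolding A(3) by (rule subsetD) (rule UNIV_I)
      then show ?thesis by (rule CollectD)
    qed
    show "\<not> s dvd q ^ n - 1" if s: "prime s" "s dvd n" for s
    proof
      assume dvd: "s dvd q ^ n - 1"
      \<comment> \<open>The hypothesis is applied to the divisor \<open>k\<close> with prime
        quotient \<open>s\<close>.\<close>
      obtain k where k: "n = s * k" using s(2) by blast
      have k0: "k > 0" using k assms(3) by (auto intro: Nat.gr0I)
      have s2: "s \<ge> 2" using s(1) by (rule prime_ge_2_nat)
      have q0: "q > 0" using assms(1) primepow_gt_0_nat by blast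
      have "s dvd q ^ k - 1"
      proof -
        have qn_eq: "q ^ n = q ^ k * (q ^ k) ^ (s - 1)"
          using s2 by (simp add: k power_mult[symmetric] power_add[symmetric] mult.commute[of s] flip: mult_Suc_right)
        have "\<not> s dvd q ^ k"
        proof
          assume "s dvd q ^ k"
          then have "s dvd q ^ n" unfolding qn_eq by (rule dvd_mult2)
          then have "s dvd q ^ n - (q ^ n - 1)" using dvd by (rule dvd_diff_nat)
          then show False using q0 s2 by simp
        qed
        \<comment> \<open>As \<open>q ^ n\<close> is the \<open>s\<close>-th power of
          \<open>q ^ k\<close>, Fermat makes the two congruent modulo \<open>s\<close>.\<close>
        then have 1: "[q ^ k * (q ^ k) ^ (s - 1) = q ^ k * 1] (mod s)"
          by (intro cong_mult cong_refl fermat_theorem[OF s(1)])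
        have 2: "[q ^ k * (q ^ k) ^ (s - 1) = 1] (mod s)"
          using dvd q0 unfolding qn_eq[symmetric] by (simp add: cong_altdef_nat)
        have "[q ^ k = 1] (mod s)" using cong_trans[OF cong_sym[OF 1] 2] by simp
        then show ?thesis using q0 by (simp add: cong_altdef_nat)
      qed
      then have "dickson_number_pair (q ^ k) s"
        unfolding dickson_number_pair_def
      proof (intro conjI allI impI)
        show "q ^ k > 0" "s > 0" using q0 s2 by auto
        obtain p h where "prime p" "h > 0" "q = p ^ h" using assms(1) by (auto simp: primepow_def)
        then show "primepow (q ^ k)" using k0
          unfolding primepow_def by (intro exI[of _ p] exI[of _ "h * k"]) (simp add: power_mult)
        show "p dvd q ^ k - 1" if "prime p \<and> p dvd s" for p
          using that \<open>s dvd q ^ k - 1\<close> s(1) primes_dvd_imp_eq by blast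
        \<comment> \<open>A prime is never divisible by \<open>4\<close>, so the third condition on
          Dickson pairs holds whatever \<open>q ^ k\<close> is modulo \<open>4\<close>.\<close>
        show "s mod 4 \<noteq> 0"
        proof
          assume "s mod 4 = 0"
          then have "2 dvd s" "s \<noteq> 2" by auto
          then show False using s(1) primes_dvd_imp_eq two_is_prime_nat by blast
        qed
      qed
      moreover have "k dvd n" "k < n" "n div k = s" using k k0 s2 by auto
      ultimately show False using assms(6) by metis
    qed
  qed
  show ?thesis by (rule desarguesian)
qed

end
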